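(* Let $(A,\Delta)$ be an algebraic C$^{*}$-bialgebra and let $\mathcal{S}_{0}$ be a non-empty subset of the state space $\mathcal{S}(A)$ such that: (a) $\mathcal{S}_{0}$ is closed under the operation $\omega_{1}\star\omega_{2}\equiv(\omega_{1}\otimes\omega_{2})\circ\Delta$, and the semigroup $(\mathcal{S}_{0},\star)$ is abelian; (b) for any $\omega_{1},\omega_{2}\in\mathcal{S}_{0}$, the vector $\Omega_{\omega_{1}}\otimes\Omega_{\omega_{2}}$ is cyclic for the representation $(\mathcal{H}_{\omega_{1}}\otimes\mathcal{H}_{\omega_{2}},\ \pi_{\omega_{1}}\star\pi_{\omega_{2}})$ of $A$, where $\pi_{\omega_{1}}\star\pi_{\omega_{2}}\equiv(\pi_{\omega_{1}}\otimes\pi_{\omega_{2}})\circ\Delta$. Then for every $\omega_{1},\omega_{2}\in\mathcal{S}_{0}$ the formula $$R(\omega_{1},\omega_{2})\,\Lambda_{\omega_{1},\omega_{2}}(\Delta(x))\equiv\Lambda_{\omega_{1},\omega_{2}}(\Delta^{op}(x))\qquad(x\in A)$$ gives a well-defined unitary operator $R(\omega_{1},\omega_{2})$ from $\mathcal{H}_{\omega_{1}}\otimes\mathcal{H}_{\omega_{2}}$ to $\mathcal{H}_{\omega_{1}}\otimes\mathcal{H}_{\omega_{2}}$, and the following hold: (i) For any $\omega_{1},\omega_{2}\in\mathcal{S}_{0}$ and $x\in A$, $$R(\omega_{1},\omega_{2})\,(\pi_{\omega_{1}}\otimes\pi_{\omega_{2}})(\Delta(x))\,(R(\omega_{1},\omega_{2}))^{*}=(\pi_{\omega_{1}}\otimes\pi_{\omega_{2}})(\Delta^{op}(x)),$$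 $$R(\omega_{1},\omega_{2})\,\tau_{\omega_{2},\omega_{1}}\,R(\omega_{2},\omega_{1})\,\tau_{\omega_{1},\omega_{2}}=I_{\omega_{1}}\otimes I_{\omega_{2}}.$$ (ii) For any $\omega_{1},\omega_{2}\in\mathcal{S}_{0}$, the representations $\pi_{\omega_{1}}\star\pi_{\omega_{2}}$ and $\pi_{\omega_{2}}\star\pi_{\omega_{1}}$ of $A$ are unitarily equivalent. (iii) For any $\omega_{1},\omega_{2},\omega_{3}\in\mathcal{S}_{0}$, the following identity holds on $\mathcal{H}_{\omega_{1}}\otimes\mathcal{H}_{\omega_{2}}\otimes\mathcal{H}_{\omega_{3}}$: $$R_{12}(\omega_{1},\omega_{2})\,R_{13}(\omega_{1},\omega_{3})\,R_{23}(\omega_{2},\omega_{3})=R_{23}(\omega_{2},\omega_{3})\,R_{13}(\omega_{1},\omega_{3})\,R_{12}(\omega_{1},\omega_{2}).$$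
   Context: **C$^{*}$-bialgebras.** For C$^{*}$-algebras, $\otimes$ denotes the minimal C$^{*}$-tensor product, $\odot$ the algebraic tensor product, and $M(\cdot)$ the multiplier algebra. C$^{*}$-algebras need not be unital. A $*$-homomorphism $f:A\to M(B)$ is nondegenerate if $f(A)B$ is dense in $B$. A C$^{*}$-bialgebra is a pair $(A,\Delta)$ where $A$ is a C$^{*}$-algebra and $\Delta:A\to M(A\otimes A)$ is a nondegenerate $*$-homomorphism (the comultiplication) satisfying $(\Delta\otimes id)\circ\Delta=(id\otimes\Delta)\circ\Delta$. The C$^{*}$-bialgebra $(A,\Delta)$ is *algebraic* if there is a dense $*$-subalgebra $A_{0}$ of $A$ with $\Delta(A_{0})\subset A_{0}\odot A_{0}$. (In that case $\Delta(A)\subset A\otimes A$ by continuity.) The opposite comultiplication is $\Delta^{op}\equiv\tilde{\tau}_{A,A}\circ\Delta$, where $\tilde{\tau}_{A,A}$ is the extension to $M(A\otimes A)$ of the flip $\tau_{A,A}(x\otimes y)=y\otimes x$ of $A\otimes A$, given by $\tilde{\tau}_{A,A}(X)(x\otimes y)=\tau_{A,A}(X(y\otimes x))$ for $X\in M(A\otimes A)$, $x,y\in A$. **States and GNS.** $\mathcal{S}(A)$ is the set of all states of $A$. For $\omega_{1},\omega_{2}\in\mathcal{S}(A)$, $\omega_{1}\otimes\omega_{2}$ is the product state of $A\otimes A$ with $(\omega_{1}\otimes\omega_{2})(x\otimes y)=\omega_{1}(x)\omega_{2}(y)$. For $\omega\in\mathcal{S}(A)$, $(\mathcal{H}_{\omega},\pi_{\omega},\Omega_{\omega})$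 is the GNS triple of $\omega$, $I_{\omega}$ is the identity operator on $\mathcal{H}_{\omega}$, and the GNS map is $\Lambda_{\omega}:A\to\mathcal{H}_{\omega}$, $\Lambda_{\omega}(x)\equiv\pi_{\omega}(x)\Omega_{\omega}$. Further, $\Lambda_{\omega_{1},\omega_{2}}\equiv\Lambda_{\omega_{1}}\otimes\Lambda_{\omega_{2}}$, i.e. $\Lambda_{\omega_{1},\omega_{2}}(X)=(\pi_{\omega_{1}}\otimes\pi_{\omega_{2}})(X)(\Omega_{\omega_{1}}\otimes\Omega_{\omega_{2}})$ for $X\in A\otimes A$. **Flips and leg numbering.** $\tau_{\omega_{1},\omega_{2}}:\mathcal{H}_{\omega_{1}}\otimes\mathcal{H}_{\omega_{2}}\to\mathcal{H}_{\omega_{2}}\otimes\mathcal{H}_{\omega_{1}}$ is the flip $\xi\otimes\eta\mapsto\eta\otimes\xi$. On $\mathcal{H}_{\omega_{1}}\otimes\mathcal{H}_{\omega_{2}}\otimes\mathcal{H}_{\omega_{3}}$, $R_{ij}(\omega_{i},\omega_{j})$ is the operator acting as $R(\omega_{i},\omega_{j})$ on the $i$-th and $j$-th tensor factors and as the identity on the remaining factor: $R_{12}(\omega_{1},\omega_{2})=R(\omega_{1},\omega_{2})\otimes I_{\omega_{3}}$, $R_{23}(\omega_{2},\omega_{3})=I_{\omega_{1}}\otimes R(\omega_{2},\omega_{3})$, and $R_{13}(\omega_{1},\omega_{3})=(I_{\omega_{1}}\otimes\tau_{\omega_{3},\omega_{2}})(R(\omega_{1},\omega_{3})\otimes I_{\omega_{2}})(I_{\omega_{1}}\otimes\tau_{\omega_{2},\omega_{3}})$.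 *)

theory Defs
  imports "HOL-Analysis.Analysis"
begin

section \<open>Complex vector spaces, C*-algebras, Hilbert spaces\<close>

class complex_vector = real_vector +
  fixes scaleC :: "complex \<Rightarrow> 'a \<Rightarrow> 'a"  (infixr "*\<^sub>C" 75)
  assumes scaleC_of_real: "complex_of_real r *\<^sub>C x = r *\<^sub>R x"
    and scaleC_add_right: "c *\<^sub>C (x + y) = c *\<^sub>C x + c *\<^sub>C y"
    and scaleC_add_left: "(c + d) *\<^sub>C x = c *\<^sub>C x + d *\<^sub>C x"
    and scaleC_scaleC: "c *\<^sub>C (d *\<^sub>C x) = (c * d) *\<^sub>C x"

instantiation complex :: complex_vector
begin

definition scaleC_complex :: "complex \<Rightarrow> complex \<Rightarrow> complex" where
  "scaleC_complex = (*)"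

instance
  by standard (simp_all add: scaleC_complex_def algebra_simps scaleR_conv_of_real)

end

class cstar_algebra = complex_vector + real_normed_algebra + banach +
  fixes star :: "'a \<Rightarrow> 'a"
  assumes scaleC_mult_left: "(c *\<^sub>C x) * y = c *\<^sub>C (x * y)"
    and scaleC_mult_right: "x * (c *\<^sub>C y) = c *\<^sub>C (x * y)"
    and norm_scaleC: "norm (c *\<^sub>C x) = cmod c * norm x"
    and star_star: "star (star x) = x"
    and star_add: "star (x + y) = star x + star y"
    and star_scaleC: "star (c *\<^sub>C x) = cnj c *\<^sub>C star x"
    and star_mult: "star (x * y) = star y * star x"
    and norm_star_mult_self: "norm (star x * x) = (norm x)\<^sup>2"

text \<open>Complex Hilbert spaces; the inner product is conjugate-linear in the first argument.\<close>

class chilbert_space = complex_vector + banach +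
  fixes cinner :: "'a \<Rightarrow> 'a \<Rightarrow> complex"
  assumes cinner_commute: "cinner x y = cnj (cinner y x)"
    and cinner_add_right: "cinner x (y + z) = cinner x y + cinner x z"
    and cinner_scaleC_right: "cinner x (c *\<^sub>C y) = c * cinner x y"
    and cinner_self: "cinner x x = complex_of_real ((norm x)\<^sup>2)"

definition clinear_on :: "'a::complex_vector set \<Rightarrow> ('a \<Rightarrow> 'b::complex_vector) \<Rightarrow> bool" where
  "clinear_on H f \<longleftrightarrow>
     (\<forall>x\<in>H. \<forall>y\<in>H. f (x + y) = f x + f y) \<and> (\<forall>c. \<forall>x\<in>H. f (c *\<^sub>C x) = c *\<^sub>C f x)"

definition cbilinear :: "('a::complex_vector \<Rightarrow> 'b::complex_vector \<Rightarrow> 'c::complex_vector) \<Rightarrow> bool" where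
  "cbilinear f \<longleftrightarrow> (\<forall>y. clinear_on UNIV (\<lambda>x. f x y)) \<and> (\<forall>x. clinear_on UNIV (\<lambda>y. f x y))"

definition csubspace :: "'a::complex_vector set \<Rightarrow> bool" where
  "csubspace H \<longleftrightarrow> subspace H \<and> (\<forall>c. \<forall>x\<in>H. c *\<^sub>C x \<in> H)"


section \<open>Bounded operators\<close>

text \<open>
  All Hilbert spaces that depend on states are closed subspaces of ambient Hilbert spaces given
  by types. A bounded operator from the closed subspace \<open>H\<close> to the closed subspace \<open>K\<close> is encoded
  as a total function which vanishes outside \<open>H\<close>, so that equality of operators is equality of
  functions, their product is composition, and the operator norm is \<open>onorm\<close>.
\<close>

definition bops :: "'h::chilbert_space set \<Rightarrow> 'k::chilbert_space set \<Rightarrow> ('h \<Rightarrow> 'k) set" where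
  "bops H K = {T. T ` H \<subseteq> K \<and> clinear_on H T \<and> (\<exists>C. \<forall>x\<in>H. norm (T x) \<le> C * norm x) \<and>
     (\<forall>x. x \<notin> H \<longrightarrow> T x = 0)}"

definition id_op :: "'h::chilbert_space set \<Rightarrow> 'h \<Rightarrow> 'h" where
  "id_op H = (\<lambda>x. if x \<in> H then x else 0)"

definition adj_op :: "'h::chilbert_space set \<Rightarrow> 'k::chilbert_space set \<Rightarrow> ('h \<Rightarrow> 'k) \<Rightarrow> 'k \<Rightarrow> 'h" where
  "adj_op H K T = (THE S. S \<in> bops K H \<and> (\<forall>x\<in>H. \<forall>y\<in>K. cinner (T x) y = cinner x (S y)))"

definition unitary_op :: "'h::chilbert_space set \<Rightarrow> 'k::chilbert_space set \<Rightarrow> ('h \<Rightarrow> 'k) \<Rightarrow> bool" where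
  "unitary_op H K U \<longleftrightarrow>
     U \<in> bops H K \<and> U ` H = K \<and> (\<forall>x\<in>H. \<forall>y\<in>H. cinner (U x) (U y) = cinner x y)"


section \<open>Hilbert space tensor products\<close>

text \<open>
  \<open>hilbert_tensor s\<close>: the type \<open>'l\<close> together with \<open>s \<xi> \<eta>\<close>, to be read \<open>\<xi> \<otimes> \<eta>\<close>, is the Hilbert
  space tensor product of the types \<open>'h\<close> and \<open>'k\<close>. The set of elementary tensors is closed
  under complex scalars, so here and below the real \<open>span\<close> is the complex one.
\<close>

definition hilbert_tensor ::
  "('h::chilbert_space \<Rightarrow> 'k::chilbert_space \<Rightarrow> 'l::chilbert_space) \<Rightarrow> bool" where
  "hilbert_tensor s \<longleftrightarrow> cbilinear s \<and>
     (\<forall>x y x' y'. cinner (s x y) (s x' y') = cinner x x' * cinner y y') \<and>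
     closure (span {s x y | x y. True}) = UNIV"

definition tensor_space ::
  "('h::chilbert_space \<Rightarrow> 'k::chilbert_space \<Rightarrow> 'l::chilbert_space) \<Rightarrow> 'h set \<Rightarrow> 'k set \<Rightarrow> 'l set" where
  "tensor_space s H K = closure (span {s x y | x y. x \<in> H \<and> y \<in> K})"

definition tensor_op ::
  "('h::chilbert_space \<Rightarrow> 'k::chilbert_space \<Rightarrow> 'l::chilbert_space) \<Rightarrow>
     'h set \<Rightarrow> 'k set \<Rightarrow> ('h \<Rightarrow> 'h) \<Rightarrow> ('k \<Rightarrow> 'k) \<Rightarrow> 'l \<Rightarrow> 'l" where
  "tensor_op s H K S T =
     (THE U. U \<in> bops (tensor_space s H K) UNIV \<and> (\<forall>x\<in>H. \<forall>y\<in>K. U (s x y) = s (S x) (T y)))"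

definition flip_op ::
  "('h::chilbert_space \<Rightarrow> 'h \<Rightarrow> 'k::chilbert_space) \<Rightarrow> 'h set \<Rightarrow> 'h set \<Rightarrow> 'k \<Rightarrow> 'k" where
  "flip_op s H K =
     (THE U. U \<in> bops (tensor_space s H K) (tensor_space s K H) \<and>
        (\<forall>x\<in>H. \<forall>y\<in>K. U (s x y) = s y x))"

text \<open>Threefold tensor powers: \<open>s21 (\<xi> \<otimes> \<eta>) \<zeta>\<close> and \<open>s12 \<xi> (\<eta> \<otimes> \<zeta>)\<close> are identified.\<close>

definition hilbert_tensor3 ::
  "('h::chilbert_space \<Rightarrow> 'h \<Rightarrow> 'k::chilbert_space) \<Rightarrow> ('k \<Rightarrow> 'h \<Rightarrow> 'l::chilbert_space) \<Rightarrow>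
     ('h \<Rightarrow> 'k \<Rightarrow> 'l) \<Rightarrow> bool" where
  "hilbert_tensor3 s s21 s12 \<longleftrightarrow>
     hilbert_tensor s \<and> hilbert_tensor s21 \<and> hilbert_tensor s12 \<and>
     (\<forall>x y z. s21 (s x y) z = s12 x (s y z))"


section \<open>Representations, states, GNS triples\<close>

definition star_rep ::
  "'h::chilbert_space set \<Rightarrow> ('a::cstar_algebra \<Rightarrow> 'h \<Rightarrow> 'h) \<Rightarrow> bool" where
  "star_rep H \<pi> \<longleftrightarrow> csubspace H \<and> closed H \<and> (\<forall>a. \<pi> a \<in> bops H H) \<and>
     (\<forall>a b. \<pi> (a + b) = (\<lambda>x. \<pi> a x + \<pi> b x)) \<and>
     (\<forall>c a. \<pi> (c *\<^sub>C a) = (\<lambda>x. c *\<^sub>C \<pi> a x)) \<and>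
     (\<forall>a b. \<pi> (a * b) = \<pi> a \<circ> \<pi> b) \<and>
     (\<forall>a. \<forall>x\<in>H. \<forall>y\<in>H. cinner (\<pi> a x) y = cinner x (\<pi> (star a) y))"

definition cyclic_vector ::
  "'h::chilbert_space set \<Rightarrow> ('a \<Rightarrow> 'h \<Rightarrow> 'h) \<Rightarrow> 'h \<Rightarrow> bool" where
  "cyclic_vector H \<pi> v \<longleftrightarrow> v \<in> H \<and> closure (range (\<lambda>a. \<pi> a v)) = H"

definition unitarily_equivalent ::
  "'h::chilbert_space set \<Rightarrow> ('a \<Rightarrow> 'h \<Rightarrow> 'h) \<Rightarrow> 'k::chilbert_space set \<Rightarrow> ('a \<Rightarrow> 'k \<Rightarrow> 'k) \<Rightarrow> bool" where
  "unitarily_equivalent H \<pi> K \<rho> \<longleftrightarrow> (\<exists>U. unitary_op H K U \<and> (\<forall>a. U \<circ> \<pi> a = \<rho> a \<circ> U))"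

definition states :: "('a::cstar_algebra \<Rightarrow> complex) set" where
  "states = {\<omega>. clinear_on UNIV \<omega> \<and> (\<forall>a. \<omega> (star a * a) \<in> \<real>\<^sub>\<ge>\<^sub>0) \<and>
     bounded_linear \<omega> \<and> onorm \<omega> = 1}"

definition gns_triple ::
  "('a::cstar_algebra \<Rightarrow> complex) \<Rightarrow> 'h::chilbert_space set \<Rightarrow> ('a \<Rightarrow> 'h \<Rightarrow> 'h) \<Rightarrow> 'h \<Rightarrow> bool" where
  "gns_triple \<omega> H \<pi> \<Omega> \<longleftrightarrow> star_rep H \<pi> \<and> cyclic_vector H \<pi> \<Omega> \<and>
     (\<forall>a. \<omega> a = cinner \<Omega> (\<pi> a \<Omega>))"

definition gns_reps ::
  "(('a::cstar_algebra \<Rightarrow> complex) \<Rightarrow> 'h set) \<Rightarrow> (('a \<Rightarrow> complex) \<Rightarrow> 'a \<Rightarrow> 'h \<Rightarrow> 'h) \<Rightarrow>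
     ('h set \<times> ('a \<Rightarrow> 'h \<Rightarrow> 'h)) set" where
  "gns_reps H \<pi> = {(H \<omega>, \<pi> \<omega>) | \<omega>. \<omega> \<in> states}"


section \<open>Minimal tensor products of C*-algebras\<close>

text \<open>
  \<open>min_tensor s P Q t\<close>: the type \<open>'c\<close> with \<open>t a b\<close>, to be read \<open>a \<otimes> b\<close>, is the minimal (spatial)
  tensor product of the types \<open>'a\<close> and \<open>'b\<close>. Here \<open>P\<close> and \<open>Q\<close> are sets of representations of \<open>'a\<close>
  and \<open>'b\<close> whose direct sums are faithful (e.g. the GNS representations of all states). The
  spatial norm is the norm of the image of the algebraic tensor product under (direct sum of
  \<open>P\<close>) \<open>\<otimes>\<close> (direct sum of \<open>Q\<close>), i.e. the supremum of the norms of the images under \<open>\<pi> \<otimes> \<rho>\<close> with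
  \<open>\<pi>\<close> in \<open>P\<close> and \<open>\<rho>\<close> in \<open>Q\<close>. The \<open>0\<close> only matters if \<open>P\<close> or \<open>Q\<close> is empty (zero algebras).
\<close>

definition min_tensor ::
  "('h::chilbert_space \<Rightarrow> 'k::chilbert_space \<Rightarrow> 'l::chilbert_space) \<Rightarrow>
     ('h set \<times> ('a \<Rightarrow> 'h \<Rightarrow> 'h)) set \<Rightarrow> ('k set \<times> ('b \<Rightarrow> 'k \<Rightarrow> 'k)) set \<Rightarrow>
     ('a::cstar_algebra \<Rightarrow> 'b::cstar_algebra \<Rightarrow> 'c::cstar_algebra) \<Rightarrow> bool" where
  "min_tensor s P Q t \<longleftrightarrow> cbilinear t \<and>
     (\<forall>a b a' b'. t a b * t a' b' = t (a * a') (b * b')) \<and>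
     (\<forall>a b. star (t a b) = t (star a) (star b)) \<and>
     closure (span {t a b | a b. True}) = UNIV \<and>
     (\<forall>(n::nat) a b. norm (\<Sum>i<n. t (a i) (b i)) =
        Sup (insert 0 {onorm (\<lambda>z. \<Sum>i<n. tensor_op s H K (\<pi> (a i)) (\<rho> (b i)) z) | H \<pi> K \<rho>.
                         (H, \<pi>) \<in> P \<and> (K, \<rho>) \<in> Q}))"

definition tensor_rep ::
  "('h::chilbert_space \<Rightarrow> 'k::chilbert_space \<Rightarrow> 'l::chilbert_space) \<Rightarrow>
     ('a::cstar_algebra \<Rightarrow> 'b::cstar_algebra \<Rightarrow> 'c::cstar_algebra) \<Rightarrow>
     'h set \<Rightarrow> ('a \<Rightarrow> 'h \<Rightarrow> 'h) \<Rightarrow> 'k set \<Rightarrow> ('b \<Rightarrow> 'k \<Rightarrow> 'k) \<Rightarrow> 'c \<Rightarrow> 'l \<Rightarrow> 'l" where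
  "tensor_rep s t H \<pi> K \<rho> = (THE \<sigma>. star_rep (tensor_space s H K) \<sigma> \<and>
     (\<forall>a b. \<sigma> (t a b) = tensor_op s H K (\<pi> a) (\<rho> b)))"

definition tensor_reps ::
  "('h::chilbert_space \<Rightarrow> 'k::chilbert_space \<Rightarrow> 'l::chilbert_space) \<Rightarrow>
     ('a::cstar_algebra \<Rightarrow> 'b::cstar_algebra \<Rightarrow> 'c::cstar_algebra) \<Rightarrow>
     ('h set \<times> ('a \<Rightarrow> 'h \<Rightarrow> 'h)) set \<Rightarrow> ('k set \<times> ('b \<Rightarrow> 'k \<Rightarrow> 'k)) set \<Rightarrow>
     ('l set \<times> ('c \<Rightarrow> 'l \<Rightarrow> 'l)) set" where
  "tensor_reps s t P Q =
     {(tensor_space s H K, tensor_rep s t H \<pi> K \<rho>) | H \<pi> K \<rho>. (H, \<pi>) \<in> P \<and> (K, \<rho>) \<in> Q}"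

text \<open>
  \<open>'b = 'a \<otimes> 'a\<close> and \<open>'c = ('a \<otimes> 'a) \<otimes> 'a = 'a \<otimes> ('a \<otimes> 'a)\<close>, all minimal. The norm of \<open>'a \<otimes> 'a\<close> is
  by construction the supremum over \<open>tensor_reps s t P P\<close>, so the direct sum of the latter is a
  faithful representation of \<open>'a \<otimes> 'a\<close>.
\<close>

definition min_tensor3 ::
  "('h::chilbert_space \<Rightarrow> 'h \<Rightarrow> 'k::chilbert_space) \<Rightarrow> ('k \<Rightarrow> 'h \<Rightarrow> 'l::chilbert_space) \<Rightarrow>
     ('h \<Rightarrow> 'k \<Rightarrow> 'l) \<Rightarrow> ('h set \<times> ('a \<Rightarrow> 'h \<Rightarrow> 'h)) set \<Rightarrow>
     ('a::cstar_algebra \<Rightarrow> 'a \<Rightarrow> 'b::cstar_algebra) \<Rightarrow> ('b \<Rightarrow> 'a \<Rightarrow> 'c::cstar_algebra) \<Rightarrow>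
     ('a \<Rightarrow> 'b \<Rightarrow> 'c) \<Rightarrow> bool" where
  "min_tensor3 s s21 s12 P t t21 t12 \<longleftrightarrow>
     min_tensor s P P t \<and>
     min_tensor s21 (tensor_reps s t P P) P t21 \<and>
     min_tensor s12 P (tensor_reps s t P P) t12 \<and>
     (\<forall>a b c. t21 (t a b) c = t12 a (t b c))"

definition product_state ::
  "('a::cstar_algebra \<Rightarrow> 'a \<Rightarrow> 'b::cstar_algebra) \<Rightarrow> ('a \<Rightarrow> complex) \<Rightarrow> ('a \<Rightarrow> complex) \<Rightarrow> 'b \<Rightarrow> complex" where
  "product_state t \<omega>1 \<omega>2 = (THE \<phi>. \<phi> \<in> states \<and> (\<forall>a b. \<phi> (t a b) = \<omega>1 a * \<omega>2 b))"

definition star_hom :: "('a::cstar_algebra \<Rightarrow> 'b::cstar_algebra) \<Rightarrow> bool" where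
  "star_hom f \<longleftrightarrow> clinear_on UNIV f \<and> (\<forall>a b. f (a * b) = f a * f b) \<and> (\<forall>a. f (star a) = star (f a))"

definition flip_alg :: "('a::cstar_algebra \<Rightarrow> 'a \<Rightarrow> 'b::cstar_algebra) \<Rightarrow> 'b \<Rightarrow> 'b" where
  "flip_alg t = (THE f. star_hom f \<and> (\<forall>a b. f (t a b) = t b a))"


section \<open>Multiplier algebras\<close>

text \<open>
  \<open>M(B)\<close> is the algebra of double centralizers \<open>(T, S)\<close> of \<open>B\<close>, i.e. pairs of maps with
  \<open>x (T y) = (S x) y\<close>. A double centralizer is determined by its left part \<open>T\<close>, which we use to
  represent it; linearity and boundedness of \<open>T\<close> are automatic. Multiplication in \<open>M(B)\<close> is
  composition, the adjoint \<open>T\<^sup>*\<close> is determined by \<open>(T x)\<^sup>* y = x\<^sup>* (T\<^sup>* y)\<close>, and \<open>y \<in> B\<close> is identified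
  with left multiplication by \<open>y\<close>.
\<close>

definition multipliers :: "('b::cstar_algebra \<Rightarrow> 'b) set" where
  "multipliers = {T. \<exists>S. \<forall>x y. x * T y = S x * y}"

definition of_multiplier :: "('b::cstar_algebra \<Rightarrow> 'b) \<Rightarrow> 'b" where
  "of_multiplier T = (THE y. T = (\<lambda>x. y * x))"

text \<open>Nondegenerate *-homomorphisms \<open>A \<rightarrow> M(B)\<close>, in curried form: \<open>f a x\<close> is the product \<open>f(a)x\<close>.\<close>

definition nondeg_hom :: "('a::cstar_algebra \<Rightarrow> 'b::cstar_algebra \<Rightarrow> 'b) \<Rightarrow> bool" where
  "nondeg_hom f \<longleftrightarrow> (\<forall>a. f a \<in> multipliers) \<and>
     (\<forall>a b. f (a + b) = (\<lambda>x. f a x + f b x)) \<and>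
     (\<forall>c a. f (c *\<^sub>C a) = (\<lambda>x. c *\<^sub>C f a x)) \<and>
     (\<forall>a b. f (a * b) = f a \<circ> f b) \<and>
     (\<forall>a x y. star (f a x) * y = star x * f (star a) y) \<and>
     closure (span {f a x | a x. True}) = UNIV"

text \<open>
  \<open>U \<in> M(C)\<close> is the image of \<open>T \<in> M(B)\<close> under the canonical extension \<open>M(B) \<rightarrow> M(C)\<close> of the
  nondegenerate *-homomorphism \<open>f: B \<rightarrow> M(C)\<close>; it is unique since \<open>f(B)C\<close> is dense.
\<close>

definition extension_maps ::
  "('b::cstar_algebra \<Rightarrow> 'c::cstar_algebra \<Rightarrow> 'c) \<Rightarrow> ('b \<Rightarrow> 'b) \<Rightarrow> ('c \<Rightarrow> 'c) \<Rightarrow> bool" where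
  "extension_maps f T U \<longleftrightarrow> U \<in> multipliers \<and> (\<forall>x z. U (f x z) = f (T x) z)"


section \<open>C*-bialgebras\<close>

text \<open>
  In \<open>coassociative\<close>, \<open>F\<close> and \<open>G\<close> are the nondegenerate *-homomorphisms \<open>\<Delta> \<otimes> id\<close> and \<open>id \<otimes> \<Delta>\<close> from
  \<open>A \<otimes> A\<close> to \<open>M(A \<otimes> A \<otimes> A)\<close>; they exist and are unique for every nondegenerate \<open>\<Delta>\<close>.
\<close>

definition coassociative ::
  "('a::cstar_algebra \<Rightarrow> 'a \<Rightarrow> 'b::cstar_algebra) \<Rightarrow> ('b \<Rightarrow> 'a \<Rightarrow> 'c::cstar_algebra) \<Rightarrow>
     ('a \<Rightarrow> 'b \<Rightarrow> 'c) \<Rightarrow> ('a \<Rightarrow> 'b \<Rightarrow> 'b) \<Rightarrow> bool" where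
  "coassociative t t21 t12 \<Delta> \<longleftrightarrow>
     (\<exists>F G. nondeg_hom F \<and> (\<forall>a b y c. F (t a b) (t21 y c) = t21 (\<Delta> a y) (b * c)) \<and>
            nondeg_hom G \<and> (\<forall>a b c y. G (t a b) (t12 c y) = t12 (a * c) (\<Delta> b y)) \<and>
            (\<forall>a. \<exists>U. extension_maps F (\<Delta> a) U \<and> extension_maps G (\<Delta> a) U))"

definition cstar_bialgebra ::
  "('a::cstar_algebra \<Rightarrow> 'a \<Rightarrow> 'b::cstar_algebra) \<Rightarrow> ('b \<Rightarrow> 'a \<Rightarrow> 'c::cstar_algebra) \<Rightarrow>
     ('a \<Rightarrow> 'b \<Rightarrow> 'c) \<Rightarrow> ('a \<Rightarrow> 'b \<Rightarrow> 'b) \<Rightarrow> bool" where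
  "cstar_bialgebra t t21 t12 \<Delta> \<longleftrightarrow> nondeg_hom \<Delta> \<and> coassociative t t21 t12 \<Delta>"

definition star_subalgebra :: "'a::cstar_algebra set \<Rightarrow> bool" where
  "star_subalgebra A0 \<longleftrightarrow>
     csubspace A0 \<and> (\<forall>a\<in>A0. \<forall>b\<in>A0. a * b \<in> A0) \<and> (\<forall>a\<in>A0. star a \<in> A0)"

definition algebraic_bialgebra ::
  "('a::cstar_algebra \<Rightarrow> 'a \<Rightarrow> 'b::cstar_algebra) \<Rightarrow> ('b \<Rightarrow> 'a \<Rightarrow> 'c::cstar_algebra) \<Rightarrow>
     ('a \<Rightarrow> 'b \<Rightarrow> 'c) \<Rightarrow> ('a \<Rightarrow> 'b \<Rightarrow> 'b) \<Rightarrow> bool" where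
  "algebraic_bialgebra t t21 t12 \<Delta> \<longleftrightarrow> cstar_bialgebra t t21 t12 \<Delta> \<and>
     (\<exists>A0. star_subalgebra A0 \<and> closure A0 = UNIV \<and>
        (\<forall>a\<in>A0. \<exists>y \<in> span {t b c | b c. b \<in> A0 \<and> c \<in> A0}. \<Delta> a = (\<lambda>x. y * x)))"

definition opposite ::
  "('a::cstar_algebra \<Rightarrow> 'a \<Rightarrow> 'b::cstar_algebra) \<Rightarrow> ('a \<Rightarrow> 'b \<Rightarrow> 'b) \<Rightarrow> 'a \<Rightarrow> 'b \<Rightarrow> 'b" where
  "opposite t \<Delta> a = flip_alg t \<circ> \<Delta> a \<circ> flip_alg t"

text \<open>
  For an algebraic C*-bialgebra the values of \<open>\<Delta>\<close> and of its opposite lie in \<open>A \<otimes> A\<close>, which is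
  where product states and product representations are evaluated.
\<close>

definition state_conv ::
  "('a::cstar_algebra \<Rightarrow> 'a \<Rightarrow> 'b::cstar_algebra) \<Rightarrow> ('a \<Rightarrow> 'b \<Rightarrow> 'b) \<Rightarrow>
     ('a \<Rightarrow> complex) \<Rightarrow> ('a \<Rightarrow> complex) \<Rightarrow> 'a \<Rightarrow> complex" where
  "state_conv t \<Delta> \<omega>1 \<omega>2 = (\<lambda>x. product_state t \<omega>1 \<omega>2 (of_multiplier (\<Delta> x)))"

definition rep_conv ::
  "('h::chilbert_space \<Rightarrow> 'h \<Rightarrow> 'k::chilbert_space) \<Rightarrow>
     ('a::cstar_algebra \<Rightarrow> 'a \<Rightarrow> 'b::cstar_algebra) \<Rightarrow> ('a \<Rightarrow> 'b \<Rightarrow> 'b) \<Rightarrow>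
     'h set \<Rightarrow> ('a \<Rightarrow> 'h \<Rightarrow> 'h) \<Rightarrow> 'h set \<Rightarrow> ('a \<Rightarrow> 'h \<Rightarrow> 'h) \<Rightarrow> 'a \<Rightarrow> 'k \<Rightarrow> 'k" where
  "rep_conv s t \<Delta> H \<pi> K \<rho> = (\<lambda>x. tensor_rep s t H \<pi> K \<rho> (of_multiplier (\<Delta> x)))"

end

theory Submission
  imports Defs
begin

text \<open>
  The vectors \<open>\<Lambda>(\<Delta> x)\<close> and \<open>\<Lambda>(\<Delta>\<^sup>o\<^sup>p x)\<close> have inner products \<open>(\<omega>1 \<star> \<omega>2)(x\<^sup>* y)\<close> and \<open>(\<omega>2 \<star> \<omega>1)(x\<^sup>* y)\<close>, so
  commutativity makes \<open>R\<close> isometric and cyclicity makes it unitary; (i) and (ii) are then checked on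
  these vectors. For the Yang-Baxter equation, \<open>\<omega>1 \<star> \<omega>2\<close> belongs to \<open>S0\<close> and its GNS space is that of
  \<open>\<pi>1 \<star> \<pi>2\<close>, so \<open>\<Omega>1 \<otimes> \<Omega>2 \<otimes> \<Omega>3\<close> is cyclic for \<open>(\<Delta> \<otimes> id) \<Delta>\<close>; by coassociativity both sides turn
  \<open>a \<otimes> b \<otimes> c\<close> into \<open>c \<otimes> b \<otimes> a\<close> on the cyclic vector.

  Everything rests on the fact that *-homomorphisms are contractive, which is obtained without
  spectral theory from square roots of \<open>1 - h\<close> for self-adjoint \<open>h\<close> with \<open>\<parallel>h\<parallel> < 1\<close>.
\<close>

section \<open>Complex vector spaces and closed spans\<close>

text \<open>Three obstacles shape the development. The algebras may lack a unit, so the norm of a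
  cyclic GNS vector cannot be read off at 1; it is computed with an approximate unit, and only then
  is the vector functional of a product of GNS vectors seen to be a state. Tensor operators, product
  representations, flips and product states are definite descriptions, and the norm on the tensor
  product is a \<open>Sup\<close>, which carries information only for bounded sets; contractivity of
  representations supplies the bounds behind all existence proofs. Finally, coassociativity is
  stated by extension to multipliers. On the dense subalgebra \<open>\<Delta>\<close> has finite
  sums of elementary tensors as values, so both iterated coproducts are elements of the threefold
  tensor product and coassociativity becomes an equation between them. In the Yang-Baxter equation
  the leg pair (1,3) is adjacent in neither bracketing; it is reached through flips of the whole
  ambient space, whose relations are those of transpositions.\<close>

lemma scaleR_scaleC: "r *\<^sub>R (x::'a::complex_vector) = complex_of_real r *\<^sub>C x"
  by (simp add: scaleC_of_real)

lemma scaleC_one [simp]: "1 *\<^sub>C (x::'a::complex_vector) = x"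
  using scaleC_of_real[of 1 x] by simp

lemma scaleC_zero_left [simp]: "0 *\<^sub>C (x::'a::complex_vector) = 0"
  using scaleC_of_real[of 0 x] by simp

lemma scaleC_zero_right [simp]: "c *\<^sub>C (0::'a::complex_vector) = 0"
  using scaleC_add_right[of c 0 "0::'a"] by simp

lemma scaleC_minus_right: "c *\<^sub>C (- x::'a::complex_vector) = - (c *\<^sub>C x)"
  using scaleC_add_right[of c "- x" x] by (simp add: eq_neg_iff_add_eq_0)

lemma scaleC_diff_right: "c *\<^sub>C (x - y::'a::complex_vector) = c *\<^sub>C x - c *\<^sub>C y"
  using scaleC_add_right[of c x "- y"] by (simp add: scaleC_minus_right)

lemma scaleC_minus_left: "(- c) *\<^sub>C (x::'a::complex_vector) = - (c *\<^sub>C x)"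
  using scaleC_add_left[of "- c" c x] by (simp add: eq_neg_iff_add_eq_0)

lemma scaleC_scaleR: "c *\<^sub>C (r *\<^sub>R x) = r *\<^sub>R (c *\<^sub>C (x::'a::complex_vector))"
  by (simp add: scaleR_scaleC scaleC_scaleC mult.commute)

lemma clinear_on_scaleR:
  "clinear_on H f \<Longrightarrow> x \<in> H \<Longrightarrow> f (r *\<^sub>R x) = r *\<^sub>R f x"
  by (simp add: clinear_on_def scaleR_scaleC)

lemma clinear_on_zero:
  "clinear_on H f \<Longrightarrow> x \<in> H \<Longrightarrow> f 0 = 0"
  using clinear_on_scaleR[of H f x 0] by simp

lemma clinear_on_linear: "clinear_on UNIV f \<Longrightarrow> linear f"
  by (rule linearI) (auto simp: clinear_on_def scaleR_scaleC)

lemma in_closureI: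
  fixes S :: "'a::metric_space set"
  shows "(\<And>n. f n \<in> S) \<Longrightarrow> f \<longlonglongrightarrow> l \<Longrightarrow> l \<in> closure S"
  unfolding closure_sequential by (intro exI[of _ f]) simp

text \<open>The induction carries membership in the closed span along with \<open>P\<close>, so
  additivity and homogeneity are asked for only inside it. This matters because an operator here is
  linear on its domain and zero elsewhere, hence not linear on the whole type.\<close>

lemma closure_span_induct [consumes 1, case_names base zero add scale lim]:
  fixes G :: "'a::real_normed_vector set"
  assumes x: "x \<in> closure (span G)"
    and base: "\<And>g. g \<in> G \<Longrightarrow> P g"
    and zero: "P 0"
    and add: "\<And>x y. x \<in> closure (span G) \<Longrightarrow> y \<in> closure (span G) \<Longrightarrow> P x \<Longrightarrow> P y \<Longrightarrow> P (x + y)"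
    and scale: "\<And>r x. x \<in> closure (span G) \<Longrightarrow> P x \<Longrightarrow> P (r *\<^sub>R x)"
    and lim: "\<And>f l. (\<And>n. f n \<in> closure (span G)) \<Longrightarrow> (\<And>n::nat. P (f n)) \<Longrightarrow> f \<longlonglongrightarrow> l \<Longrightarrow>
                l \<in> closure (span G) \<Longrightarrow> P l"
  shows "P x"
proof -
  have sub: "span G \<subseteq> closure (span G)" by (rule closure_subset)
  have "y \<in> span G \<Longrightarrow> y \<in> closure (span G) \<and> P y" for y
  proof (induction rule: span_induct_alt)
    case base
    then show ?case using zero sub span_zero by blast
  next
    case (step r g y)
    have "g \<in> closure (span G)" using step sub span_base by blast
    moreover have "r *\<^sub>R g \<in> closure (span G)" using step sub span_base span_scale by blast
    moreover have "r *\<^sub>R g + y \<in> closure (span G)"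
    proof -
      obtain f where "\<forall>n. f n \<in> span G" "f \<longlonglongrightarrow> y"
        using step unfolding closure_sequential by blast
      moreover have "r *\<^sub>R g \<in> span G" using step by (simp add: span_base span_scale)
      ultimately show ?thesis
        by (intro in_closureI[of "\<lambda>n. r *\<^sub>R g + f n"]) (auto intro: span_add tendsto_intros)
    qed
    ultimately show ?case using step assms(2) scale add by blast
  qed
  moreover obtain f where "\<forall>n. f n \<in> span G" "f \<longlonglongrightarrow> x"
    using x unfolding closure_sequential by blast
  ultimately show ?thesis using lim[of f x] x by blast
qed

lemma subspace_closure:
  fixes S :: "'a::real_normed_vector set"
  assumes "subspace S"
  shows "subspace (closure S)"
proof (rule subspaceI)
  show "0 \<in> closure S"
    using assms closure_subset subspace_0 by blast
next
  fix x y assume "x \<in> closure S" "y \<in> closure S"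
  then obtain f g where "\<forall>n. f n \<in> S" "f \<longlonglongrightarrow> x" "\<forall>n. g n \<in> S" "g \<longlonglongrightarrow> y"
    unfolding closure_sequential by blast
  then show "x + y \<in> closure S"
    using assms by (intro in_closureI[of "\<lambda>n. f n + g n"]) (auto intro: tendsto_add subspace_add)
next
  fix c x assume "x \<in> closure S"
  then obtain f where "\<forall>n. f n \<in> S" "f \<longlonglongrightarrow> x"
    unfolding closure_sequential by blast
  then show "c *\<^sub>R x \<in> closure S"
    using assms by (intro in_closureI[of "\<lambda>n. c *\<^sub>R f n"]) (auto intro: tendsto_intros subspace_scale)
qed

text \<open>A common form for bounded linear maps and for operators that are linear on a closed
  subspace only. Just real homogeneity is demanded, so that conjugate-linear maps such as
  \<open>star\<close> and the first slot of \<open>cinner\<close> are covered.\<close>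

definition cont_linear_on :: "'a::real_normed_vector set \<Rightarrow> ('a \<Rightarrow> 'b::real_normed_vector) \<Rightarrow> bool" where
  "cont_linear_on D f \<longleftrightarrow> (\<forall>x\<in>D. \<forall>y\<in>D. f (x + y) = f x + f y) \<and>
     (\<forall>r. \<forall>x\<in>D. f (r *\<^sub>R x) = r *\<^sub>R f x) \<and> continuous_on D f"

lemma cont_linear_on_eq:
  assumes "cont_linear_on D f" "cont_linear_on D g" "D = closure (span G)"
    and "\<And>x. x \<in> G \<Longrightarrow> f x = g x" "x \<in> D"
  shows "f x = g x"
proof -
  have "x \<in> closure (span G)" using assms by simp
  then show ?thesis
  proof (induction rule: closure_span_induct)
    case zero
    have "0 \<in> D"
      using assms(3) closure_subset span_zero by blast
    then have "f (0 *\<^sub>R 0) = 0 *\<^sub>R f 0" "g (0 *\<^sub>R 0) = 0 *\<^sub>R g 0"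
      using assms(1,2) unfolding cont_linear_on_def by blast+
    then show ?case by simp
  next
    case (lim h l)
    have "continuous_on D f" "continuous_on D g" using assms(1,2) by (auto simp: cont_linear_on_def)
    then have "(f \<circ> h) \<longlonglongrightarrow> f l" "(g \<circ> h) \<longlonglongrightarrow> g l"
      using assms(3) lim unfolding continuous_on_sequentially by blast+
    then have "(\<lambda>n. f (h n)) \<longlonglongrightarrow> f l" "(\<lambda>n. g (h n)) \<longlonglongrightarrow> g l"
      by (simp_all add: comp_def)
    then show ?case using lim by (metis (no_types, lifting) LIMSEQ_unique ext)
  qed (use assms in \<open>auto simp: cont_linear_on_def\<close>)
qed

lemma bounded_linear_cont_linear_on: "bounded_linear f \<Longrightarrow> cont_linear_on D f"
  by (simp add: cont_linear_on_def linear_simps linear_continuous_on)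

lemma cont_linear_on_compose:
  "cont_linear_on D f \<Longrightarrow> f ` D \<subseteq> E \<Longrightarrow> cont_linear_on E g \<Longrightarrow> cont_linear_on D (\<lambda>x. g (f x))"
  unfolding cont_linear_on_def
  by (auto simp: image_subset_iff intro!: continuous_on_compose2[of E g])

text \<open>Continuity of complex scaling is assumed because the sort ties the norm to real scalars
  only; it is discharged for Hilbert spaces below.\<close>

lemma csubspace_closure_span:
  fixes G :: "'a::{complex_vector,real_normed_vector} set"
  assumes "\<And>c g. g \<in> G \<Longrightarrow> c *\<^sub>C g \<in> G" "\<And>c. continuous_on UNIV (\<lambda>x::'a. c *\<^sub>C x)"
  shows "csubspace (closure (span G))"
  unfolding csubspace_def
proof (intro conjI allI ballI)
  show s: "subspace (closure (span G))" by (intro subspace_closure subspace_span)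
  fix c x assume "x \<in> closure (span G)"
  then show "c *\<^sub>C x \<in> closure (span G)"
  proof (induction rule: closure_span_induct)
    case (base g)
    then show ?case using assms(1) closure_subset span_base by blast
  next
    case zero then show ?case using s subspace_0 by auto
  next
    case (add x y) then show ?case using s by (simp add: scaleC_add_right subspace_add)
  next
    case (scale r x) then show ?case using s by (simp add: scaleC_scaleR subspace_scale)
  next
    case (lim f l)
    have "(\<lambda>n. c *\<^sub>C f n) \<longlonglongrightarrow> c *\<^sub>C l"
      using assms(2)[of c] lim by (auto simp: continuous_on_sequentially comp_def)
    moreover have "\<forall>n. c *\<^sub>C f n \<in> closure (span G)" using lim by blast
    ultimately show ?case by (metis (no_types) in_closureI closure_closure)
  qed
qed


section \<open>Hilbert spaces\<close>

lemma cinner_add_left: "cinner (x + y) z = cinner x z + cinner y z"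
  by (metis cinner_commute cinner_add_right complex_cnj_add)

lemma cinner_scaleC_left: "cinner (c *\<^sub>C x) z = cnj c * cinner x z"
  by (metis cinner_commute cinner_scaleC_right complex_cnj_mult)

lemma cinner_scaleR_right: "cinner x (r *\<^sub>R y) = of_real r * cinner x y"
  by (simp add: scaleR_scaleC cinner_scaleC_right)

lemma cinner_scaleR_left: "cinner (r *\<^sub>R x) y = of_real r * cinner x y"
  by (simp add: scaleR_scaleC cinner_scaleC_left)

lemma cinner_zero_right [simp]: "cinner x 0 = 0"
  using cinner_scaleR_right[of x 0 0] by simp

lemma cinner_zero_left [simp]: "cinner 0 x = 0"
  using cinner_scaleR_left[of 0 0 x] by simp

lemma cinner_minus_right: "cinner x (- y) = - cinner x y"
  using cinner_scaleR_right[of x "-1" y] by simp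

lemma cinner_minus_left: "cinner (- x) y = - cinner x y"
  using cinner_scaleR_left[of "-1" x y] by simp

lemma cinner_diff_right: "cinner x (y - z) = cinner x y - cinner x z"
  using cinner_add_right[of x y "- z"] by (simp add: cinner_minus_right)

lemma cinner_diff_left: "cinner (x - y) z = cinner x z - cinner y z"
  using cinner_add_left[of x "- y" z] by (simp add: cinner_minus_left)

lemma cinner_sum_right: "cinner x (\<Sum>i\<in>I. f i) = (\<Sum>i\<in>I. cinner x (f i))"
  by (induction I rule: infinite_finite_induct) (simp_all add: cinner_add_right)

lemma cinner_sum_left: "cinner (\<Sum>i\<in>I. f i) x = (\<Sum>i\<in>I. cinner (f i) x)"
  by (induction I rule: infinite_finite_induct) (simp_all add: cinner_add_left)

lemma norm_sq_cinner: "(norm x)\<^sup>2 = Re (cinner x x)"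
  by (simp add: cinner_self)

lemma norm_eq_cinner: "cinner x x = cinner y y \<Longrightarrow> norm x = norm y"
  by (simp add: cinner_self of_real_eq_iff del: of_real_power)

lemma norm_scaleC_chilbert: "norm (c *\<^sub>C (x::'a::chilbert_space)) = cmod c * norm x"
proof -
  have "complex_of_real ((norm (c *\<^sub>C x))\<^sup>2) = c * cnj c * of_real ((norm x)\<^sup>2)"
    by (simp only: cinner_self[symmetric] cinner_scaleC_left cinner_scaleC_right)
      (simp add: ac_simps)
  also have "\<dots> = complex_of_real ((cmod c * norm x)\<^sup>2)"
    by (simp only: complex_norm_square[symmetric] power_mult_distrib of_real_mult)
  finally have "(norm (c *\<^sub>C x))\<^sup>2 = (cmod c * norm x)\<^sup>2" using of_real_eq_iff by blast
  then show ?thesis by simp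
qed

lemma bounded_linear_scaleC_chilbert: "bounded_linear (\<lambda>x::'a::chilbert_space. c *\<^sub>C x)"
  by (rule bounded_linear_intro[of _ "cmod c"])
    (simp_all add: scaleC_add_right scaleC_scaleR norm_scaleC_chilbert mult.commute)

lemma cinner_Cauchy_Schwarz: "cmod (cinner x y) \<le> norm x * norm y"
proof (cases "y = 0")
  case False
  \<comment> \<open>The component of \<open>x\<close> orthogonal to \<open>y\<close>, multiplied by
    the squared norm of \<open>y\<close> to avoid a division.\<close>
  define v where "v = complex_of_real ((norm y)\<^sup>2) *\<^sub>C x - cinner y x *\<^sub>C y"
  have yv: "cinner y v = 0"
    by (simp add: v_def cinner_diff_right cinner_scaleC_right cinner_self)
  have "cinner v v = of_real ((norm y)\<^sup>2) * cinner x v"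
    using yv by (subst v_def) (simp add: cinner_diff_left cinner_scaleC_left)
  also have "cinner x v = of_real ((norm y)\<^sup>2 * (norm x)\<^sup>2) - cinner y x * cinner x y"
    by (simp add: v_def cinner_diff_right cinner_scaleC_right cinner_self)
  also have "cinner y x * cinner x y = of_real ((cmod (cinner x y))\<^sup>2)"
    by (subst (1) cinner_commute) (simp only: complex_norm_square mult.commute)
  finally have "complex_of_real ((norm v)\<^sup>2) =
      of_real ((norm y)\<^sup>2 * ((norm y)\<^sup>2 * (norm x)\<^sup>2 - (cmod (cinner x y))\<^sup>2))"
    by (simp add: cinner_self)
  then have "(norm v)\<^sup>2 = (norm y)\<^sup>2 * ((norm y)\<^sup>2 * (norm x)\<^sup>2 - (cmod (cinner x y))\<^sup>2)"
    using of_real_eq_iff by blast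
  then have "(norm y)\<^sup>2 * ((norm y)\<^sup>2 * (norm x)\<^sup>2 - (cmod (cinner x y))\<^sup>2) \<ge> 0"
    by (metis zero_le_power2)
  then have "(cmod (cinner x y))\<^sup>2 \<le> (norm x * norm y)\<^sup>2"
    using False by (simp add: zero_le_mult_iff power_mult_distrib mult.commute)
  then show ?thesis by (meson mult_nonneg_nonneg norm_ge_zero power2_le_imp_le)
qed simp

lemma bounded_bilinear_cinner: "bounded_bilinear (cinner :: 'a::chilbert_space \<Rightarrow> 'a \<Rightarrow> complex)"
proof
  show "\<exists>K. \<forall>a b::'a. cmod (cinner a b) \<le> norm a * norm b * K"
    by (intro exI[of _ 1]) (simp add: cinner_Cauchy_Schwarz)
qed (simp_all add: cinner_add_left cinner_add_right cinner_scaleR_left cinner_scaleR_right scaleR_conv_of_real)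

lemmas tendsto_cinner = bounded_bilinear.tendsto[OF bounded_bilinear_cinner]
lemmas bounded_linear_cinner_left = bounded_bilinear.bounded_linear_left[OF bounded_bilinear_cinner]
lemmas bounded_linear_cinner_right = bounded_bilinear.bounded_linear_right[OF bounded_bilinear_cinner]

lemma csubspace_closure_span_chilbert:
  fixes G :: "'a::chilbert_space set"
  shows "(\<And>c g. g \<in> G \<Longrightarrow> c *\<^sub>C g \<in> G) \<Longrightarrow> csubspace (closure (span G))"
  by (rule csubspace_closure_span) (simp_all add: linear_continuous_on bounded_linear_scaleC_chilbert)


section \<open>C*-algebras\<close>

lemma star_zero [simp]: "star (0::'a::cstar_algebra) = 0"
  using star_scaleC[of 0 "0::'a"] by simp

lemma star_scaleR: "star (r *\<^sub>R (x::'a::cstar_algebra)) = r *\<^sub>R star x"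
  by (simp add: scaleR_scaleC star_scaleC)

lemma star_minus: "star (- x::'a::cstar_algebra) = - star x"
  using star_scaleR[of "-1" x] by simp

lemma star_diff: "star (x - y::'a::cstar_algebra) = star x - star y"
  using star_add[of x "- y"] by (simp add: star_minus)

lemma norm_star: "norm (star (x::'a::cstar_algebra)) = norm x"
proof -
  have le: "norm y \<le> norm (star y)" for y :: 'a
  proof (cases "y = 0")
    case False
    have "norm y * norm y \<le> norm (star y) * norm y"
      using norm_star_mult_self[of y] norm_mult_ineq[of "star y" y] by (simp add: power2_eq_square)
    then show ?thesis using False by simp
  qed simp
  from le[of x] le[of "star x"] show ?thesis by (simp add: star_star)
qed

lemma bounded_linear_star: "bounded_linear (star :: 'a::cstar_algebra \<Rightarrow> 'a)"
  by (rule bounded_linear_intro[of _ 1]) (simp_all add: star_add star_scaleR norm_star)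

lemma bounded_linear_scaleC_cstar: "bounded_linear (\<lambda>x::'a::cstar_algebra. c *\<^sub>C x)"
  by (rule bounded_linear_intro[of _ "cmod c"])
    (simp_all add: scaleC_add_right scaleC_scaleR norm_scaleC mult.commute)

lemma norm_mult_star_self: "norm (x * star x) = (norm (x::'a::cstar_algebra))\<^sup>2"
  using norm_star_mult_self[of "star x"] by (simp add: star_star norm_star)

text \<open>Even without a unit, an element is determined by its left multiplication: take
  \<open>w = star (x - y)\<close> and use the C*-identity. This is why \<open>of_multiplier\<close>
  is well defined, and it serves to compare elements through their products.\<close>

lemma cstar_mult_cancel:
  fixes x y :: "'a::cstar_algebra"
  assumes "\<And>w. x * w = y * w"
  shows "x = y"
proof -
  have "(x - y) * star (x - y) = 0" by (simp add: assms left_diff_distrib)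
  then show ?thesis using norm_mult_star_self[of "x - y"] by simp
qed

lemma cstar_mult_cancel_left:
  fixes x y :: "'a::cstar_algebra"
  assumes "\<And>w. w * x = w * y"
  shows "x = y"
proof -
  have "star (x - y) * (x - y) = 0" by (simp add: assms right_diff_distrib)
  then show ?thesis using norm_star_mult_self[of "x - y"] by simp
qed

text \<open>In the unitization, \<open>1 - h = (1 - k)\<^sup>2\<close>.\<close>

lemma cstar_sqrt:
  fixes h :: "'a::cstar_algebra"
  assumes sa: "star h = h" and n: "norm h < 1"
  shows "\<exists>k. star k = k \<and> k + k - k * k = h \<and> (\<forall>x. x * h = h * x \<longrightarrow> x * k = k * x)"
proof -
  \<comment> \<open>The smaller root of \<open>norm h + r^2 = 2 * r\<close>. On the ball of radius
    \<open>r\<close> the map \<open>f\<close> below is then a self-map, and a contraction with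
    constant \<open>r < 1\<close>; its fixed points solve \<open>k + k - k * k = h\<close>.\<close>
  define r where "r = 1 - sqrt (1 - norm h)"
  have r: "0 \<le> r" "r < 1" "norm h + r\<^sup>2 = 2 * r"
    using n by (auto simp: r_def power2_eq_square algebra_simps)
  \<comment> \<open>Self-adjointness and commutation with everything that commutes with
    \<open>h\<close> are closed conditions preserved by \<open>f\<close>, so the fixed point
    inherits them.\<close>
  define S where "S = {k. star k = k \<and> norm k \<le> r \<and> (\<forall>x. x * h = h * x \<longrightarrow> x * k = k * x)}"
  define f where "f k = (1/2) *\<^sub>R (h + k * k)" for k
  have "closed S"
  proof -
    have "S = {k. star k = k} \<inter> {k. norm k \<le> r} \<inter> (\<Inter>x\<in>{x. x * h = h * x}. {k. x * k = k * x})"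
      by (auto simp: S_def)
    moreover have "closed {k::'a. star k = k}"
      by (intro closed_Collect_eq linear_continuous_on bounded_linear_star continuous_on_id)
    moreover have "closed {k::'a. norm k \<le> r}"
      by (intro closed_Collect_le continuous_intros)
    moreover have "closed {k. x * k = k * x}" for x :: 'a
      by (intro closed_Collect_eq continuous_intros)
    ultimately show ?thesis by (auto intro!: closed_Int closed_INT)
  qed
  then have "complete S" by (simp add: complete_eq_closed)
  moreover have "0 \<in> S" using r by (simp add: S_def)
  moreover have "f ` S \<subseteq> S"
  proof
    fix y assume "y \<in> f ` S"
    then obtain k where k: "k \<in> S" "y = f k" by blast
    have "norm k \<le> r" using k by (simp add: S_def)
    then have "norm k * norm k \<le> r * r" using r by (intro mult_mono) auto
    then have "norm (k * k) \<le> r\<^sup>2"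
      using norm_mult_ineq[of k k] by (simp add: power2_eq_square)
    then have "norm y \<le> r"
      using norm_triangle_ineq[of h "k * k"] r by (simp add: k(2) f_def)
    moreover have "star k = k" using k(1) by (simp add: S_def)
    then have "star y = y" by (simp add: sa k(2) f_def star_scaleR star_add star_mult)
    moreover have "x * y = y * x" if "x * h = h * x" for x
    proof -
      have xk: "x * k = k * x" using k(1) that unfolding S_def by blast
      have "x * (k * k) = k * x * k" by (simp add: xk mult.assoc[symmetric])
      also have "\<dots> = k * k * x" by (simp only: xk mult.assoc)
      finally show ?thesis
        using that by (simp add: k(2) f_def distrib_left distrib_right)
    qed
    ultimately show "y \<in> S" by (simp add: S_def)
  qed
  moreover have "dist (f x) (f y) \<le> r * dist x y" if "x \<in> S" "y \<in> S" for x y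
  proof -
    have "x * x - y * y = x * (x - y) + (x - y) * y" by (simp add: algebra_simps)
    then have "norm (x * x - y * y) \<le> norm (x * (x - y)) + norm ((x - y) * y)"
      by (metis norm_triangle_ineq)
    also have "\<dots> \<le> norm x * norm (x - y) + norm (x - y) * norm y"
      by (intro add_mono norm_mult_ineq)
    also have "\<dots> \<le> r * norm (x - y) + norm (x - y) * r"
      using that by (intro add_mono mult_mono) (auto simp: S_def r)
    finally have "norm (x * x - y * y) \<le> 2 * (r * norm (x - y))" by simp
    moreover have "f x - f y = (1/2) *\<^sub>R (x * x - y * y)"
      by (simp add: f_def scaleR_diff_right[symmetric])
    ultimately show ?thesis by (simp add: dist_norm)
  qed
  ultimately obtain k where k: "k \<in> S" "f k = k"
    using Banach_fix[of S r f] r by blast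
  have "2 *\<^sub>R f k = h + k * k" by (simp add: f_def)
  then have "k + k - k * k = h" using k by (simp add: scaleR_2)
  moreover have "star k = k" "\<forall>x. x * h = h * x \<longrightarrow> x * k = k * x"
    using k(1) unfolding S_def by blast+
  ultimately show ?thesis by blast
qed

text \<open>\<open>c \<plusminus> i f\<close> are unitary, and \<open>c\<close> is their mean.\<close>

lemma norm_le_if_sq_sum_one:
  fixes c f :: "'a::cstar_algebra \<Rightarrow> 'a"
  assumes sa: "\<And>x y. star (c x) * y = star x * c y" "\<And>x y. star (f x) * y = star x * f y"
    and comm: "\<And>x. c (f x) = f (c x)" and sq: "\<And>x. c (c x) + f (f x) = x"
  shows "norm (c z) \<le> norm z"
proof -
  have n: "norm (c z + e *\<^sub>C f z) = norm z" if e: "e = \<i> \<or> e = - \<i>" for e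
  proof -
    have ee: "cnj e = - e" "e * e = - 1" using e by auto
    have "star (c z + e *\<^sub>C f z) * (c z + e *\<^sub>C f z) =
        star (c z) * c z + e *\<^sub>C (star (c z) * f z) - e *\<^sub>C (star (f z) * c z) + star (f z) * f z"
      by (simp add: star_add star_scaleC distrib_left distrib_right left_diff_distrib scaleC_mult_left
          scaleC_mult_right scaleC_scaleC scaleC_diff_right ee scaleC_minus_left)
    also have "\<dots> = star z * (c (c z) + f (f z))"
      by (simp add: sa comm distrib_left)
    finally have "(norm (c z + e *\<^sub>C f z))\<^sup>2 = (norm z)\<^sup>2"
      by (simp add: norm_star_mult_self[symmetric] sq)
    then show ?thesis by simp
  qed
  have "2 *\<^sub>R c z = (c z + \<i> *\<^sub>C f z) + (c z + (- \<i>) *\<^sub>C f z)"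
    by (simp add: scaleC_minus_left scaleR_2)
  then have "2 * norm (c z) \<le> norm (c z + \<i> *\<^sub>C f z) + norm (c z + (- \<i>) *\<^sub>C f z)"
    by (metis norm_triangle_ineq norm_scaleR abs_numeral)
  then show ?thesis using n[of \<i>] n[of "- \<i>"] by simp
qed

text \<open>In the unitization the hypothesis reads \<open>c^2 + (1 - p)^2 = 1\<close> for commuting
  self-adjoint elements. The missing \<open>1 - p\<close> is replaced by the operator
  \<open>z - p * z\<close>.\<close>

lemma norm_le_one_if_sq_eq:
  fixes c p :: "'a::cstar_algebra"
  assumes "star c = c" "star p = p" "c * p = p * c" "c * c = p + p - p * p"
  shows "norm c \<le> 1"
proof -
  have "norm (c * z) \<le> norm z" for z
  proof (rule norm_le_if_sq_sum_one[where c = "\<lambda>z. c * z" and f = "\<lambda>z. z - p * z"])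
    fix x y :: 'a
    show "star (c * x) * y = star x * (c * y)" by (simp add: star_mult assms mult.assoc)
    show "star (x - p * x) * y = star x * (y - p * y)"
      by (simp add: star_mult star_diff assms algebra_simps)
    have "c * (p * x) = p * (c * x)" by (simp add: assms mult.assoc[symmetric])
    then show "c * (x - p * x) = c * x - p * (c * x)"
      by (simp add: algebra_simps)
    have "c * (c * x) = (p + p - p * p) * x" by (simp add: assms mult.assoc[symmetric])
    then show "c * (c * x) + (x - p * x - p * (x - p * x)) = x"
      by (simp add: algebra_simps)
  qed
  \<comment> \<open>The bound on left multiplication, evaluated at \<open>star c\<close>, becomes a
    bound on the norm of \<open>c\<close> itself through the C*-identity.\<close>
  from this[of "star c"] have "(norm c)\<^sup>2 \<le> norm c"
    by (simp add: norm_mult_star_self norm_star)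
  then show ?thesis
    by (cases "c = 0") (auto simp: power2_eq_square)
qed

text \<open>Square roots are available only in the open unit ball. Scaling by \<open>1/r\<close>
  with \<open>r > norm a\<close> enters it, and \<open>r\<close> then decreases to
  \<open>norm a\<close>, which also covers \<open>a = 0\<close>.\<close>

lemma norm_le_mult_if_unit:
  fixes g :: "'a::real_normed_vector \<Rightarrow> real"
  assumes hom: "\<And>r x. r \<ge> 0 \<Longrightarrow> g (r *\<^sub>R x) = r * g x"
    and unit: "\<And>x. norm x < 1 \<Longrightarrow> g x \<le> C"
  shows "g a \<le> norm a * C"
proof -
  have "g a \<le> r * C" if r: "r > norm a" for r
  proof -
    have r0: "r > 0" using r norm_ge_zero[of a] by linarith
    then have "norm ((1/r) *\<^sub>R a) < 1" using r by simp
    then have "(1/r) * g a \<le> C" using unit[of "(1/r) *\<^sub>R a"] hom[of "1/r" a] r0 by simp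
    then show ?thesis using r0 by (simp add: field_simps)
  qed
  moreover have "(\<lambda>n. (norm a + 1 / Suc n) * C) \<longlonglongrightarrow> (norm a + 0) * C"
    by (intro tendsto_intros LIMSEQ_inverse_real_of_nat[unfolded inverse_eq_divide])
  ultimately show ?thesis
    by (intro LIMSEQ_le_const[of _ "norm a * C" "g a"]) (auto intro!: exI[of _ 0])
qed

section \<open>Representations on closed subspaces and their contractivity\<close>

lemma star_rep_apply:
  assumes "star_rep H \<pi>"
  shows star_rep_add: "\<pi> (a + b) x = \<pi> a x + \<pi> b x"
    and star_rep_scaleC: "\<pi> (c *\<^sub>C a) x = c *\<^sub>C \<pi> a x"
    and star_rep_mult: "\<pi> (a * b) x = \<pi> a (\<pi> b x)"
    and star_rep_bops: "\<pi> a \<in> bops H H"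
    and star_rep_adj: "x \<in> H \<Longrightarrow> y \<in> H \<Longrightarrow> cinner (\<pi> a x) y = cinner x (\<pi> (star a) y)"
    and star_rep_csubspace: "csubspace H"
    and star_rep_mem: "x \<in> H \<Longrightarrow> \<pi> a x \<in> H"
  using assms unfolding star_rep_def bops_def by (auto simp: image_subset_iff)

lemma star_rep_scaleR: "star_rep H \<pi> \<Longrightarrow> \<pi> (r *\<^sub>R a) x = r *\<^sub>R \<pi> a x"
  by (simp add: scaleR_scaleC star_rep_scaleC)

lemma star_rep_zero: "star_rep H \<pi> \<Longrightarrow> \<pi> 0 x = 0"
  using star_rep_scaleR[of H \<pi> 0 0 x] by simp

lemma star_rep_diff: "star_rep H \<pi> \<Longrightarrow> \<pi> (a - b) x = \<pi> a x - \<pi> b x"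
  using star_rep_add[of H \<pi> a "- b" x] star_rep_scaleR[of H \<pi> "-1" b x] by simp

lemma star_rep_clinear: "star_rep H \<pi> \<Longrightarrow> clinear_on UNIV (\<lambda>a. \<pi> a x)"
  by (simp add: clinear_on_def star_rep_add star_rep_scaleC)

lemma bops_mem: "T \<in> bops H K \<Longrightarrow> x \<in> H \<Longrightarrow> T x \<in> K"
  by (auto simp: bops_def)

lemma bops_clinear: "T \<in> bops H K \<Longrightarrow> clinear_on H T"
  by (simp add: bops_def)

lemma bops_out: "T \<in> bops H K \<Longrightarrow> x \<notin> H \<Longrightarrow> T x = 0"
  by (simp add: bops_def)

lemma bops_bound:
  assumes "T \<in> bops H K"
  shows "\<exists>C\<ge>0. \<forall>x. norm (T x) \<le> C * norm x"
proof -
  obtain C where C: "\<forall>x\<in>H. norm (T x) \<le> C * norm x" using assms by (auto simp: bops_def)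
  have "norm (T x) \<le> \<bar>C\<bar> * norm x" for x
  proof (cases "x \<in> H")
    case True
    then show ?thesis using C mult_right_mono[of C "\<bar>C\<bar>" "norm x"] by fastforce
  next
    case False
    then show ?thesis using assms by (simp add: bops_out)
  qed
  then show ?thesis by (intro exI[of _ "\<bar>C\<bar>"]) simp
qed

lemma csubspace_subspace: "csubspace H \<Longrightarrow> subspace H"
  by (simp add: csubspace_def)

lemma csubspace_mem:
  assumes "csubspace H"
  shows csubspace_0: "0 \<in> H"
    and csubspace_add: "x \<in> H \<Longrightarrow> y \<in> H \<Longrightarrow> x + y \<in> H"
    and csubspace_diff: "x \<in> H \<Longrightarrow> y \<in> H \<Longrightarrow> x - y \<in> H"
    and csubspace_scaleC: "x \<in> H \<Longrightarrow> c *\<^sub>C x \<in> H"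
  using assms by (auto simp: csubspace_def subspace_0 subspace_add subspace_diff)

lemma bops_cont_linear_on:
  assumes "T \<in> bops H K" "csubspace H"
  shows "cont_linear_on H T"
proof -
  obtain C where C: "C \<ge> 0" "\<And>x. norm (T x) \<le> C * norm x" using bops_bound[OF assms(1)] by blast
  have lin: "clinear_on H T" using assms by (simp add: bops_clinear)
  have diff: "T x - T y = T (x - y)" if "x \<in> H" "y \<in> H" for x y
  proof -
    have "T (x - y) + T y = T (x - y + y)"
      using lin that assms(2) csubspace_diff unfolding clinear_on_def by metis
    then have "T x = T (x - y) + T y" by simp
    then show ?thesis by simp
  qed
  have "dist (T x) (T y) \<le> C * dist x y" if "x \<in> H" "y \<in> H" for x y
    using C(2)[of "x - y"] diff[OF that] by (simp add: dist_norm)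
  then have "continuous_on H T"
    using C(1) by (intro lipschitz_on_continuous_on[of C] lipschitz_onI)
  then show ?thesis
    using lin by (auto simp: cont_linear_on_def clinear_on_scaleR clinear_on_def)
qed

lemma bops_diff:
  assumes "T \<in> bops H K" "csubspace H" "x \<in> H" "y \<in> H"
  shows "T (x - y) = T x - T y"
proof -
  have "T ((x - y) + y) = T (x - y) + T y"
    using assms csubspace_diff unfolding bops_def clinear_on_def by blast
  then show ?thesis by simp
qed

lemma bops_zero:
  assumes "T \<in> bops H K"
  shows "T 0 = 0"
  using bops_bound[OF assms] by (metis mult_zero_right norm_le_zero_iff norm_zero)

text \<open>\<open>1 - \<pi> k\<close> is self-adjoint and its square is
  \<open>1 - \<pi> (k + k - k * k)\<close>. In the applications \<open>k + k - k * k\<close> has the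
  form \<open>star a * a\<close>, so the subtracted term is the squared norm of
  \<open>\<pi> a v\<close>.\<close>

lemma star_rep_complement_sq:
  assumes rep: "star_rep H \<pi>" and k: "star k = k" and v: "v \<in> H"
  shows "(norm (v - \<pi> k v))\<^sup>2 = (norm v)\<^sup>2 - Re (cinner v (\<pi> (k + k - k * k) v))"
proof -
  note R = star_rep_mem[OF rep] v
  have "cinner (v - \<pi> k v) (v - \<pi> k v) = cinner v v - cinner v (\<pi> (k + k - k * k) v)"
    using R by (simp add: cinner_diff_left cinner_diff_right star_rep_adj[OF rep] k
        star_rep_diff[OF rep] star_rep_add[OF rep] star_rep_mult[OF rep] cinner_add_right)
  then show ?thesis by (simp add: norm_sq_cinner)
qed

text \<open>For \<open>norm a < 1\<close> write \<open>1 - star a * a = (1 - k)^2\<close> in the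
  unitization. The difference of the squared norms of \<open>v\<close> and \<open>\<pi> a v\<close>
  is then the squared norm of \<open>v - \<pi> k v\<close>, hence nonnegative.\<close>

theorem star_rep_norm_le:
  fixes \<pi> :: "'a::cstar_algebra \<Rightarrow> 'h::chilbert_space \<Rightarrow> 'h"
  assumes rep: "star_rep H \<pi>" and v: "v \<in> H"
  shows "norm (\<pi> a v) \<le> norm a * norm v"
proof (rule norm_le_mult_if_unit[where g = "\<lambda>a. norm (\<pi> a v)"])
  show "norm (\<pi> (r *\<^sub>R x) v) = r * norm (\<pi> x v)" if "r \<ge> 0" for r x
    using that by (simp add: star_rep_scaleR[OF rep])
  fix a :: 'a assume a: "norm a < 1"
  have "norm (star a * a) < 1"
    using a by (simp add: norm_star_mult_self power_less_one_iff)
  moreover have "star (star a * a) = star a * a" by (simp add: star_mult star_star)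
  ultimately obtain k where k: "star k = k" "k + k - k * k = star a * a"
    using cstar_sqrt by blast
  have "cinner v (\<pi> (star a * a) v) = cinner (\<pi> a v) (\<pi> a v)"
    using star_rep_mem[OF rep] v by (simp add: star_rep_adj[OF rep] star_rep_mult[OF rep])
  then have "(norm (v - \<pi> k v))\<^sup>2 = (norm v)\<^sup>2 - (norm (\<pi> a v))\<^sup>2"
    using star_rep_complement_sq[OF rep k(1) v] by (simp add: k(2) norm_sq_cinner)
  then have "(norm (\<pi> a v))\<^sup>2 \<le> (norm v)\<^sup>2"
    using zero_le_power2[of "norm (v - \<pi> k v)"] by linarith
  then show "norm (\<pi> a v) \<le> norm v" by simp
qed

lemma star_rep_bounded_linear:
  assumes "star_rep H \<pi>"
  shows "bounded_linear (\<lambda>a. \<pi> a v)"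
proof (cases "v \<in> H")
  case True
  then show ?thesis
    using star_rep_norm_le[OF assms True]
    by (intro bounded_linear_intro[of _ "norm v"])
      (simp_all add: star_rep_add[OF assms] star_rep_scaleR[OF assms])
next
  case False
  then have "(\<lambda>a. \<pi> a v) = (\<lambda>a. 0)" using bops_out[OF star_rep_bops[OF assms]] by blast
  then show ?thesis by simp
qed

section \<open>Multipliers and contractivity of nondegenerate homomorphisms\<close>

lemma multiplier_add:
  fixes T :: "'b::cstar_algebra \<Rightarrow> 'b"
  assumes "T \<in> multipliers"
  shows "T (x + y) = T x + T y" "T (x - y) = T x - T y" "T (r *\<^sub>R x) = r *\<^sub>R T x"
proof -
  obtain S where S: "\<And>x y. x * T y = S x * y" using assms by (auto simp: multipliers_def)
  show "T (x + y) = T x + T y" "T (x - y) = T x - T y" "T (r *\<^sub>R x) = r *\<^sub>R T x"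
    by (rule cstar_mult_cancel_left, simp add: S distrib_left right_diff_distrib)+
qed

lemma nondeg_hom_apply:
  assumes "nondeg_hom D"
  shows nondeg_hom_add: "D (a + b) x = D a x + D b x"
    and nondeg_hom_scaleC: "D (c *\<^sub>C a) x = c *\<^sub>C D a x"
    and nondeg_hom_mult: "D (a * b) x = D a (D b x)"
    and nondeg_hom_star: "star (D a x) * y = star x * D (star a) y"
    and nondeg_hom_multiplier: "D a \<in> multipliers"
  using assms unfolding nondeg_hom_def by auto

lemma nondeg_hom_scaleR: "nondeg_hom D \<Longrightarrow> D (r *\<^sub>R a) x = r *\<^sub>R D a x"
  by (simp add: scaleR_scaleC nondeg_hom_scaleC)

lemma nondeg_hom_diff: "nondeg_hom D \<Longrightarrow> D (a - b) x = D a x - D b x"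
  using nondeg_hom_add[of D a "- b" x] nondeg_hom_scaleR[of D "-1" b x] by simp

text \<open>The target has no scalar inner product, so a square cannot simply be dropped from a sum.
  For self-adjoint \<open>h\<close> the commuting operators \<open>D h\<close> and
  \<open>1 - D k\<close>, with \<open>k\<close> obtained from \<open>h * h\<close>, have squares
  adding up to 1, and \<open>norm_le_if_sq_sum_one\<close> applies. A general \<open>a\<close> is
  reduced to \<open>star a * a\<close> by the C*-identity applied to \<open>D a z\<close>.\<close>

theorem nondeg_hom_norm_le:
  fixes D :: "'a::cstar_algebra \<Rightarrow> 'b::cstar_algebra \<Rightarrow> 'b"
  assumes D: "nondeg_hom D"
  shows "norm (D a z) \<le> norm a * norm z"
proof -
  have *: "norm (D h z) \<le> norm z" if h: "star h = h" "norm h < 1" for h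
  proof -
    have "norm (h * h) < 1"
      using h norm_star_mult_self[of h] by (simp add: power_less_one_iff)
    moreover have "star (h * h) = h * h" by (simp add: star_mult h)
    ultimately obtain k where k: "star k = k" "k + k - k * k = h * h"
        "\<And>x. x * (h * h) = h * h * x \<Longrightarrow> x * k = k * x"
      using cstar_sqrt[of "h * h"] by blast
    \<comment> \<open>\<open>h\<close> commutes with \<open>h * h\<close>, and \<open>k\<close>
      commutes with whatever does.\<close>
    have hk: "h * k = k * h" by (rule k(3)) (simp add: mult.assoc)
    show ?thesis
    proof (rule norm_le_if_sq_sum_one[where c = "D h" and f = "\<lambda>z. z - D k z"])
      fix x y
      show "star (D h x) * y = star x * D h y" by (simp add: nondeg_hom_star[OF D] h)
      show "star (x - D k x) * y = star x * (y - D k y)"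
        by (simp add: star_diff left_diff_distrib right_diff_distrib nondeg_hom_star[OF D] k(1))
      have "D h (D k x) = D k (D h x)" by (simp add: nondeg_hom_mult[OF D, symmetric] hk)
      then show "D h (x - D k x) = D h x - D k (D h x)"
        by (simp add: multiplier_add[OF nondeg_hom_multiplier[OF D]])
      have "D h (D h x) = D (k + k - k * k) x"
        by (simp add: nondeg_hom_mult[OF D] k(2))
      then show "D h (D h x) + (x - D k x - D k (x - D k x)) = x"
        by (simp add: nondeg_hom_diff[OF D] nondeg_hom_add[OF D] nondeg_hom_mult[OF D]
            multiplier_add[OF nondeg_hom_multiplier[OF D]])
    qed
  qed
  show ?thesis
  proof (rule norm_le_mult_if_unit[where g = "\<lambda>a. norm (D a z)"])
    show "norm (D (r *\<^sub>R x) z) = r * norm (D x z)" if "r \<ge> 0" for r x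
      using that by (simp add: nondeg_hom_scaleR[OF D])
    fix a :: 'a assume a: "norm a < 1"
    have "norm (star a * a) < 1"
      using a by (simp add: norm_star_mult_self power_less_one_iff)
    moreover have "star (star a * a) = star a * a" by (simp add: star_mult star_star)
    ultimately have "norm (D (star a * a) z) \<le> norm z" by (intro *)
    moreover have "star (D a z) * D a z = star z * D (star a * a) z"
      by (simp add: nondeg_hom_star[OF D] nondeg_hom_mult[OF D])
    ultimately have "(norm (D a z))\<^sup>2 \<le> norm z * norm z"
      using norm_mult_ineq[of "star z" "D (star a * a) z"]
      by (simp add: norm_star_mult_self[symmetric] norm_star)
        (meson mult_left_mono norm_ge_zero order_trans)
    then show "norm (D a z) \<le> norm z"
      by (simp add: power2_eq_square[symmetric])
  qed
qed

text \<open>\<open>T\<close> may be compared on a dense set because \<open>w * T x = S w * x\<close> is continuous in \<open>x\<close> for every \<open>w\<close>.\<close>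

lemma multiplier_eq_mult:
  fixes T :: "'b::cstar_algebra \<Rightarrow> 'b"
  assumes T: "T \<in> multipliers" and G: "closure (span G) = UNIV"
    and eq: "\<And>x. x \<in> G \<Longrightarrow> T x = e * x"
  shows "T = (\<lambda>x. e * x)"
proof (rule ext, rule cstar_mult_cancel_left)
  fix x w
  obtain S where S: "\<And>x y. x * T y = S x * y" using T by (auto simp: multipliers_def)
  have "S w * x = (w * e) * x"
  proof (rule cont_linear_on_eq[where D = UNIV and G = G and f = "\<lambda>x. S w * x" and g = "\<lambda>x. (w * e) * x"])
    show "S w * g = (w * e) * g" if "g \<in> G" for g
      using eq[OF that] S[of w g] by (simp add: mult.assoc)
  qed (simp_all add: G bounded_linear_cont_linear_on bounded_linear_mult_right)
  then show "w * T x = w * (e * x)" by (simp add: S mult.assoc)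
qed


section \<open>Extension of densely defined operators\<close>

lemma in_closureE:
  fixes S :: "'a::metric_space set"
  assumes "x \<in> closure S"
  obtains f where "\<forall>n. f n \<in> S" "f \<longlonglongrightarrow> x"
  using assms unfolding closure_sequential by blast

text \<open>Coefficients are absorbed into the index, because the norm in \<open>min_tensor\<close>
  and all later estimates are formulated for plain sums of elementary tensors.\<close>

lemma span_image_sum:
  fixes h :: "'i \<Rightarrow> 'v::real_vector"
  assumes z: "z \<in> span (h ` I)"
    and scale: "\<And>r i. i \<in> I \<Longrightarrow> \<exists>j\<in>I. h j = r *\<^sub>R h i"
  shows "\<exists>(n::nat) p. (\<forall>k<n. p k \<in> I) \<and> z = (\<Sum>k<n. h (p k))"
  using z
proof (induction rule: span_induct_alt)
  case base
  show ?case by (intro exI[of _ 0]) simp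
next
  case (step r x y)
  then obtain i where i: "i \<in> I" "x = h i" by blast
  obtain n p where n: "\<forall>k<n::nat. p k \<in> I" "y = (\<Sum>k<n. h (p k))" using step by blast
  obtain j where j: "j \<in> I" "h j = r *\<^sub>R h i" using scale[OF i(1)] by blast
  define q where "q k = (if k < n then p k else j)" for k
  have "(\<Sum>k<Suc n. h (q k)) = (\<Sum>k<n. h (p k)) + h j"
    by (simp add: q_def)
  then show ?case
    using n i j by (intro exI[of _ "Suc n"] exI[of _ q]) (auto simp: q_def)
qed

text \<open>The extension is the function whose graph is the closed span of the given values.\<close>

lemma bounded_extension:
  fixes g :: "'i \<Rightarrow> 'v::real_normed_vector" and f :: "'i \<Rightarrow> 'w::banach"
  assumes scale: "\<And>r i. i \<in> I \<Longrightarrow> \<exists>j\<in>I. g j = r *\<^sub>R g i \<and> f j = r *\<^sub>R f i"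
    and bound: "\<And>(n::nat) p. (\<And>k. k < n \<Longrightarrow> p k \<in> I) \<Longrightarrow>
        norm (\<Sum>k<n. f (p k)) \<le> C * norm (\<Sum>k<n. g (p k))"
    and C: "C \<ge> 0"
  shows "\<exists>\<Phi>. (\<forall>i\<in>I. \<Phi> (g i) = f i) \<and> cont_linear_on (closure (span (g ` I))) \<Phi> \<and>
    (\<forall>x. norm (\<Phi> x) \<le> C * norm x) \<and> (\<forall>x. x \<notin> closure (span (g ` I)) \<longrightarrow> \<Phi> x = 0)"
proof -
  define h where "h i = (g i, f i)" for i
  define D where "D = closure (span (g ` I))"
  define \<Gamma> where "\<Gamma> = closure (span (h ` I))"
  have sub: "subspace \<Gamma>" by (simp add: \<Gamma>_def subspace_closure)
  have bd0: "norm (snd z) \<le> C * norm (fst z)" if "z \<in> span (h ` I)" for z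
  proof -
    have "\<exists>(n::nat) p. (\<forall>k<n. p k \<in> I) \<and> z = (\<Sum>k<n. h (p k))"
    proof (rule span_image_sum[OF that])
      fix r i assume "i \<in> I"
      then show "\<exists>j\<in>I. h j = r *\<^sub>R h i" using scale[of i r] by (auto simp: h_def)
    qed
    then obtain n p where "\<forall>k<n::nat. p k \<in> I" "z = (\<Sum>k<n. h (p k))" by blast
    then show ?thesis using bound[of n p] by (simp add: h_def fst_sum snd_sum)
  qed
  have bd: "norm (snd z) \<le> C * norm (fst z)" if "z \<in> \<Gamma>" for z
  proof -
    have "closed {z::'v \<times> 'w. norm (snd z) \<le> C * norm (fst z)}"
      by (intro closed_Collect_le continuous_intros)
    then have "\<Gamma> \<subseteq> {z. norm (snd z) \<le> C * norm (fst z)}"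
      unfolding \<Gamma>_def using bd0 by (intro closure_minimal) auto
    then show ?thesis using that by blast
  qed
  \<comment> \<open>For \<open>x = x'\<close> this says that the closed span is single-valued, that
    is, a graph; in general it is the Lipschitz estimate for the extension.\<close>
  have diff: "norm (w - w') \<le> C * norm (x - x')" if "(x, w) \<in> \<Gamma>" "(x', w') \<in> \<Gamma>" for x w x' w'
    using bd[OF subspace_diff[OF sub that]] by simp
  have ex: "\<exists>w. (x, w) \<in> \<Gamma>" if "x \<in> D" for x
  proof -
    obtain X where X: "\<forall>n. X n \<in> span (g ` I)" "X \<longlonglongrightarrow> x"
      using \<open>x \<in> D\<close> unfolding D_def by (rule in_closureE)
    note X = X(1)[rule_format] X(2)
    have "fst ` span (h ` I) = span (fst ` h ` I)"
      by (rule linear_span_image[symmetric]) (rule bounded_linear.linear[OF bounded_linear_fst])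
    then have img: "span (g ` I) = fst ` span (h ` I)"
      by (simp add: image_image h_def)
    have "\<exists>w. (X n, w) \<in> span (h ` I)" for n
      using X(1)[of n] by (force simp: img)
    then obtain W where W: "\<And>n. (X n, W n) \<in> span (h ` I)" by metis
    have W': "(X n, W n) \<in> \<Gamma>" for n
      using W closure_subset unfolding \<Gamma>_def by blast
    have "Cauchy W"
    proof (rule metric_CauchyI)
      fix e :: real assume e: "e > 0"
      have "Cauchy X" using X(2) by (rule LIMSEQ_imp_Cauchy)
      \<comment> \<open>The denominator is \<open>C + 1\<close> since \<open>C\<close> may be
        0.\<close>
      then obtain M where M: "\<And>m n. m \<ge> M \<Longrightarrow> n \<ge> M \<Longrightarrow> dist (X m) (X n) < e / (C + 1)"
        using e C by (meson metric_CauchyD divide_pos_pos add_nonneg_pos zero_less_one)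
      have "dist (W m) (W n) < e" if "m \<ge> M" "n \<ge> M" for m n
      proof -
        have "dist (W m) (W n) \<le> C * dist (X m) (X n)"
          using diff[OF W' W'] by (simp add: dist_norm)
        also have "\<dots> \<le> C * (e / (C + 1))"
          using M[OF that] C by (intro mult_left_mono) auto
        also have "\<dots> < e" using e C by (simp add: field_simps)
        finally show ?thesis .
      qed
      then show "\<exists>M. \<forall>m\<ge>M. \<forall>n\<ge>M. dist (W m) (W n) < e" by blast
    qed
    then obtain w where "W \<longlonglongrightarrow> w" using Cauchy_convergent convergentD by blast
    then have "(\<lambda>n. (X n, W n)) \<longlonglongrightarrow> (x, w)" using X(2) by (intro tendsto_Pair)
    then have "(x, w) \<in> \<Gamma>"
      unfolding \<Gamma>_def using W by (intro in_closureI[of "\<lambda>n. (X n, W n)"]) auto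
    then show ?thesis ..
  qed
  define \<Phi> where "\<Phi> x = (if x \<in> D then SOME w. (x, w) \<in> \<Gamma> else 0)" for x
  have \<Phi>: "(x, \<Phi> x) \<in> \<Gamma>" if "x \<in> D" for x
    using someI_ex[OF ex[OF that]] that by (simp add: \<Phi>_def)
  have eq: "\<Phi> x = w" if "x \<in> D" "(x, w) \<in> \<Gamma>" for x w
    using diff[OF \<Phi>[OF that(1)] that(2)] by simp
  have Dsub: "subspace D" by (simp add: D_def subspace_closure)
  have "\<Phi> (g i) = f i" if "i \<in> I" for i
  proof (rule eq)
    show "g i \<in> D"
      using that span_base[of "g i" "g ` I"] closure_subset unfolding D_def by blast
    show "(g i, f i) \<in> \<Gamma>"
      using that span_base[of "h i" "h ` I"] closure_subset unfolding \<Gamma>_def h_def by blast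
  qed
  moreover have "cont_linear_on D \<Phi>"
    unfolding cont_linear_on_def
  proof (intro conjI ballI allI)
    fix x y assume "x \<in> D" "y \<in> D"
    then show "\<Phi> (x + y) = \<Phi> x + \<Phi> y"
      using subspace_add[OF sub \<Phi> \<Phi>, of x y] Dsub by (intro eq) (auto intro: subspace_add)
  next
    fix r x assume "x \<in> D"
    then show "\<Phi> (r *\<^sub>R x) = r *\<^sub>R \<Phi> x"
      using subspace_scale[OF sub \<Phi>, of x r] Dsub by (intro eq) (auto intro: subspace_scale)
  next
    have "dist (\<Phi> x) (\<Phi> y) \<le> C * dist x y" if "x \<in> D" "y \<in> D" for x y
      using diff[OF \<Phi> \<Phi>, of x y] that by (simp add: dist_norm)
    then show "continuous_on D \<Phi>"
      using C by (intro lipschitz_on_continuous_on[of C] lipschitz_onI)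
  qed
  moreover have "norm (\<Phi> x) \<le> C * norm x" for x
    using bd[OF \<Phi>, of x] C by (cases "x \<in> D") (auto simp: \<Phi>_def)
  moreover have "\<Phi> x = 0" if "x \<notin> D" for x
    using that by (simp add: \<Phi>_def)
  ultimately show ?thesis unfolding D_def by blast
qed

text \<open>The graph construction yields real linearity only. Complex scaling permutes the
  generators by \<open>scale\<close>, so complex homogeneity holds on them and passes to the closed
  span by density.\<close>

lemma bops_extension:
  fixes g :: "'i \<Rightarrow> 'h::chilbert_space" and f :: "'i \<Rightarrow> 'k::chilbert_space"
  assumes scale: "\<And>c i. i \<in> I \<Longrightarrow> \<exists>j\<in>I. g j = c *\<^sub>C g i \<and> f j = c *\<^sub>C f i"
    and bound: "\<And>(n::nat) p. (\<And>k. k < n \<Longrightarrow> p k \<in> I) \<Longrightarrow>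
        norm (\<Sum>k<n. f (p k)) \<le> C * norm (\<Sum>k<n. g (p k))"
    and C: "C \<ge> 0"
  shows "\<exists>T \<in> bops (closure (span (g ` I))) UNIV. (\<forall>i\<in>I. T (g i) = f i) \<and>
    (\<forall>x. norm (T x) \<le> C * norm x)"
proof -
  let ?D = "closure (span (g ` I))"
  have "\<exists>\<Phi>. (\<forall>i\<in>I. \<Phi> (g i) = f i) \<and> cont_linear_on ?D \<Phi> \<and>
    (\<forall>x. norm (\<Phi> x) \<le> C * norm x) \<and> (\<forall>x. x \<notin> ?D \<longrightarrow> \<Phi> x = 0)"
    using scale bound C by (intro bounded_extension) (auto simp: scaleR_scaleC)
  then obtain \<Phi> where \<Phi>: "\<And>i. i \<in> I \<Longrightarrow> \<Phi> (g i) = f i" "cont_linear_on ?D \<Phi>"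
    "\<And>x. norm (\<Phi> x) \<le> C * norm x" "\<And>x. x \<notin> ?D \<Longrightarrow> \<Phi> x = 0" by blast
  have D: "csubspace ?D"
  proof (rule csubspace_closure_span_chilbert)
    fix c x assume "x \<in> g ` I"
    then show "c *\<^sub>C x \<in> g ` I" using scale by (metis image_iff)
  qed
  have "\<Phi> (c *\<^sub>C x) = c *\<^sub>C \<Phi> x" if "x \<in> ?D" for c x
  proof (rule cont_linear_on_eq[where D = ?D and G = "g ` I"
        and f = "\<lambda>x. \<Phi> (c *\<^sub>C x)" and g = "\<lambda>x. c *\<^sub>C \<Phi> x"])
    show "cont_linear_on ?D (\<lambda>x. \<Phi> (c *\<^sub>C x))"
      by (rule cont_linear_on_compose[OF bounded_linear_cont_linear_on[OF bounded_linear_scaleC_chilbert] _ \<Phi>(2)])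
        (use D in \<open>auto intro: csubspace_scaleC\<close>)
    show "cont_linear_on ?D (\<lambda>x. c *\<^sub>C \<Phi> x)"
      by (rule cont_linear_on_compose[OF \<Phi>(2) subset_UNIV
            bounded_linear_cont_linear_on[OF bounded_linear_scaleC_chilbert]])
    fix x assume "x \<in> g ` I"
    then show "\<Phi> (c *\<^sub>C x) = c *\<^sub>C \<Phi> x"
      using scale \<Phi>(1) by (metis imageE)
  qed (use that in auto)
  then have "\<Phi> \<in> bops ?D UNIV"
    using \<Phi>(2-4) by (auto simp: bops_def clinear_on_def cont_linear_on_def)
  then show ?thesis using \<Phi> by blast
qed

text \<open>The convention that operators vanish off their domain turns agreement on generators into
  equality of functions, which is the form of all operator identities in the theorem.\<close>

lemma bops_eq:
  assumes U: "U \<in> bops D K" and V: "V \<in> bops D L" and D: "D = closure (span G)" "csubspace D"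
    and eq: "\<And>x. x \<in> G \<Longrightarrow> U x = V x"
  shows "U = V"
proof
  fix x show "U x = V x"
    using cont_linear_on_eq[OF bops_cont_linear_on[OF U D(2)] bops_cont_linear_on[OF V D(2)] D(1) eq]
      bops_out[OF U] bops_out[OF V] by (cases "x \<in> D") auto
qed

lemma cont_linear_on_range:
  assumes f: "cont_linear_on D f" and D: "D = closure (span G)"
    and E: "subspace E" "closed E" "\<And>x. x \<in> G \<Longrightarrow> f x \<in> E" and x: "x \<in> D"
  shows "f x \<in> E"
proof -
  have "x \<in> closure (span G)" using x D by simp
  then show ?thesis
  proof (induction rule: closure_span_induct)
    case zero
    have "0 \<in> D" using D closure_subset span_zero by blast
    then have "f (0 *\<^sub>R 0) = 0 *\<^sub>R f 0" using f unfolding cont_linear_on_def by blast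
    then show ?case using E(1) by (simp add: subspace_0)
  next
    case (add x y)
    then have "f (x + y) = f x + f y" using f D unfolding cont_linear_on_def by blast
    then show ?case using add E(1) by (simp add: subspace_add)
  next
    case (scale r x)
    then have "f (r *\<^sub>R x) = r *\<^sub>R f x" using f D unfolding cont_linear_on_def by blast
    then show ?case using scale E(1) by (simp add: subspace_scale)
  next
    case (lim h l)
    then have "(f \<circ> h) \<longlonglongrightarrow> f l"
      using f D unfolding cont_linear_on_def continuous_on_sequentially by blast
    then show ?case using lim E(2) by (metis closed_sequentially comp_apply)
  qed (use E in auto)
qed

lemma bops_range:
  assumes T: "T \<in> bops D K" and D: "D = closure (span G)" "csubspace D"
    and E: "csubspace E" "closed E" "\<And>x. x \<in> G \<Longrightarrow> T x \<in> E"
  shows "T \<in> bops D E"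
proof -
  have "T x \<in> E" if "x \<in> D" for x
    by (rule cont_linear_on_range[OF bops_cont_linear_on[OF T D(2)] D(1) csubspace_subspace E(2) _ that])
      (use E in auto)
  then show ?thesis using T by (auto simp: bops_def)
qed

lemma bops_UNIV: "T \<in> bops H K \<Longrightarrow> T \<in> bops H UNIV"
  by (simp add: bops_def)

lemma bops_add: "T \<in> bops H K \<Longrightarrow> x \<in> H \<Longrightarrow> y \<in> H \<Longrightarrow> T (x + y) = T x + T y"
  by (simp add: bops_def clinear_on_def)

lemma bops_scaleC: "T \<in> bops H K \<Longrightarrow> x \<in> H \<Longrightarrow> T (c *\<^sub>C x) = c *\<^sub>C T x"
  by (simp add: bops_def clinear_on_def)

lemma bops_compose:
  assumes S: "S \<in> bops H K" and T: "T \<in> bops K L"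
  shows "T \<circ> S \<in> bops H L"
proof -
  obtain C where C: "C \<ge> 0" "\<And>x. norm (S x) \<le> C * norm x" using bops_bound[OF S] by blast
  obtain D where D: "D \<ge> 0" "\<And>x. norm (T x) \<le> D * norm x" using bops_bound[OF T] by blast
  have "norm (T (S x)) \<le> (D * C) * norm x" for x
    using D(2)[of "S x"] mult_left_mono[OF C(2) D(1), of x] by (simp add: mult.assoc)
  then have "\<exists>C. \<forall>x\<in>H. norm ((T \<circ> S) x) \<le> C * norm x" by auto
  moreover have "T (S x) = 0" if "x \<notin> H" for x
    using that by (simp add: bops_out[OF S] bops_zero[OF T])
  ultimately show ?thesis
    using bops_mem[OF S] bops_mem[OF T] bops_add[OF S] bops_add[OF T] bops_scaleC[OF S] bops_scaleC[OF T]
    by (auto simp: bops_def clinear_on_def)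
qed

lemma id_op_bops: "csubspace H \<Longrightarrow> id_op H \<in> bops H H"
  by (auto simp: bops_def id_op_def clinear_on_def csubspace_add csubspace_scaleC intro: exI[of _ 1])


section \<open>Unitary operators\<close>

lemma clinear_range_csubspace:
  assumes "clinear_on UNIV u"
  shows "csubspace (range u)"
proof -
  have "linear u" using assms by (rule clinear_on_linear)
  then have "subspace (range u)" using linear_subspace_image[of u UNIV] by simp
  moreover have "c *\<^sub>C u x \<in> range u" for c x
    using assms unfolding clinear_on_def by (metis UNIV_I rangeI)
  ultimately show ?thesis by (auto simp: csubspace_def)
qed

lemma clinear_on_sum: "clinear_on UNIV u \<Longrightarrow> u (\<Sum>k\<in>K. f k) = (\<Sum>k\<in>K. u (f k))"
  using linear_sum[OF clinear_on_linear] by blast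

text \<open>Equal Gram matrices make \<open>u x\<close> to \<open>v x\<close> a well-defined
  isometry on dense subspaces. The same construction gives the operators \<open>R\<close>, the
  equivalence in (ii), and the identification of the GNS space of a convolution with a tensor
  product.\<close>

lemma unitary_from_dense:
  fixes u :: "'a::complex_vector \<Rightarrow> 'h::chilbert_space" and v :: "'a \<Rightarrow> 'k::chilbert_space"
  assumes u: "clinear_on UNIV u" "closure (range u) = D"
    and v: "clinear_on UNIV v" "closure (range v) = E"
    and inner: "\<And>x y. cinner (v x) (v y) = cinner (u x) (u y)"
  shows "\<exists>U. unitary_op D E U \<and> (\<forall>x. U (u x) = v x)"
proof -
  have nrm: "norm (v x) = norm (u x)" for x by (rule norm_eq_cinner) (rule inner)
  have span: "span (range u) = range u" "span (range v) = range v"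
    using clinear_range_csubspace u v csubspace_subspace by (metis span_eq_iff)+
  have D: "D = closure (span (range u))" and E: "E = closure (span (range v))"
    using u(2) v(2) by (simp_all only: span)
  have "\<exists>T \<in> bops (closure (span (u ` UNIV))) UNIV. (\<forall>i\<in>UNIV. T (u i) = v i) \<and>
    (\<forall>x. norm (T x) \<le> 1 * norm x)"
  proof (rule bops_extension)
    fix c i
    have "u (c *\<^sub>C i) = c *\<^sub>C u i \<and> v (c *\<^sub>C i) = c *\<^sub>C v i" using u v by (simp add: clinear_on_def)
    then show "\<exists>j\<in>UNIV. u j = c *\<^sub>C u i \<and> v j = c *\<^sub>C v i" by blast
  next
    fix n :: nat and p
    show "norm (\<Sum>k<n. v (p k)) \<le> 1 * norm (\<Sum>k<n. u (p k))"
      by (simp add: clinear_on_sum[OF u(1), symmetric] clinear_on_sum[OF v(1), symmetric] nrm)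
  qed simp
  then obtain U where U: "U \<in> bops D UNIV" "\<And>x. U (u x) = v x" unfolding D[symmetric] by auto
  have csD: "csubspace D" "csubspace E"
    unfolding D E using u v
    by (auto intro!: csubspace_closure_span_chilbert csubspace_scaleC clinear_range_csubspace)
  have UE: "U \<in> bops D E"
  proof (rule bops_range[OF U(1) D csD(1) csD(2)])
    show "closed E" by (simp add: E)
    show "U x \<in> E" if "x \<in> range u" for x
      using that U(2) v(2) closure_subset by fastforce
  qed
  have cont: "continuous_on D U"
    using bops_cont_linear_on[OF UE csD(1)] by (simp add: cont_linear_on_def)
  have seq: "\<exists>X. (\<lambda>n. u (X n)) \<longlonglongrightarrow> x" if "x \<in> D" for x
  proof -
    have "x \<in> closure (range u)" using \<open>x \<in> D\<close> u(2) by simp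
    then obtain f where f: "\<forall>n. f n \<in> range u" "f \<longlonglongrightarrow> x" by (rule in_closureE)
    note f = f(1)[rule_format] f(2)
    have "\<exists>X. \<forall>n. f n = u (X n)" using f(1) by (intro choice) blast
    then obtain X where "\<forall>n. f n = u (X n)" by blast
    then have "f = (\<lambda>n. u (X n))" by (simp add: fun_eq_iff)
    then show ?thesis using f(2) by blast
  qed
  have uD: "u x \<in> D" for x
    unfolding u(2)[symmetric] by (rule subsetD[OF closure_subset]) simp
  have Useq: "(\<lambda>n. v (X n)) \<longlonglongrightarrow> U x" if "(\<lambda>n. u (X n)) \<longlonglongrightarrow> x" "x \<in> D" for X x
  proof -
    have "(\<lambda>n. U (u (X n))) \<longlonglongrightarrow> U x"
      by (rule continuous_on_tendsto_compose[OF cont that]) (simp add: uD)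
    then show ?thesis by (simp add: U(2))
  qed
  have "cinner (U x) (U y) = cinner x y" if xy: "x \<in> D" "y \<in> D" for x y
  proof -
    obtain X Y where X: "(\<lambda>n. u (X n)) \<longlonglongrightarrow> x" and Y: "(\<lambda>n. u (Y n)) \<longlonglongrightarrow> y"
      using seq xy by blast
    have "(\<lambda>n. cinner (v (X n)) (v (Y n))) \<longlonglongrightarrow> cinner (U x) (U y)"
      by (intro tendsto_cinner Useq X Y xy)
    moreover have "(\<lambda>n. cinner (v (X n)) (v (Y n))) \<longlonglongrightarrow> cinner x y"
      unfolding inner by (intro tendsto_cinner X Y)
    ultimately show ?thesis by (rule LIMSEQ_unique)
  qed
  moreover have "E \<subseteq> U ` D"
  proof
    fix y assume "y \<in> E"
    then have "y \<in> closure (range v)" using v(2) by simp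
    then obtain f where f: "\<forall>n. f n \<in> range v" "f \<longlonglongrightarrow> y" by (rule in_closureE)
    note f = f(1)[rule_format] f(2)
    have "\<exists>X. \<forall>n. f n = v (X n)" using f(1) by (intro choice) blast
    then obtain X where "\<forall>n. f n = v (X n)" by blast
    then have X: "f = (\<lambda>n. v (X n))" by (simp add: fun_eq_iff)
    have lin: "linear u" "linear v" using u v clinear_on_linear by auto
    \<comment> \<open>A sequence in the range of \<open>v\<close> converging to \<open>y\<close>
      therefore lifts to a Cauchy sequence in the range of \<open>u\<close>, whose limit is a
      preimage of \<open>y\<close>.\<close>
    have "dist (u x) (u x') = dist (v x) (v x')" for x x'
      using nrm[of "x - x'"] by (simp add: dist_norm linear_diff[OF lin(1)] linear_diff[OF lin(2)])
    then have "Cauchy (\<lambda>n. u (X n))"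
      using LIMSEQ_imp_Cauchy[OF f(2)] by (simp add: X Cauchy_def)
    then obtain x where x: "(\<lambda>n. u (X n)) \<longlonglongrightarrow> x" using Cauchy_convergent convergentD by blast
    have "x \<in> D" unfolding u(2)[symmetric] by (rule in_closureI[OF _ x]) simp
    then have "U x = y" using Useq[OF x] f(2) X LIMSEQ_unique by blast
    then show "y \<in> U ` D" using \<open>x \<in> D\<close> by blast
  qed
  ultimately have "unitary_op D E U"
    using UE unfolding unitary_op_def by (auto simp: bops_mem)
  then show ?thesis using U(2) by blast
qed

text \<open>The inverse of \<open>U\<close>, extended by zero, satisfies the description of the
  adjoint. Any other solution agrees with it by pairing the difference with itself.\<close>

lemma adj_op_unitary:
  assumes U: "unitary_op H K U" and H: "csubspace H" and K: "csubspace K"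
  shows "adj_op H K U \<in> bops K H" "\<And>y. y \<in> K \<Longrightarrow> U (adj_op H K U y) = y"
proof -
  have B: "U \<in> bops H K" "U ` H = K" "\<And>x y. x \<in> H \<Longrightarrow> y \<in> H \<Longrightarrow> cinner (U x) (U y) = cinner x y"
    using U by (auto simp: unitary_op_def)
  have inj: "x = y" if "x \<in> H" "y \<in> H" "U x = U y" for x y
  proof -
    have "cinner (x - y) (x - y) = 0"
      using B(3)[of "x - y" "x - y"] bops_diff[OF B(1) H that(1,2)] that csubspace_diff[OF H] by simp
    then show ?thesis by (simp add: cinner_self)
  qed
  define V where "V y = (if y \<in> K then (SOME x. x \<in> H \<and> U x = y) else 0)" for y
  have V: "V y \<in> H \<and> U (V y) = y" if "y \<in> K" for y
  proof -
    have "\<exists>x. x \<in> H \<and> U x = y" using that B(2) by blast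
    from someI_ex[OF this] show ?thesis using that by (simp add: V_def)
  qed
  have Veq: "V y = x" if "x \<in> H" "U x = y" for x y
    using V[of y] inj that B(2) by blast
  have VB: "V \<in> bops K H"
    unfolding bops_def
  proof (intro CollectI conjI allI impI)
    show "V ` K \<subseteq> H" using V by blast
    show "clinear_on K V"
      unfolding clinear_on_def
      using V H K by (auto intro!: Veq simp: bops_add[OF B(1)] bops_scaleC[OF B(1)]
          csubspace_add csubspace_scaleC)
    have "norm (V y) = norm y" if "y \<in> K" for y
      using V[OF that] B(3)[of "V y" "V y"] by (intro norm_eq_cinner) simp
    then show "\<exists>C. \<forall>x\<in>K. norm (V x) \<le> C * norm x" by (intro exI[of _ 1]) simp
  qed (simp add: V_def)
  have "adj_op H K U = V"
    unfolding adj_op_def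
  proof (rule the_equality)
    show "V \<in> bops K H \<and> (\<forall>x\<in>H. \<forall>y\<in>K. cinner (U x) y = cinner x (V y))"
      using VB V B(3) by metis
    fix S assume S: "S \<in> bops K H \<and> (\<forall>x\<in>H. \<forall>y\<in>K. cinner (U x) y = cinner x (S y))"
    show "S = V"
    proof
      fix y show "S y = V y"
      proof (cases "y \<in> K")
        case True
        then have m: "S y \<in> H" "V y \<in> H" using S V bops_mem by blast+
        define d where "d = S y - V y"
        have "d \<in> H" using m by (simp add: d_def csubspace_diff[OF H])
        moreover have "cinner d (S y) = cinner d (V y)" if "d \<in> H" for d
          using S V[OF True] B(3)[OF that m(2)] True that by metis
        ultimately have "cinner d d = 0" by (simp add: d_def cinner_diff_right)
        then show ?thesis by (simp add: cinner_self d_def)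
      next
        case False
        then have "S y = 0" using S bops_out by blast
        then show ?thesis using False by (simp add: V_def)
      qed
    qed
  qed
  then show "adj_op H K U \<in> bops K H" "\<And>y. y \<in> K \<Longrightarrow> U (adj_op H K U y) = y"
    using VB V by auto
qed


section \<open>Tensor products of operators\<close>

lemma cbilinear_apply:
  assumes "cbilinear s"
  shows cbilinear_add_left: "s (x + x') y = s x y + s x' y"
    and cbilinear_add_right: "s x (y + y') = s x y + s x y'"
    and cbilinear_scaleC_left: "s (c *\<^sub>C x) y = c *\<^sub>C s x y"
    and cbilinear_scaleC_right: "s x (c *\<^sub>C y) = c *\<^sub>C s x y"
  using assms by (auto simp: cbilinear_def clinear_on_def)

definition tensor_map :: "('h::chilbert_space \<Rightarrow> 'k::chilbert_space \<Rightarrow> 'l::chilbert_space) \<Rightarrow> bool" where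
  "tensor_map s \<longleftrightarrow> cbilinear s \<and> (\<forall>x y x' y'. cinner (s x y) (s x' y') = cinner x x' * cinner y y')"

lemma hilbert_tensor_map: "hilbert_tensor s \<Longrightarrow> tensor_map s"
  by (simp add: hilbert_tensor_def tensor_map_def)

lemma tensor_map_norm:
  assumes "tensor_map s"
  shows "norm (s x y) = norm x * norm y"
proof -
  have "complex_of_real ((norm (s x y))\<^sup>2) = of_real ((norm x * norm y)\<^sup>2)"
    using assms by (simp only: cinner_self[symmetric] tensor_map_def) (simp add: cinner_self power_mult_distrib)
  then have "(norm (s x y))\<^sup>2 = (norm x * norm y)\<^sup>2" using of_real_eq_iff by blast
  then show ?thesis by simp
qed

lemma tensor_map_bounded_linear:
  assumes "tensor_map s"
  shows "bounded_linear (\<lambda>x. s x y)" "bounded_linear (\<lambda>y. s x y)"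
proof -
  have b: "cbilinear s" using assms by (simp add: tensor_map_def)
  show "bounded_linear (\<lambda>x. s x y)"
    by (rule bounded_linear_intro[of _ "norm y"])
      (simp_all add: cbilinear_apply[OF b] scaleR_scaleC tensor_map_norm[OF assms])
  show "bounded_linear (\<lambda>y. s x y)"
    by (rule bounded_linear_intro[of _ "norm x"])
      (simp_all add: cbilinear_apply[OF b] scaleR_scaleC tensor_map_norm[OF assms] mult.commute)
qed

text \<open>Gram-Schmidt: the coefficients of the \<open>w k\<close> in a finite orthonormal system
  factor their Gram matrix. It takes the place of an orthonormal basis of the second tensor
  factor.\<close>

lemma gram_factorization:
  fixes w :: "nat \<Rightarrow> 'k::chilbert_space"
  shows "\<exists>(m::nat) c. \<forall>k<n. \<forall>l<n. cinner (w k) (w l) = (\<Sum>j<m. cnj (c k j) * c l j)"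
proof -
  have "\<exists>(m::nat) e c. (\<forall>i<m. \<forall>j<m. cinner (e i) (e j) = (if i = j then 1 else 0)) \<and>
      (\<forall>k<n. w k = (\<Sum>j<m. c k j *\<^sub>C e j))"
  proof (induction n)
    case 0
    show ?case by (intro exI[of _ 0]) simp
  next
    case (Suc n)
    then obtain m e c where IH: "\<And>i j. i < (m::nat) \<Longrightarrow> j < m \<Longrightarrow> cinner (e i) (e j) = (if i = j then 1 else 0)"
      "\<And>k. k < n \<Longrightarrow> w k = (\<Sum>j<m. c k j *\<^sub>C e j)" by blast
    \<comment> \<open>The part of the new vector orthogonal to the system found so far. If it
      vanishes, the system is kept; otherwise its normalization is added.\<close>
    define r where "r = w n - (\<Sum>j<m. cinner (e j) (w n) *\<^sub>C e j)"
    have er: "cinner (e i) r = 0" if "i < m" for i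
    proof -
      have "cinner (e i) (\<Sum>j<m. cinner (e j) (w n) *\<^sub>C e j) =
          (\<Sum>j<m. cinner (e j) (w n) * (if i = j then 1 else 0))"
        using that by (auto simp: cinner_sum_right cinner_scaleC_right IH intro!: sum.cong)
      also have "\<dots> = (\<Sum>j<m. if i = j then cinner (e j) (w n) else 0)"
        by (intro sum.cong) auto
      finally show ?thesis using that by (simp add: r_def cinner_diff_right)
    qed
    show ?case
    proof (cases "r = 0")
      case True
      define c' where "c' k j = (if k < n then c k j else cinner (e j) (w n))" for k j
      have "w k = (\<Sum>j<m. c' k j *\<^sub>C e j)" if "k < Suc n" for k
        using that True IH(2)[of k] by (cases "k < n") (auto simp: c'_def r_def less_Suc_eq)
      then show ?thesis using IH(1) by (intro exI[of _ m] exI[of _ e] exI[of _ c']) simp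
    next
      case False
      define e' where "e' j = (if j < m then e j else (1 / complex_of_real (norm r)) *\<^sub>C r)" for j
      define c' where "c' k j = (if k < n then (if j < m then c k j else 0)
          else (if j < m then cinner (e j) (w n) else complex_of_real (norm r)))" for k j
      have re: "cinner r (e i) = 0" if "i < m" for i
        using er[OF that] by (subst cinner_commute) simp
      have rr: "cinner (e' m) (e' m) = 1"
        using False by (simp add: e'_def cinner_self norm_scaleC_chilbert norm_divide)
      have 1: "cinner (e' i) (e' j) = (if i = j then 1 else 0)" if "i < Suc m" "j < Suc m" for i j
      proof (cases "i = m \<and> j = m")
        case True
        then show ?thesis using rr by simp
      next
        case False
        then show ?thesis
          using that er re IH(1) by (auto simp: e'_def cinner_scaleC_left cinner_scaleC_right less_Suc_eq)
      qed
      have 2: "w k = (\<Sum>j<Suc m. c' k j *\<^sub>C e' j)" if "k < Suc n" for k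
      proof (cases "k < n")
        case True
        then show ?thesis using IH(2)[of k] by (simp add: c'_def e'_def)
      next
        case F: False
        then have "k = n" using that by simp
        moreover have "complex_of_real (norm r) *\<^sub>C ((1 / complex_of_real (norm r)) *\<^sub>C r) = r"
          using False by (simp add: scaleC_scaleC)
        ultimately show ?thesis by (simp add: c'_def e'_def r_def)
      qed
      show ?thesis using 1 2 by (intro exI[of _ "Suc m"] exI[of _ e'] exI[of _ c']) blast
    qed
  qed
  then obtain m e c where ec: "\<And>i j. i < (m::nat) \<Longrightarrow> j < m \<Longrightarrow> cinner (e i) (e j) = (if i = j then 1 else 0)"
      "\<And>k. k < n \<Longrightarrow> w k = (\<Sum>j<m. c k j *\<^sub>C e j)" by blast
  have "cinner (w k) (w l) = (\<Sum>j<m. cnj (c k j) * c l j)" if "k < n" "l < n" for k l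
  proof -
    have "cinner (w k) (w l) = (\<Sum>i<m. \<Sum>j<m. cnj (c k i) * (c l j * cinner (e i) (e j)))"
      unfolding ec(2)[OF that(1)] ec(2)[OF that(2)] cinner_sum_left
      by (simp add: cinner_sum_right cinner_scaleC_left cinner_scaleC_right sum_distrib_left ac_simps)
    also have "\<dots> = (\<Sum>i<m. \<Sum>j<m. if i = j then cnj (c k i) * c l j else 0)"
      by (intro sum.cong) (auto simp: ec(1))
    finally show ?thesis by simp
  qed
  then show ?thesis by blast
qed

text \<open>The estimate for \<open>S\<close> tensored with the identity. With the Gram matrix of
  \<open>w\<close> factored by \<open>c\<close>, the double sum becomes a sum over \<open>j\<close>
  of squared norms of the vectors with coefficients \<open>c k j\<close>, and \<open>S\<close> is
  estimated in each term separately.\<close>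

lemma gram_sum_mono:
  fixes S :: "'h::chilbert_space \<Rightarrow> 'h2::chilbert_space" and w :: "nat \<Rightarrow> 'k::chilbert_space"
  assumes H: "csubspace H" and S: "clinear_on H S" "\<And>x. x \<in> H \<Longrightarrow> norm (S x) \<le> C * norm x" "C \<ge> 0"
    and x: "\<And>k. k < n \<Longrightarrow> x k \<in> H"
  shows "Re (\<Sum>k<n. \<Sum>l<n. cinner (S (x k)) (S (x l)) * cinner (w k) (w l))
    \<le> C\<^sup>2 * Re (\<Sum>k<n. \<Sum>l<n. cinner (x k) (x l) * cinner (w k) (w l))"
proof -
  obtain m c where c: "\<And>k l. k < n \<Longrightarrow> l < n \<Longrightarrow> cinner (w k) (w l) = (\<Sum>j<m::nat. cnj (c k j) * c l j)"
    using gram_factorization[of n w] by blast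
  have eq: "(\<Sum>k<n. \<Sum>l<n. cinner (u k) (u l) * cinner (w k) (w l)) =
      (\<Sum>j<m. of_real ((norm (\<Sum>k<n. c k j *\<^sub>C u k))\<^sup>2))" for u :: "nat \<Rightarrow> 'z::chilbert_space"
  proof -
    have "(\<Sum>k<n. \<Sum>l<n. cinner (u k) (u l) * cinner (w k) (w l)) =
        (\<Sum>k<n. \<Sum>l<n. \<Sum>j<m. cnj (c k j) * (c l j * cinner (u k) (u l)))"
      by (intro sum.cong refl) (simp add: c sum_distrib_left ac_simps)
    also have "\<dots> = (\<Sum>k<n. \<Sum>j<m. \<Sum>l<n. cnj (c k j) * (c l j * cinner (u k) (u l)))"
      by (intro sum.cong refl sum.swap)
    also have "\<dots> = (\<Sum>j<m. \<Sum>k<n. \<Sum>l<n. cnj (c k j) * (c l j * cinner (u k) (u l)))"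
      by (rule sum.swap)
    also have "\<dots> = (\<Sum>j<m. cinner (\<Sum>k<n. c k j *\<^sub>C u k) (\<Sum>k<n. c k j *\<^sub>C u k))"
      unfolding cinner_sum_left
      by (simp add: cinner_sum_right cinner_scaleC_left cinner_scaleC_right sum_distrib_left ac_simps)
    finally show ?thesis by (simp add: cinner_self)
  qed
  have lin: "(\<Sum>k\<in>N. a k *\<^sub>C S (x k)) = S (\<Sum>k\<in>N. a k *\<^sub>C x k) \<and> (\<Sum>k\<in>N. a k *\<^sub>C x k) \<in> H"
    if "N \<subseteq> {..<n}" "finite N" for a N
    using that(2,1)
  proof (induction N)
    case empty
    have "S 0 = 0" using S(1) csubspace_0[OF H] clinear_on_zero by blast
    then show ?case by (simp add: csubspace_0[OF H])
  next
    case (insert k N)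
    have "x k \<in> H" using insert x by auto
    then have "a k *\<^sub>C x k \<in> H" "S (a k *\<^sub>C x k) = a k *\<^sub>C S (x k)"
      using S(1) csubspace_scaleC[OF H] by (auto simp: clinear_on_def)
    then show ?case using insert S(1) csubspace_add[OF H] by (auto simp: clinear_on_def)
  qed
  have "(norm (\<Sum>k<n. c k j *\<^sub>C S (x k)))\<^sup>2 \<le> C\<^sup>2 * (norm (\<Sum>k<n. c k j *\<^sub>C x k))\<^sup>2" for j
  proof -
    have l: "(\<Sum>k<n. c k j *\<^sub>C S (x k)) = S (\<Sum>k<n. c k j *\<^sub>C x k)" "(\<Sum>k<n. c k j *\<^sub>C x k) \<in> H"
      using lin[of "{..<n}" "\<lambda>k. c k j"] by auto
    have "(norm (\<Sum>k<n. c k j *\<^sub>C S (x k)))\<^sup>2 \<le> (C * norm (\<Sum>k<n. c k j *\<^sub>C x k))\<^sup>2"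
      unfolding l(1) using S(2)[OF l(2)] by (rule power_mono) simp
    then show ?thesis by (simp add: power_mult_distrib)
  qed
  then show ?thesis
    by (simp only: eq Re_sum Re_complex_of_real sum_distrib_left) (rule sum_mono)
qed

lemma tensor_norm_sum:
  assumes "tensor_map s"
  shows "(norm (\<Sum>k<n::nat. s (x k) (y k)))\<^sup>2 = Re (\<Sum>k<n. \<Sum>l<n. cinner (x k) (x l) * cinner (y k) (y l))"
  using assms unfolding norm_sq_cinner cinner_sum_left
  by (simp only: cinner_sum_right tensor_map_def)

text \<open>One factor at a time: \<open>S\<close> is removed while the \<open>T (y k)\<close> play
  the role of \<open>w\<close>, then \<open>T\<close> is removed with the \<open>x k\<close> in that
  role.\<close>

lemma tensor_sum_bound:
  assumes s: "tensor_map s" "tensor_map s'" and H: "csubspace H" "csubspace K"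
    and S: "clinear_on H S" "\<And>x. x \<in> H \<Longrightarrow> norm (S x) \<le> C * norm x" "C \<ge> 0"
    and T: "clinear_on K T" "\<And>x. x \<in> K \<Longrightarrow> norm (T x) \<le> D * norm x" "D \<ge> 0"
    and x: "\<And>k. k < n \<Longrightarrow> x k \<in> H" and y: "\<And>k. k < n \<Longrightarrow> y k \<in> K"
  shows "norm (\<Sum>k<n::nat. s' (S (x k)) (T (y k))) \<le> C * D * norm (\<Sum>k<n. s (x k) (y k))"
proof -
  have "(norm (\<Sum>k<n. s' (S (x k)) (T (y k))))\<^sup>2 \<le>
      C\<^sup>2 * Re (\<Sum>k<n. \<Sum>l<n. cinner (x k) (x l) * cinner (T (y k)) (T (y l)))"
    unfolding tensor_norm_sum[OF s(2)] by (rule gram_sum_mono[OF H(1) S x])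
  also have "(\<Sum>k<n. \<Sum>l<n. cinner (x k) (x l) * cinner (T (y k)) (T (y l))) =
      (\<Sum>k<n. \<Sum>l<n. cinner (T (y k)) (T (y l)) * cinner (x k) (x l))"
    by (simp add: mult.commute)
  also have "C\<^sup>2 * Re \<dots> \<le> C\<^sup>2 * (D\<^sup>2 * Re (\<Sum>k<n. \<Sum>l<n. cinner (y k) (y l) * cinner (x k) (x l)))"
    by (intro mult_left_mono gram_sum_mono[OF H(2) T y]) auto
  also have "(\<Sum>k<n. \<Sum>l<n. cinner (y k) (y l) * cinner (x k) (x l)) =
      (\<Sum>k<n. \<Sum>l<n. cinner (x k) (x l) * cinner (y k) (y l))"
    by (simp add: mult.commute)
  finally have "(norm (\<Sum>k<n. s' (S (x k)) (T (y k))))\<^sup>2 \<le> (C * D * norm (\<Sum>k<n. s (x k) (y k)))\<^sup>2"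
    unfolding tensor_norm_sum[OF s(1), symmetric] by (simp only: power_mult_distrib mult.assoc)
  then show ?thesis using S(3) T(3) by (intro power2_le_imp_le[OF _ mult_nonneg_nonneg]) auto
qed

lemma tensor_space_image: "tensor_space s H K = closure (span ((\<lambda>(x, y). s x y) ` (H \<times> K)))"
proof -
  have "{s x y | x y. x \<in> H \<and> y \<in> K} = (\<lambda>(x, y). s x y) ` (H \<times> K)" by auto
  then show ?thesis by (simp add: tensor_space_def)
qed

lemma tensor_space_closed: "closed (tensor_space s H K)"
  by (simp add: tensor_space_def)

lemma tensor_space_mem: "x \<in> H \<Longrightarrow> y \<in> K \<Longrightarrow> s x y \<in> tensor_space s H K"
  unfolding tensor_space_def by (rule subsetD[OF closure_subset span_base]) blast


lemma tensor_space_csubspace: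
  assumes "tensor_map s" "csubspace H"
  shows "csubspace (tensor_space s H K)"
  unfolding tensor_space_def
proof (rule csubspace_closure_span_chilbert)
  fix c z assume "z \<in> {s x y | x y. x \<in> H \<and> y \<in> K}"
  then obtain x y where "z = s x y" "x \<in> H" "y \<in> K" by blast
  moreover have "cbilinear s" using assms(1) by (simp add: tensor_map_def)
  ultimately have "c *\<^sub>C z = s (c *\<^sub>C x) y" "c *\<^sub>C x \<in> H"
    by (simp_all add: cbilinear_scaleC_left csubspace_scaleC[OF assms(2)])
  then show "c *\<^sub>C z \<in> {s x y | x y. x \<in> H \<and> y \<in> K}" using \<open>y \<in> K\<close> by blast
qed

lemma hilbert_tensor_space_UNIV: "hilbert_tensor s \<Longrightarrow> tensor_space s UNIV UNIV = UNIV"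
  by (simp add: hilbert_tensor_def tensor_space_def)

text \<open>A second tensor map \<open>s'\<close> on the target side allows one construction to
  serve for tensor operators, for flips (\<open>s'\<close> with exchanged arguments), and for the
  passage from two legs to three in the cyclicity argument.\<close>

lemma tensor_bops_exists:
  assumes s: "tensor_map s" "tensor_map s'" and H: "csubspace H" "csubspace K"
    and S: "clinear_on H S" "\<And>x. x \<in> H \<Longrightarrow> norm (S x) \<le> C * norm x" "C \<ge> 0"
    and T: "clinear_on K T" "\<And>x. x \<in> K \<Longrightarrow> norm (T x) \<le> D * norm x" "D \<ge> 0"
  shows "\<exists>U \<in> bops (tensor_space s H K) UNIV. (\<forall>x\<in>H. \<forall>y\<in>K. U (s x y) = s' (S x) (T y)) \<and>
    (\<forall>z. norm (U z) \<le> C * D * norm z)"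
proof -
  have b: "cbilinear s" "cbilinear s'" using s by (simp_all add: tensor_map_def)
  have "\<exists>U \<in> bops (closure (span ((\<lambda>(x, y). s x y) ` (H \<times> K)))) UNIV.
     (\<forall>i\<in>H \<times> K. U ((\<lambda>(x, y). s x y) i) = (\<lambda>(x, y). s' (S x) (T y)) i) \<and> (\<forall>z. norm (U z) \<le> C * D * norm z)"
  proof (rule bops_extension)
    fix c i assume "i \<in> H \<times> K"
    then obtain x y where "i = (x, y)" "x \<in> H" "y \<in> K" by blast
    then show "\<exists>j\<in>H \<times> K. (\<lambda>(x, y). s x y) j = c *\<^sub>C (\<lambda>(x, y). s x y) i \<and>
        (\<lambda>(x, y). s' (S x) (T y)) j = c *\<^sub>C (\<lambda>(x, y). s' (S x) (T y)) i"
      using S(1) csubspace_scaleC[OF H(1)] b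
      by (intro bexI[of _ "(c *\<^sub>C x, y)"]) (auto simp: cbilinear_scaleC_left clinear_on_def)
  next
    fix n :: nat and p assume p: "\<And>k. k < n \<Longrightarrow> p k \<in> H \<times> K"
    have "norm (\<Sum>k<n. s' (S (fst (p k))) (T (snd (p k)))) \<le> C * D * norm (\<Sum>k<n. s (fst (p k)) (snd (p k)))"
      by (rule tensor_sum_bound[OF s H S T]) (use p in \<open>auto simp: mem_Times_iff\<close>)
    then show "norm (\<Sum>k<n. (\<lambda>(x, y). s' (S x) (T y)) (p k)) \<le> C * D * norm (\<Sum>k<n. (\<lambda>(x, y). s x y) (p k))"
      by (simp add: case_prod_beta)
  next
    show "0 \<le> C * D" using S T by simp
  qed
  then show ?thesis unfolding tensor_space_image[symmetric] by auto
qed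

lemma tensor_bops_eq:
  assumes "tensor_map s" "csubspace H" "U \<in> bops (tensor_space s H K) L" "V \<in> bops (tensor_space s H K) M"
    and "\<And>x y. x \<in> H \<Longrightarrow> y \<in> K \<Longrightarrow> U (s x y) = V (s x y)"
  shows "U = V"
  by (rule bops_eq[OF assms(3,4) tensor_space_def tensor_space_csubspace[OF assms(1,2)]])
    (use assms(5) in auto)

lemma tensor_op_eqI:
  assumes s: "tensor_map s" and H: "csubspace H" and U: "U \<in> bops (tensor_space s H K) L"
    and eq: "\<And>x y. x \<in> H \<Longrightarrow> y \<in> K \<Longrightarrow> U (s x y) = s (S x) (T y)"
  shows "tensor_op s H K S T = U"
  unfolding tensor_op_def
proof (rule the_equality)
  show "U \<in> bops (tensor_space s H K) UNIV \<and> (\<forall>x\<in>H. \<forall>y\<in>K. U (s x y) = s (S x) (T y))"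
    using bops_UNIV[OF U] eq by blast
  fix V assume "V \<in> bops (tensor_space s H K) UNIV \<and> (\<forall>x\<in>H. \<forall>y\<in>K. V (s x y) = s (S x) (T y))"
  then show "V = U" using eq by (intro tensor_bops_eq[OF s H _ U]) auto
qed

lemma tensor_op_props:
  assumes s: "tensor_map s" and H: "csubspace H" "csubspace K"
    and S: "clinear_on H S" "\<And>x. x \<in> H \<Longrightarrow> norm (S x) \<le> C * norm x" "C \<ge> 0"
    and T: "clinear_on K T" "\<And>x. x \<in> K \<Longrightarrow> norm (T x) \<le> D * norm x" "D \<ge> 0"
  shows "tensor_op s H K S T \<in> bops (tensor_space s H K) UNIV"
    and "\<And>x y. x \<in> H \<Longrightarrow> y \<in> K \<Longrightarrow> tensor_op s H K S T (s x y) = s (S x) (T y)"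
    and "\<And>z. norm (tensor_op s H K S T z) \<le> C * D * norm z"
proof -
  obtain U where U: "U \<in> bops (tensor_space s H K) UNIV"
    "\<And>x y. x \<in> H \<Longrightarrow> y \<in> K \<Longrightarrow> U (s x y) = s (S x) (T y)" "\<And>z. norm (U z) \<le> C * D * norm z"
    using tensor_bops_exists[OF s s H S T] by blast
  have "tensor_op s H K S T = U" by (rule tensor_op_eqI[OF s H(1) U(1,2)])
  then show "tensor_op s H K S T \<in> bops (tensor_space s H K) UNIV"
    and "\<And>x y. x \<in> H \<Longrightarrow> y \<in> K \<Longrightarrow> tensor_op s H K S T (s x y) = s (S x) (T y)"
    and "\<And>z. norm (tensor_op s H K S T z) \<le> C * D * norm z"
    using U by auto
qed

lemma tensor_op_bops:
  assumes s: "tensor_map s" and H: "csubspace H" "csubspace K"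
    and S: "S \<in> bops H L" and T: "T \<in> bops K M"
  shows tensor_op_mem: "tensor_op s H K S T \<in> bops (tensor_space s H K) (tensor_space s L M)"
    and tensor_op_apply: "\<And>x y. x \<in> H \<Longrightarrow> y \<in> K \<Longrightarrow> tensor_op s H K S T (s x y) = s (S x) (T y)"
proof -
  obtain C where C: "C \<ge> 0" "\<And>x. norm (S x) \<le> C * norm x" using bops_bound[OF S] by blast
  obtain D where D: "D \<ge> 0" "\<And>x. norm (T x) \<le> D * norm x" using bops_bound[OF T] by blast
  note P = tensor_op_props[OF s H bops_clinear[OF S] C(2) C(1) bops_clinear[OF T] D(2) D(1)]
  show a: "\<And>x y. x \<in> H \<Longrightarrow> y \<in> K \<Longrightarrow> tensor_op s H K S T (s x y) = s (S x) (T y)"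
    by (rule P(2))
  have sub: "subspace (tensor_space s L M)"
    unfolding tensor_space_def by (intro subspace_closure subspace_span)
  have "tensor_op s H K S T z \<in> tensor_space s L M" if "z \<in> tensor_space s H K" for z
  proof (rule cont_linear_on_range[OF bops_cont_linear_on[OF P(1) tensor_space_csubspace[OF s H(1)]]
        tensor_space_def sub tensor_space_closed _ that])
    fix u assume "u \<in> {s x y |x y. x \<in> H \<and> y \<in> K}"
    then show "tensor_op s H K S T u \<in> tensor_space s L M"
      using a bops_mem[OF S] bops_mem[OF T] by (auto intro!: tensor_space_mem)
  qed
  then show "tensor_op s H K S T \<in> bops (tensor_space s H K) (tensor_space s L M)"
    using P(1) by (auto simp: bops_def)
qed


section \<open>The cyclic vector of a state\<close>

text \<open>In the unitization \<open>1 - d^2 = (1 - c^2)^2\<close>. The square root exists because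
  \<open>d^2 = 2 * c^2 * (1 - h)\<close> with \<open>h = c^2 / 2\<close> of norm below 1: with
  \<open>1 - h = (1 - k)^2\<close>, take \<open>d\<close> to be \<open>c * (1 - k)\<close> times the
  square root of 2.\<close>

lemma contraction_doubling:
  fixes c :: "'a::cstar_algebra"
  assumes c: "star c = c" "norm c \<le> 1"
  shows "\<exists>d. star d = d \<and> norm d \<le> 1 \<and> d * d = c * c + c * c - (c * c) * (c * c)"
proof -
  define h where "h = (1/2) *\<^sub>R (c * c)"
  have "norm (c * c) \<le> 1"
    using c norm_star_mult_self[of c] by (simp add: power_le_one)
  then have "norm h < 1" by (simp add: h_def)
  moreover have "star h = h" by (simp add: h_def star_scaleR star_mult c)
  ultimately obtain k where k: "star k = k" "k + k - k * k = h" "\<And>x. x * h = h * x \<Longrightarrow> x * k = k * x"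
    using cstar_sqrt[of h] by blast
  have ck: "c * k = k * c" by (rule k(3)) (simp add: h_def mult.assoc)
  define d where "d = sqrt 2 *\<^sub>R (c - c * k)"
  have "d * d = 2 *\<^sub>R ((c - c * k) * (c - c * k))"
    by (simp add: d_def)
  also have "(c - c * k) * (c - c * k) = c * c - c * c * (k + k - k * k)"
  proof -
    have kc: "k * (c * z) = c * (k * z)" for z
      by (simp add: ck mult.assoc[symmetric])
    show ?thesis by (simp add: algebra_simps kc ck[symmetric])
  qed
  also have "2 *\<^sub>R \<dots> = c * c + c * c - (c * c) * (c * c)"
    by (simp add: k(2) h_def scaleR_diff_right scaleR_2)
  finally have dd: "d * d = c * c + c * c - (c * c) * (c * c)" .
  have sd: "star d = d" by (simp add: d_def star_scaleR star_diff star_mult c k(1) ck)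
  have "(c - c * k) * c = c * (c - c * k)"
    by (simp add: left_diff_distrib right_diff_distrib mult.assoc ck[symmetric])
  then have "(c - c * k) * (c * c) = (c * c) * (c - c * k)"
    by (metis mult.assoc)
  then have "d * (c * c) = (c * c) * d" by (simp add: d_def)
  then have "norm d \<le> 1"
    by (intro norm_le_one_if_sq_eq[of d "c * c"]) (simp_all add: sd dd star_mult c)
  then show ?thesis using sd dd by blast
qed

text \<open>
  An approximate unit: \<open>1 - \<pi> e = B\<^bsup>N\<^esup>\<close> with \<open>N\<close> a power of two and \<open>B = 1 - \<pi> (g\<^sup>2)\<close>, where \<open>g\<close> is a
  small multiple of \<open>a a\<^sup>*\<close>. As \<open>\<parallel>\<pi> g v\<parallel>\<^sup>2 \<le> \<parallel>v\<parallel>\<^sup>2 - \<parallel>B v\<parallel>\<^sup>2\<close>, the powers of \<open>B\<close> tend to \<open>0\<close> on the range of \<open>\<pi> a\<close>.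
\<close>

lemma star_rep_approximate_unit:
  fixes \<pi> :: "'a::cstar_algebra \<Rightarrow> 'h::chilbert_space \<Rightarrow> 'h"
  assumes rep: "star_rep H \<pi>" and w: "w \<in> H" and d: "d > 0"
  shows "\<exists>e. norm e \<le> 1 \<and> norm (\<pi> a w - \<pi> e (\<pi> a w)) < d \<and>
    (\<forall>v\<in>H. norm (v - \<pi> e v) \<le> norm v)"
proof (cases "a = 0")
  case True
  then show ?thesis using d by (intro exI[of _ 0]) (simp add: star_rep_zero[OF rep])
next
  case False
  \<comment> \<open>Chosen so that \<open>norm g = 1/2\<close>; then \<open>g * g\<close> lies in
    the open unit ball, and \<open>g\<close> can start the doubling of contractions below.\<close>
  define r where "r = 1 / (2 * (norm a)\<^sup>2)"
  have r: "r > 0" using False by (simp add: r_def)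
  define g where "g = r *\<^sub>R (a * star a)"
  have ng: "norm g = 1/2" using False r by (simp add: g_def norm_mult_star_self r_def)
  have sg: "star g = g" by (simp add: g_def star_scaleR star_mult star_star)
  have gg: "norm (g * g) < 1" "star (g * g) = g * g"
    using norm_star_mult_self[of g] by (simp_all add: sg ng power2_eq_square star_mult)
  obtain k where k: "star k = k" "k + k - k * k = g * g"
    using cstar_sqrt[OF gg(2,1)] by blast
  define B where "B v = v - \<pi> (g * g) v" for v
  define M where "M v = v - \<pi> k v" for v
  note mem = star_rep_mem[OF rep]
  have cs: "csubspace H" using rep by (rule star_rep_csubspace)
  have BH: "B v \<in> H" if "v \<in> H" for v using that mem csubspace_diff[OF cs] by (simp add: B_def)
  have MH: "M v \<in> H" if "v \<in> H" for v using that mem csubspace_diff[OF cs] by (simp add: M_def)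
  \<comment> \<open>\<open>M\<close> is a self-adjoint square root of \<open>B\<close>. The exact
    identity for the squared norm of \<open>M v\<close> thereby becomes an estimate for
    \<open>B v\<close>.\<close>
  have MM: "B v = M (M v)" if "v \<in> H" for v
  proof -
    have "\<pi> k (v - \<pi> k v) = \<pi> k v - \<pi> k (\<pi> k v)"
      using that mem by (intro bops_diff[OF star_rep_bops[OF rep] cs])
    then show ?thesis
      by (simp add: B_def M_def k(2)[symmetric] star_rep_diff[OF rep] star_rep_add[OF rep] star_rep_mult[OF rep])
  qed
  have M2: "(norm (M v))\<^sup>2 = (norm v)\<^sup>2 - (norm (\<pi> g v))\<^sup>2" if v: "v \<in> H" for v
  proof -
    have "cinner v (\<pi> (g * g) v) = cinner (\<pi> g v) (\<pi> g v)"
      using star_rep_adj[OF rep v, of "\<pi> g v" g] mem[OF v] by (simp add: star_rep_mult[OF rep] sg)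
    then show ?thesis
      using star_rep_complement_sq[OF rep k(1) v] by (simp add: M_def k(2) norm_sq_cinner)
  qed
  have M1: "norm (M v) \<le> norm v" if "v \<in> H" for v
    by (rule power2_le_imp_le) (simp_all add: M2[OF that])
  have BM: "norm (B v) \<le> norm (M v)" if "v \<in> H" for v
    using M1[OF MH[OF that]] MM[OF that] by simp
  have B1: "norm (B v) \<le> norm v" if "v \<in> H" for v
    using BM[OF that] M1[OF that] by simp
  have Bg: "(norm (\<pi> g v))\<^sup>2 \<le> (norm v)\<^sup>2 - (norm (B v))\<^sup>2" if "v \<in> H" for v
    using M2[OF that] power_mono[OF BM[OF that], of 2] by simp
  have Bn: "(B ^^ n) v \<in> H" "norm ((B ^^ n) v) \<le> norm v" if "v \<in> H" for n v
    using that BH B1 by (induction n) (auto intro: order_trans)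
  have Badj: "cinner ((B ^^ n) u) v = cinner u ((B ^^ n) v)" if "u \<in> H" "v \<in> H" for n u v
    using that
  proof (induction n arbitrary: v)
    case (Suc n)
    have "cinner (B x) y = cinner x (B y)" if "x \<in> H" "y \<in> H" for x y
      using star_rep_adj[OF rep that, of "g * g"] by (simp add: B_def cinner_diff_left cinner_diff_right gg(2))
    then have "cinner ((B ^^ Suc n) u) v = cinner ((B ^^ n) u) (B v)"
      using Suc.prems Bn by simp
    also have "\<dots> = cinner u ((B ^^ Suc n) v)"
      using Suc BH by (simp add: funpow_Suc_right del: funpow.simps)
    finally show ?case .
  qed simp
  define v where "v = \<pi> a w"
  have v: "v \<in> H" using w mem by (simp add: v_def)
  define f where "f n = norm (\<pi> g ((B ^^ n) v))" for n
  \<comment> \<open>The squares of \<open>f n\<close> are bounded by consecutive differences of the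
    decreasing nonnegative sequence \<open>q\<close>, hence tend to 0.\<close>
  have f0: "f \<longlonglongrightarrow> 0"
  proof -
    define q where "q n = (norm ((B ^^ n) v))\<^sup>2" for n
    have "q (Suc n) \<le> q n" for n
      using B1[OF Bn(1)[OF v]] by (simp add: q_def power_mono)
    then have "decseq q" by (rule decseq_SucI)
    moreover have "0 \<le> q n" for n by (simp add: q_def)
    ultimately obtain L where L: "q \<longlonglongrightarrow> L" using decseq_convergent[of q 0] by metis
    have "(\<lambda>n. q n - q (Suc n)) \<longlonglongrightarrow> L - L"
      by (intro tendsto_diff L LIMSEQ_Suc[OF L])
    moreover have "(f n)\<^sup>2 \<le> q n - q (Suc n)" for n
      using Bg[OF Bn(1)[OF v]] by (simp add: f_def q_def)
    ultimately have "(\<lambda>n. (f n)\<^sup>2) \<longlonglongrightarrow> 0"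
      by (intro tendsto_sandwich[OF _ _ tendsto_const[of 0], of "\<lambda>n. (f n)\<^sup>2" _ "\<lambda>n. q n - q (Suc n)"]) auto
    then have "(\<lambda>n. sqrt ((f n)\<^sup>2)) \<longlonglongrightarrow> sqrt 0" by (rule tendsto_real_sqrt)
    moreover have "sqrt ((f n)\<^sup>2) = f n" for n by (simp add: f_def)
    ultimately show ?thesis by simp
  qed
  \<comment> \<open>By self-adjointness the squared norm of \<open>(B ^^ n) v\<close> is the inner
    product of \<open>v\<close> with \<open>u = (B ^^ (2 * n)) v\<close>, and
    \<open>v = \<pi> a w\<close> moves \<open>star a\<close> onto \<open>u\<close>. Since
    \<open>a * star a\<close> is \<open>g\<close> divided by \<open>r\<close>, what remains is
    controlled by \<open>f (2 * n)\<close>.\<close>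
  have bound: "(norm ((B ^^ n) v))^4 \<le> (norm w)\<^sup>2 * ((1/r) * (norm v * f (2 * n)))" for n
  proof -
    define u where "u = (B ^^ (2 * n)) v"
    have u: "u \<in> H" "norm u \<le> norm v" using Bn[OF v] by (simp_all add: u_def)
    have "cinner ((B ^^ n) v) ((B ^^ n) v) = cinner v ((B ^^ n) ((B ^^ n) v))"
      using v Bn by (simp add: Badj)
    also have "(B ^^ n) ((B ^^ n) v) = u" by (simp add: u_def mult_2 funpow_add)
    also have "cinner v u = cinner w (\<pi> (star a) u)"
      unfolding v_def by (rule star_rep_adj[OF rep w u(1)])
    finally have "cinner ((B ^^ n) v) ((B ^^ n) v) = cinner w (\<pi> (star a) u)" .
    then have "(norm ((B ^^ n) v))\<^sup>2 \<le> norm w * norm (\<pi> (star a) u)"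
      unfolding norm_sq_cinner using cinner_Cauchy_Schwarz complex_Re_le_cmod order_trans by metis
    then have 1: "((norm ((B ^^ n) v))\<^sup>2)\<^sup>2 \<le> (norm w * norm (\<pi> (star a) u))\<^sup>2"
      by (rule power_mono) simp
    have "cinner (\<pi> (star a) u) (\<pi> (star a) u) = cinner u (\<pi> (a * star a) u)"
      using star_rep_adj[OF rep u(1) mem[OF u(1)], of "star a"] by (simp add: star_rep_mult[OF rep] star_star)
    also have "\<pi> (a * star a) u = (1/r) *\<^sub>R \<pi> g u"
      using r by (simp add: g_def star_rep_scaleR[OF rep])
    finally have "(norm (\<pi> (star a) u))\<^sup>2 \<le> norm u * norm ((1/r) *\<^sub>R \<pi> g u)"
      unfolding norm_sq_cinner using cinner_Cauchy_Schwarz complex_Re_le_cmod order_trans by metis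
    also have "\<dots> = (1/r) * (norm u * f (2 * n))" using r by (simp add: f_def u_def)
    also have "\<dots> \<le> (1/r) * (norm v * f (2 * n))"
      using r u(2) by (intro mult_left_mono mult_right_mono) (auto simp: f_def)
    finally have "(norm (\<pi> (star a) u))\<^sup>2 \<le> (1/r) * (norm v * f (2 * n))" .
    then have "(norm w)\<^sup>2 * (norm (\<pi> (star a) u))\<^sup>2 \<le> (norm w)\<^sup>2 * ((1/r) * (norm v * f (2 * n)))"
      by (intro mult_left_mono) auto
    then show ?thesis using 1 by (simp add: power_mult_distrib power_mult[symmetric])
  qed
  \<comment> \<open>The exponents are powers of two because each use of
    \<open>contraction_doubling\<close> squares \<open>1 - \<pi> (c * c)\<close>; it starts at
    \<open>c = g\<close>, where this operator is \<open>B\<close>.\<close>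
  have e_ex: "\<exists>c. star c = c \<and> norm c \<le> 1 \<and> (\<forall>v\<in>H. v - \<pi> (c * c) v = (B ^^ (2 ^ n)) v)" for n
  proof (induction n)
    case 0
    show ?case by (intro exI[of _ g]) (simp add: sg ng B_def)
  next
    case (Suc n)
    then obtain c where c: "star c = c" "norm c \<le> 1" "\<And>v. v \<in> H \<Longrightarrow> v - \<pi> (c * c) v = (B ^^ (2 ^ n)) v"
      by blast
    obtain d where d: "star d = d" "norm d \<le> 1" "d * d = c * c + c * c - (c * c) * (c * c)"
      using contraction_doubling[OF c(1,2)] by blast
    have "v - \<pi> (d * d) v = (B ^^ (2 ^ Suc n)) v" if v: "v \<in> H" for v
    proof -
      have "(B ^^ (2 ^ Suc n)) v = (B ^^ (2 ^ n)) ((B ^^ (2 ^ n)) v)"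
        by (simp add: mult_2 funpow_add)
      also have "\<dots> = (v - \<pi> (c * c) v) - \<pi> (c * c) (v - \<pi> (c * c) v)"
        using c(3)[OF v] c(3)[OF Bn(1)[OF v]] by simp
      also have "\<pi> (c * c) (v - \<pi> (c * c) v) = \<pi> (c * c) v - \<pi> (c * c) (\<pi> (c * c) v)"
        using v mem by (intro bops_diff[OF star_rep_bops[OF rep] cs])
      also have "\<pi> (c * c) (\<pi> (c * c) v) = \<pi> ((c * c) * (c * c)) v"
        by (simp only: star_rep_mult[OF rep])
      finally show ?thesis
        by (simp add: d(3) star_rep_diff[OF rep] star_rep_add[OF rep])
    qed
    then show ?case using d by blast
  qed
  define G where "G n = (norm w)\<^sup>2 * ((1/r) * (norm v * f (2 * n)))" for n
  have "(\<lambda>n. f (2 * n)) \<longlonglongrightarrow> 0"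
    using LIMSEQ_subseq_LIMSEQ[OF f0, of "\<lambda>n. 2 * n"] by (simp add: strict_mono_def comp_def)
  then have "G \<longlonglongrightarrow> (norm w)\<^sup>2 * ((1/r) * (norm v * 0))"
    unfolding G_def by (intro tendsto_intros)
  then have "G \<longlonglongrightarrow> 0" by simp
  \<comment> \<open>The threshold is the fourth power of \<open>d\<close> because
    \<open>bound\<close> controls a fourth power.\<close>
  then obtain n where n: "\<And>m. m \<ge> n \<Longrightarrow> norm (G m) < d^4"
    using d LIMSEQ_D[of G 0 "d^4"] by auto
  have "n \<le> 2 ^ n" by (rule less_imp_le) (rule less_exp)
  then have "norm (G (2 ^ n)) < d^4" by (rule n)
  then have "(norm ((B ^^ (2 ^ n)) v))^4 < d^4"
    using bound[of "2 ^ n"] unfolding G_def real_norm_def by linarith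
  then have small: "norm ((B ^^ (2 ^ n)) v) < d"
    using d by (meson less_imp_le power_less_imp_less_base)
  obtain c where c: "star c = c" "norm c \<le> 1" "\<And>v. v \<in> H \<Longrightarrow> v - \<pi> (c * c) v = (B ^^ (2 ^ n)) v"
    using e_ex by blast
  have "norm (c * c) \<le> 1" using norm_star_mult_self[of c] c by (simp add: power_le_one)
  then show ?thesis
    using c(3) small Bn(2) v unfolding v_def[symmetric] by (intro exI[of _ "c * c"]) auto
qed

lemma state_bounded: "\<omega> \<in> states \<Longrightarrow> cmod (\<omega> a) \<le> norm a"
  using onorm[of \<omega> a] by (simp add: states_def)

text \<open>States are normalized by \<open>onorm\<close>. The lower bound on the vector is
  Cauchy-Schwarz together with contractivity. For the upper bound, \<open>u\<close> in the unit ball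
  with \<open>\<pi> u \<Omega>\<close> near \<open>\<Omega>\<close> makes the squared norm of
  \<open>\<Omega>\<close> nearly \<open>\<omega> u\<close>, which has modulus at most 1.\<close>

lemma gns_norm:
  fixes \<omega> :: "'a::cstar_algebra \<Rightarrow> complex" and \<pi> :: "'a \<Rightarrow> 'h::chilbert_space \<Rightarrow> 'h"
  assumes gns: "gns_triple \<omega> H \<pi> \<Omega>" and st: "\<omega> \<in> states"
  shows "norm \<Omega> = 1"
proof (rule antisym)
  have rep: "star_rep H \<pi>" and \<Omega>: "\<Omega> \<in> H" "\<Omega> \<in> closure (range (\<lambda>a. \<pi> a \<Omega>))"
    and \<omega>: "\<And>a. \<omega> a = cinner \<Omega> (\<pi> a \<Omega>)"
    using gns by (auto simp: gns_triple_def cyclic_vector_def)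
  have "(norm \<Omega>)\<^sup>2 \<le> 1 + e" if e: "e > 0" for e
  proof -
    \<comment> \<open>This makes \<open>norm \<Omega> * (2 * d)\<close> at most \<open>e\<close>;
      the summand 1 keeps the denominator positive.\<close>
    define d where "d = e / (2 * norm \<Omega> + 1)"
    have d: "d > 0" using e by (simp add: d_def add_nonneg_pos)
    obtain x where x: "x \<in> range (\<lambda>a. \<pi> a \<Omega>)" "dist x \<Omega> < d"
      using \<Omega>(2) d unfolding closure_approachable by blast
    then obtain a where a: "norm (\<Omega> - \<pi> a \<Omega>) < d" by (auto simp: dist_norm norm_minus_commute)
    obtain u where u: "norm u \<le> 1" "norm (\<pi> a \<Omega> - \<pi> u (\<pi> a \<Omega>)) < d"
      "\<And>v. v \<in> H \<Longrightarrow> norm (v - \<pi> u v) \<le> norm v"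
      using star_rep_approximate_unit[OF rep \<Omega>(1) d] by blast
    have aH: "\<pi> a \<Omega> \<in> H" "\<Omega> - \<pi> a \<Omega> \<in> H"
      using star_rep_mem[OF rep] \<Omega> csubspace_diff[OF star_rep_csubspace[OF rep]] by auto
    \<comment> \<open>On \<open>\<pi> a \<Omega>\<close> the operator \<open>1 - \<pi> u\<close> is
      small by choice of \<open>u\<close>; on the small remainder it is used only that it does not
      increase norms.\<close>
    have "\<Omega> - \<pi> u \<Omega> = (\<pi> a \<Omega> - \<pi> u (\<pi> a \<Omega>)) + ((\<Omega> - \<pi> a \<Omega>) - \<pi> u (\<Omega> - \<pi> a \<Omega>))"
      using bops_diff[OF star_rep_bops[OF rep] star_rep_csubspace[OF rep] \<Omega>(1) aH(1), of u] by simp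
    then have "norm (\<Omega> - \<pi> u \<Omega>) \<le> norm (\<pi> a \<Omega> - \<pi> u (\<pi> a \<Omega>)) + norm ((\<Omega> - \<pi> a \<Omega>) - \<pi> u (\<Omega> - \<pi> a \<Omega>))"
      by (metis norm_triangle_ineq)
    also have "\<dots> \<le> d + d" using u(2) u(3)[OF aH(2)] a by linarith
    finally have "norm (\<Omega> - \<pi> u \<Omega>) \<le> 2 * d" by simp
    then have "cmod (cinner \<Omega> (\<Omega> - \<pi> u \<Omega>)) \<le> norm \<Omega> * (2 * d)"
      by (meson cinner_Cauchy_Schwarz mult_left_mono norm_ge_zero order_trans)
    moreover have "cinner \<Omega> (\<Omega> - \<pi> u \<Omega>) = of_real ((norm \<Omega>)\<^sup>2) - \<omega> u"
      by (simp add: cinner_diff_right \<omega> cinner_self)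
    moreover have "cmod (\<omega> u) \<le> 1" using state_bounded[OF st, of u] u(1) by linarith
    moreover have "cmod (complex_of_real ((norm \<Omega>)\<^sup>2)) = (norm \<Omega>)\<^sup>2" by (simp add: norm_power)
    moreover have "cmod (complex_of_real ((norm \<Omega>)\<^sup>2)) \<le>
        cmod (of_real ((norm \<Omega>)\<^sup>2) - \<omega> u) + cmod (\<omega> u)"
      by (metis diff_add_cancel norm_triangle_ineq)
    ultimately have "(norm \<Omega>)\<^sup>2 \<le> 1 + norm \<Omega> * (2 * d)" by simp
    also have "norm \<Omega> * (2 * d) = e * (2 * norm \<Omega> / (2 * norm \<Omega> + 1))" by (simp add: d_def)
    also have "\<dots> \<le> e * 1"
      using e by (intro mult_left_mono) (simp_all add: divide_le_eq_1 add_nonneg_pos)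
    finally show ?thesis by simp
  qed
  then have "(norm \<Omega>)\<^sup>2 \<le> 1" by (rule field_le_epsilon)
  then show "norm \<Omega> \<le> 1" by (simp add: abs_square_le_1)
  have "onorm \<omega> \<le> (norm \<Omega>)\<^sup>2"
  proof (rule onorm_bound)
    fix a
    have "cmod (\<omega> a) \<le> norm \<Omega> * (norm a * norm \<Omega>)"
      unfolding \<omega> using cinner_Cauchy_Schwarz star_rep_norm_le[OF rep \<Omega>(1)]
      by (meson mult_left_mono norm_ge_zero order_trans)
    then show "cmod (\<omega> a) \<le> (norm \<Omega>)\<^sup>2 * norm a" by (simp add: power2_eq_square ac_simps)
  qed simp
  moreover have "onorm \<omega> = 1" using st by (simp add: states_def)
  ultimately show "1 \<le> norm \<Omega>"
    by (metis abs_norm_cancel abs_square_less_1 not_less)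
qed


section \<open>Spatial tensor products\<close>

text \<open>Density is applied to one argument at a time, \<open>x\<close> first with
  \<open>y\<close> kept among the generators.\<close>

lemma cinner_adj_extend:
  assumes T: "T \<in> bops D K" "S \<in> bops D L" and D: "csubspace D" "D = closure (span G)"
    and eq: "\<And>x y. x \<in> G \<Longrightarrow> y \<in> G \<Longrightarrow> cinner (T x) y = cinner x (S y)"
    and x: "x \<in> D" and y: "y \<in> D"
  shows "cinner (T x) y = cinner x (S y)"
proof -
  note R = bounded_linear_cinner_left and L = bounded_linear_cinner_right
  note c = bops_cont_linear_on[OF T(1) D(1)] bops_cont_linear_on[OF T(2) D(1)]
  have 1: "cinner (T x) y = cinner x (S y)" if "x \<in> D" "y \<in> G" for x y
    by (rule cont_linear_on_eq[OF cont_linear_on_compose[OF c(1) subset_UNIV bounded_linear_cont_linear_on[OF R]]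
          bounded_linear_cont_linear_on[OF R] D(2) eq[OF _ that(2)] that(1)])
  show ?thesis
    by (rule cont_linear_on_eq[OF bounded_linear_cont_linear_on[OF L]
          cont_linear_on_compose[OF c(2) subset_UNIV bounded_linear_cont_linear_on[OF L]] D(2) 1[OF x] y])
qed

text \<open>Two independent families of representations are kept because the locale is used for the
  twofold tensor product and for both bracketings of the threefold one, where one of the families
  consists of product representations.\<close>

locale spatial_tensor =
  fixes s :: "'h::chilbert_space \<Rightarrow> 'k::chilbert_space \<Rightarrow> 'l::chilbert_space"
    and P :: "('h set \<times> ('a::cstar_algebra \<Rightarrow> 'h \<Rightarrow> 'h)) set"
    and Q :: "('k set \<times> ('b::cstar_algebra \<Rightarrow> 'k \<Rightarrow> 'k)) set"
    and t :: "'a \<Rightarrow> 'b \<Rightarrow> 'c::cstar_algebra"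
  assumes s: "tensor_map s" and t: "min_tensor s P Q t"
    and P: "\<And>H \<pi>. (H, \<pi>) \<in> P \<Longrightarrow> star_rep H \<pi>"
    and Q: "\<And>K \<rho>. (K, \<rho>) \<in> Q \<Longrightarrow> star_rep K \<rho>"
begin

lemma bilinear: "cbilinear t"
  using t by (simp add: min_tensor_def)

lemma t_mult: "t a b * t a' b' = t (a * a') (b * b')"
  using t by (simp add: min_tensor_def)

lemma t_star: "star (t a b) = t (star a) (star b)"
  using t by (simp add: min_tensor_def)

lemma t_dense: "closure (span {t a b | a b. True}) = UNIV"
  using t by (simp add: min_tensor_def)

lemma t_image: "{t a b | a b. True} = (\<lambda>(a, b). t a b) ` UNIV"
  by auto

lemma bounded_linear_eq:
  assumes "bounded_linear f" "bounded_linear g" "\<And>a b. f (t a b) = g (t a b)"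
  shows "f X = g X"
  by (rule cont_linear_on_eq[OF bounded_linear_cont_linear_on[OF assms(1)]
        bounded_linear_cont_linear_on[OF assms(2)] t_dense[symmetric]])
    (use assms(3) in auto)

lemma span_sum:
  assumes "X \<in> span {t a b | a b. True}"
  obtains n :: nat and a b where "X = (\<Sum>i<n. t (a i) (b i))"
proof -
  have "\<exists>(n::nat) p. (\<forall>k<n. p k \<in> UNIV) \<and> X = (\<Sum>k<n. (\<lambda>(a, b). t a b) (p k))"
  proof (rule span_image_sum)
    show "X \<in> span ((\<lambda>(a, b). t a b) ` UNIV)" using assms unfolding t_image .
    fix r i
    have "(\<lambda>(a, b). t a b) (r *\<^sub>R fst i, snd i) = r *\<^sub>R (\<lambda>(a, b). t a b) i"
      using cbilinear_scaleC_left[OF bilinear] by (simp add: scaleR_scaleC case_prod_beta)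
    then show "\<exists>j\<in>UNIV. (\<lambda>(a, b). t a b) j = r *\<^sub>R (\<lambda>(a, b). t a b) i" by blast
  qed
  then show ?thesis using that by (auto simp: case_prod_beta)
qed

lemma extend_from_tensors:
  fixes f :: "'a \<Rightarrow> 'b \<Rightarrow> 'w::banach"
  assumes scale: "\<And>r a b. f (r *\<^sub>R a) b = r *\<^sub>R f a b" and C: "C \<ge> 0"
    and bound: "\<And>(n::nat) a b. norm (\<Sum>k<n. f (a k) (b k)) \<le> C * norm (\<Sum>k<n. t (a k) (b k))"
  shows "\<exists>\<Phi>. bounded_linear \<Phi> \<and> (\<forall>a b. \<Phi> (t a b) = f a b) \<and> (\<forall>X. norm (\<Phi> X) \<le> C * norm X)"
proof -
  let ?g = "\<lambda>(a, b). t a b" and ?f = "\<lambda>(a, b). f a b"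
  have "\<exists>\<Phi>. (\<forall>i\<in>UNIV. \<Phi> (?g i) = ?f i) \<and> cont_linear_on (closure (span (?g ` UNIV))) \<Phi> \<and>
    (\<forall>x. norm (\<Phi> x) \<le> C * norm x) \<and> (\<forall>x. x \<notin> closure (span (?g ` UNIV)) \<longrightarrow> \<Phi> x = 0)"
  proof (rule bounded_extension[OF _ _ C])
    fix r i
    have "?g (r *\<^sub>R fst i, snd i) = r *\<^sub>R ?g i \<and> ?f (r *\<^sub>R fst i, snd i) = r *\<^sub>R ?f i"
      using cbilinear_scaleC_left[OF bilinear] by (simp add: scaleR_scaleC[where 'a = 'a]
          scaleR_scaleC[where 'a = 'c] case_prod_beta scale[unfolded scaleR_scaleC[where 'a = 'a]])
    then show "\<exists>j\<in>UNIV. ?g j = r *\<^sub>R ?g i \<and> ?f j = r *\<^sub>R ?f i" by blast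
  next
    fix n :: nat and p
    show "norm (\<Sum>k<n. ?f (p k)) \<le> C * norm (\<Sum>k<n. ?g (p k))"
      using bound[where a = "\<lambda>k. fst (p k)" and b = "\<lambda>k. snd (p k)"] by (simp add: case_prod_beta)
  qed
  then obtain \<Phi> where \<Phi>: "\<And>i. \<Phi> (?g i) = ?f i" "cont_linear_on UNIV \<Phi>" "\<And>x. norm (\<Phi> x) \<le> C * norm x"
    unfolding t_image[symmetric] t_dense by blast
  have "bounded_linear \<Phi>"
    using \<Phi>(2,3) by (intro bounded_linear_intro[of _ C]) (auto simp: cont_linear_on_def mult.commute)
  moreover have "\<Phi> (t a b) = f a b" for a b using \<Phi>(1)[of "(a, b)"] by simp
  ultimately show ?thesis using \<Phi>(3) by blast
qed

context
  fixes H \<pi> K \<rho>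
  assumes HP: "(H, \<pi>) \<in> P" and KQ: "(K, \<rho>) \<in> Q"
begin

lemma reps: "star_rep H \<pi>" "star_rep K \<rho>"
  using P[OF HP] Q[OF KQ] .

lemma HK: "csubspace H" "csubspace K"
  using reps star_rep_csubspace by blast+

lemma op_bops: "tensor_op s H K (\<pi> a) (\<rho> b) \<in> bops (tensor_space s H K) (tensor_space s H K)"
  by (rule tensor_op_mem[OF s HK star_rep_bops[OF reps(1)] star_rep_bops[OF reps(2)]])

lemma op_apply: "x \<in> H \<Longrightarrow> y \<in> K \<Longrightarrow> tensor_op s H K (\<pi> a) (\<rho> b) (s x y) = s (\<pi> a x) (\<rho> b y)"
  by (rule tensor_op_apply[OF s HK star_rep_bops[OF reps(1)] star_rep_bops[OF reps(2)]])

lemma op_norm: "norm (tensor_op s H K (\<pi> a) (\<rho> b) z) \<le> norm a * norm b * norm z"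
  by (rule tensor_op_props(3)[OF s HK bops_clinear[OF star_rep_bops[OF reps(1)]] star_rep_norm_le[OF reps(1)]
        norm_ge_zero bops_clinear[OF star_rep_bops[OF reps(2)]] star_rep_norm_le[OF reps(2)] norm_ge_zero])

end

lemma op_sum_norm: 
  assumes "(H, \<pi>) \<in> P" "(K, \<rho>) \<in> Q"
  shows "norm (\<Sum>i<n. tensor_op s H K (\<pi> (a i)) (\<rho> (b i)) z) \<le> (\<Sum>i<n. norm (a i) * norm (b i)) * norm z"
  unfolding sum_distrib_right by (intro sum_norm_le op_norm assms)

lemma onorm_op_le:
  assumes "(H, \<pi>) \<in> P" "(K, \<rho>) \<in> Q"
  shows "onorm (\<lambda>z. \<Sum>i<n. tensor_op s H K (\<pi> (a i)) (\<rho> (b i)) z) \<le> (\<Sum>i<n. norm (a i) * norm (b i))"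
  by (rule onorm_bound[OF _ op_sum_norm[OF assms]]) (simp add: sum_nonneg)

lemma norm_sum_eq: "norm (\<Sum>i<(n::nat). t (a i) (b i)) =
   Sup (insert 0 {onorm (\<lambda>z. \<Sum>i<n. tensor_op s H K (\<pi> (a i)) (\<rho> (b i)) z) | H \<pi> K \<rho>.
                         (H, \<pi>) \<in> P \<and> (K, \<rho>) \<in> Q})"
  using t by (simp add: min_tensor_def)

text \<open>A member of a set is below its \<open>Sup\<close> only if the set is bounded above.
  Contractivity of the representations supplies the uniform bound, the sum of the
  \<open>norm (a i) * norm (b i)\<close>.\<close>

lemma op_sum_le:
  assumes "(H, \<pi>) \<in> P" "(K, \<rho>) \<in> Q"
  shows "norm (\<Sum>i<n. tensor_op s H K (\<pi> (a i)) (\<rho> (b i)) z) \<le> norm (\<Sum>i<(n::nat). t (a i) (b i)) * norm z"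
proof -
  let ?f = "\<lambda>z. \<Sum>i<n. tensor_op s H K (\<pi> (a i)) (\<rho> (b i)) z"
  let ?M = "\<Sum>i<n. norm (a i) * norm (b i)"
  have M: "?M \<ge> 0" by (simp add: sum_nonneg)
  \<comment> \<open>\<open>?f\<close> vanishes off the tensor space and need not be linear on the
    type, so \<open>onorm\<close> is handled directly as a supremum of quotients.\<close>
  have "norm (?f x) / norm x \<le> ?M" for x
    using op_sum_norm[OF assms, where n = n and a = a and b = b and z = x] M by (cases "x = 0") (simp_all add: pos_divide_le_eq)
  then have bd: "bdd_above (range (\<lambda>x. norm (?f x) / norm x))" by (auto intro!: bdd_aboveI)
  have "norm (?f z) \<le> onorm ?f * norm z"
  proof (cases "z = 0")
    case True
    then show ?thesis using op_sum_norm[OF assms, where n = n and a = a and b = b and z = z] by simp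
  next
    case False
    have "norm (?f z) / norm z \<le> onorm ?f"
      unfolding onorm_def by (rule cSUP_upper[OF UNIV_I bd])
    then show ?thesis using False by (simp add: pos_divide_le_eq)
  qed
  also have "\<dots> \<le> norm (\<Sum>i<n. t (a i) (b i)) * norm z"
    unfolding norm_sum_eq
    by (intro mult_right_mono cSup_upper bdd_aboveI[where M = ?M])
      (use assms onorm_op_le M in auto)
  finally show ?thesis .
qed

text \<open>The inserted 0 makes the set of operator norms nonempty, at the price of requiring
  \<open>M\<close> to be nonnegative.\<close>

lemma norm_sum_le:
  assumes "M \<ge> 0"
    and "\<And>H \<pi> K \<rho> z. (H, \<pi>) \<in> P \<Longrightarrow> (K, \<rho>) \<in> Q \<Longrightarrow>
      norm (\<Sum>i<n. tensor_op s H K (\<pi> (a i)) (\<rho> (b i)) z) \<le> M * norm z"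
  shows "norm (\<Sum>i<(n::nat). t (a i) (b i)) \<le> M"
  unfolding norm_sum_eq using assms by (intro cSup_least) (auto intro!: onorm_bound)

lemma norm_t_le: "norm (t a b) \<le> norm a * norm b"
  using norm_sum_le[where M = "norm a * norm b" and n = 1 and a = "\<lambda>_. a" and b = "\<lambda>_. b"] op_norm by simp

lemma bounded_linear_t: "bounded_linear (\<lambda>a. t a b)" "bounded_linear (\<lambda>b. t a b)"
proof -
  show "bounded_linear (\<lambda>a. t a b)"
    by (rule bounded_linear_intro[of _ "norm b"])
      (simp_all add: cbilinear_apply[OF bilinear] scaleR_scaleC norm_t_le)
  show "bounded_linear (\<lambda>b. t a b)"
    by (rule bounded_linear_intro[of _ "norm a"])
      (simp_all add: cbilinear_apply[OF bilinear] scaleR_scaleC norm_t_le mult.commute[of _ "norm a"])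
qed

text \<open>Representations are automatically continuous, so elementary tensors determine them. This
  gives uniqueness in the description of \<open>tensor_rep\<close>.\<close>

lemma tensor_rep_unique:
  assumes "star_rep D \<sigma>" "star_rep E \<sigma>'" "\<And>a b. \<sigma> (t a b) = \<sigma>' (t a b)"
  shows "\<sigma> = \<sigma>'"
proof (rule ext, rule ext)
  fix X v show "\<sigma> X v = \<sigma>' X v"
    by (rule bounded_linear_eq[OF star_rep_bounded_linear[OF assms(1)] star_rep_bounded_linear[OF assms(2)]])
      (simp add: assms(3))
qed

context
  fixes H \<pi> K \<rho>
  assumes HP: "(H, \<pi>) \<in> P" and KQ: "(K, \<rho>) \<in> Q"
begin

text \<open>For each fixed vector \<open>v\<close> the map from finite tensor sums to their values
  at \<open>v\<close> is bounded by \<open>op_sum_le\<close> and extends to the completion. The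
  extensions are glued into \<sigma>, whose algebraic laws follow by density in the algebra
  variable.\<close>

lemma tensor_rep_exists:
  "\<exists>\<sigma>. star_rep (tensor_space s H K) \<sigma> \<and> (\<forall>a b. \<sigma> (t a b) = tensor_op s H K (\<pi> a) (\<rho> b))"
proof -
  define D where "D = tensor_space s H K"
  define T where "T a b = tensor_op s H K (\<pi> a) (\<rho> b)" for a b
  note reps = reps[OF HP KQ] and HK = HK[OF HP KQ]
  have Dc: "csubspace D" "closed D"
    unfolding D_def by (rule tensor_space_csubspace[OF s HK(1)], rule tensor_space_closed)
  have TB: "T a b \<in> bops D D" for a b unfolding T_def D_def by (rule op_bops[OF HP KQ])
  have Ts: "T a b (s x y) = s (\<pi> a x) (\<rho> b y)" if "x \<in> H" "y \<in> K" for a b x y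
    unfolding T_def by (rule op_apply[OF HP KQ that])
  have Teq: "T a b = V" if "V \<in> bops D D" "\<And>x y. x \<in> H \<Longrightarrow> y \<in> K \<Longrightarrow> V (s x y) = s (\<pi> a x) (\<rho> b y)" for a b V
    unfolding T_def by (rule tensor_op_eqI[OF s HK(1) that(1)[unfolded D_def] that(2)])
  have Tscale: "T (c *\<^sub>C a) b = (\<lambda>v. c *\<^sub>C T a b v)" for c a b
  proof (rule Teq)
    obtain C where C: "\<And>x. norm (T a b x) \<le> C * norm x" using bops_bound[OF TB] by blast
    have "norm (c *\<^sub>C T a b x) \<le> (cmod c * C) * norm x" for x
      using mult_left_mono[OF C[of x], of "cmod c"] by (simp add: norm_scaleC_chilbert mult.assoc)
    then have "\<exists>C. \<forall>x\<in>D. norm (c *\<^sub>C T a b x) \<le> C * norm x" by blast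
    then show "(\<lambda>v. c *\<^sub>C T a b v) \<in> bops D D"
      using bops_mem[OF TB] csubspace_scaleC[OF Dc(1)] bops_add[OF TB] bops_scaleC[OF TB] bops_out[OF TB]
      by (auto simp: bops_def clinear_on_def scaleC_add_right scaleC_scaleC mult.commute)
    fix x y assume "x \<in> H" "y \<in> K"
    then show "c *\<^sub>C T a b (s x y) = s (\<pi> (c *\<^sub>C a) x) (\<rho> b y)"
      using s by (simp add: Ts star_rep_scaleC[OF reps(1)] cbilinear_scaleC_left tensor_map_def)
  qed
  have Tmult: "T (a * a') (b * b') = T a b \<circ> T a' b'" for a a' b b'
    by (rule Teq[OF bops_compose[OF TB TB]])
      (simp add: Ts star_rep_mem[OF reps(1)] star_rep_mem[OF reps(2)] star_rep_mult[OF reps(1)] star_rep_mult[OF reps(2)])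
  have Tadj: "cinner (T a b x) y = cinner x (T (star a) (star b) y)" if "x \<in> D" "y \<in> D" for a b x y
  proof (rule cinner_adj_extend[OF TB TB Dc(1) D_def[unfolded tensor_space_def] _ that])
    fix u v assume "u \<in> {s x y |x y. x \<in> H \<and> y \<in> K}" "v \<in> {s x y |x y. x \<in> H \<and> y \<in> K}"
    then show "cinner (T a b u) v = cinner u (T (star a) (star b) v)"
      using s star_rep_adj[OF reps(1)] star_rep_adj[OF reps(2)] by (auto simp: Ts tensor_map_def)
  qed
  have "\<exists>\<Phi>. bounded_linear \<Phi> \<and> (\<forall>a b. \<Phi> (t a b) = T a b v) \<and> (\<forall>X. norm (\<Phi> X) \<le> norm v * norm X)" for v
    using op_sum_le[OF HP KQ, where z = v] Tscale
    by (intro extend_from_tensors) (simp_all add: scaleR_scaleC T_def[symmetric] mult.commute)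
  then have "\<exists>\<Phi>. \<forall>v. bounded_linear (\<Phi> v) \<and> (\<forall>a b. \<Phi> v (t a b) = T a b v) \<and> (\<forall>X. norm (\<Phi> v X) \<le> norm v * norm X)"
    by (intro choice) blast
  then obtain \<Phi> where bl: "\<And>v. bounded_linear (\<Phi> v)" and \<Phi>t: "\<And>v a b. \<Phi> v (t a b) = T a b v"
    and nrm: "\<And>v X. norm (\<Phi> v X) \<le> norm v * norm X" by blast
  define \<sigma> where "\<sigma> X v = \<Phi> v X" for X v
  have \<sigma>t: "\<sigma> (t a b) = T a b" for a b by (simp add: \<sigma>_def \<Phi>t fun_eq_iff)
  have \<sigma>bl: "bounded_linear (\<lambda>X. \<sigma> X v)" for v using bl by (simp add: \<sigma>_def)
  have \<sigma>B: "\<sigma> X \<in> bops D D" for X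
    unfolding bops_def clinear_on_def
  proof (intro CollectI conjI ballI allI impI)
    show "\<sigma> X ` D \<subseteq> D"
    proof
      fix z assume "z \<in> \<sigma> X ` D"
      then obtain v where v: "v \<in> D" "z = \<sigma> X v" by blast
      have "\<sigma> X v \<in> D"
        by (rule cont_linear_on_range[OF bounded_linear_cont_linear_on[OF \<sigma>bl[of v]] t_dense[symmetric]
              csubspace_subspace[OF Dc(1)] Dc(2)])
          (use v bops_mem[OF TB] in \<open>auto simp: \<sigma>t\<close>)
      then show "z \<in> D" using v by simp
    qed
    fix v w assume vw: "v \<in> D" "w \<in> D"
    show "\<sigma> X (v + w) = \<sigma> X v + \<sigma> X w"
      by (rule bounded_linear_eq[OF \<sigma>bl bounded_linear_add[OF \<sigma>bl \<sigma>bl]])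
        (simp add: \<sigma>t bops_add[OF TB vw])
  next
    fix c v assume v: "v \<in> D"
    show "\<sigma> X (c *\<^sub>C v) = c *\<^sub>C \<sigma> X v"
      by (rule bounded_linear_eq[OF \<sigma>bl bounded_linear_compose[OF bounded_linear_scaleC_chilbert \<sigma>bl]])
        (simp add: \<sigma>t bops_scaleC[OF TB v])
  next
    show "\<exists>C. \<forall>v\<in>D. norm (\<sigma> X v) \<le> C * norm v"
      using nrm by (intro exI[of _ "norm X"]) (simp add: \<sigma>_def mult.commute)
  next
    fix v assume v: "v \<notin> D"
    show "\<sigma> X v = 0"
      by (rule bounded_linear_eq[OF \<sigma>bl bounded_linear_zero]) (simp add: \<sigma>t bops_out[OF TB v])
  qed
  have "star_rep D \<sigma>"
    unfolding star_rep_def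
  proof (intro conjI allI ballI)
    show "\<sigma> (X + Y) = (\<lambda>v. \<sigma> X v + \<sigma> Y v)" for X Y
      using bl by (simp add: \<sigma>_def fun_eq_iff linear_simps)
    show "\<sigma> (c *\<^sub>C X) = (\<lambda>v. c *\<^sub>C \<sigma> X v)" for c X
    proof
      fix v
      show "\<sigma> (c *\<^sub>C X) v = c *\<^sub>C \<sigma> X v"
      proof (rule bounded_linear_eq[where f = "\<lambda>X. \<sigma> (c *\<^sub>C X) v" and g = "\<lambda>X. c *\<^sub>C \<sigma> X v"])
        show "bounded_linear (\<lambda>X. \<sigma> (c *\<^sub>C X) v)"
          by (rule bounded_linear_compose[OF \<sigma>bl bounded_linear_scaleC_cstar])
        show "bounded_linear (\<lambda>X. c *\<^sub>C \<sigma> X v)"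
          by (rule bounded_linear_compose[OF bounded_linear_scaleC_chilbert \<sigma>bl])
        show "\<sigma> (c *\<^sub>C t a b) v = c *\<^sub>C \<sigma> (t a b) v" for a b
          by (simp add: cbilinear_scaleC_left[OF bilinear, symmetric] \<sigma>t Tscale)
      qed
    qed
    \<comment> \<open>Multiplicativity is reached in two rounds: this one has an elementary right
      factor. The next varies the right factor and uses continuity of \<open>\<sigma> X\<close> on
      \<open>D\<close>; off \<open>D\<close> both sides are 0.\<close>
    have m1: "\<sigma> (X * t a b) v = \<sigma> X (\<sigma> (t a b) v)" for X a b v
    proof (rule bounded_linear_eq[where f = "\<lambda>X. \<sigma> (X * t a b) v" and g = "\<lambda>X. \<sigma> X (\<sigma> (t a b) v)"])
      show "bounded_linear (\<lambda>X. \<sigma> (X * t a b) v)"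
        by (rule bounded_linear_compose[OF \<sigma>bl bounded_linear_mult_left])
    qed (simp_all add: \<sigma>bl t_mult \<sigma>t Tmult)
    show "\<sigma> (X * Y) = \<sigma> X \<circ> \<sigma> Y" for X Y
    proof
      fix v
      have "\<sigma> (X * Y) v = \<sigma> X (\<sigma> Y v)"
      proof (cases "v \<in> D")
        case True
        obtain C where C: "\<And>x. norm (\<sigma> X x) \<le> C * norm x" "C \<ge> 0" using bops_bound[OF \<sigma>B] by blast
        have c: "cont_linear_on UNIV (\<lambda>Y. \<sigma> X (\<sigma> Y v))"
          by (rule cont_linear_on_compose[OF bounded_linear_cont_linear_on[OF \<sigma>bl] _ bops_cont_linear_on[OF \<sigma>B Dc(1)]])
            (use True bops_mem[OF \<sigma>B] in auto)
        have c': "cont_linear_on UNIV (\<lambda>Y. \<sigma> (X * Y) v)"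
          by (rule bounded_linear_cont_linear_on[OF bounded_linear_compose[OF \<sigma>bl bounded_linear_mult_right]])
        show ?thesis
          by (rule cont_linear_on_eq[OF c' c t_dense[symmetric]]) (auto simp: m1)
      next
        case False
        then show ?thesis by (simp add: bops_out[OF \<sigma>B] bops_zero[OF \<sigma>B])
      qed
      then show "\<sigma> (X * Y) v = (\<sigma> X \<circ> \<sigma> Y) v" by simp
    qed
    fix X x y assume xy: "x \<in> D" "y \<in> D"
    show "cinner (\<sigma> X x) y = cinner x (\<sigma> (star X) y)"
    proof (rule bounded_linear_eq[where f = "\<lambda>X. cinner (\<sigma> X x) y" and g = "\<lambda>X. cinner x (\<sigma> (star X) y)"])
      show "bounded_linear (\<lambda>X. cinner (\<sigma> X x) y)"
        by (rule bounded_linear_compose[OF bounded_linear_cinner_left \<sigma>bl])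
      show "bounded_linear (\<lambda>X. cinner x (\<sigma> (star X) y))"
        by (rule bounded_linear_compose[OF bounded_linear_cinner_right
              bounded_linear_compose[OF \<sigma>bl bounded_linear_star]])
      show "cinner (\<sigma> (t a b) x) y = cinner x (\<sigma> (star (t a b)) y)" for a b
        by (simp add: \<sigma>t t_star Tadj xy)
    qed
  qed (use Dc \<sigma>B in auto)
  then show ?thesis unfolding D_def T_def[symmetric] using \<sigma>t by blast
qed

lemma tensor_rep:
  shows tensor_rep_star_rep: "star_rep (tensor_space s H K) (tensor_rep s t H \<pi> K \<rho>)"
    and tensor_rep_t: "tensor_rep s t H \<pi> K \<rho> (t a b) = tensor_op s H K (\<pi> a) (\<rho> b)"
proof -
  have "\<exists>!\<sigma>. star_rep (tensor_space s H K) \<sigma> \<and> (\<forall>a b. \<sigma> (t a b) = tensor_op s H K (\<pi> a) (\<rho> b))"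
    using tensor_rep_exists by (intro ex_ex1I tensor_rep_unique) auto
  from theI'[OF this] show "star_rep (tensor_space s H K) (tensor_rep s t H \<pi> K \<rho>)"
    and "tensor_rep s t H \<pi> K \<rho> (t a b) = tensor_op s H K (\<pi> a) (\<rho> b)"
    unfolding tensor_rep_def by auto
qed

lemma tensor_rep_apply:
  "x \<in> H \<Longrightarrow> y \<in> K \<Longrightarrow> tensor_rep s t H \<pi> K \<rho> (t a b) (s x y) = s (\<pi> a x) (\<rho> b y)"
  by (simp add: tensor_rep_t op_apply[OF HP KQ])

end

text \<open>The spatial norm formula is postulated for finite sums only; approximating
  \<open>X\<close> by such a sum extends the upper bound to the completion. Elements can then be
  estimated through Hilbert space operators.\<close>

lemma norm_le_reps:
  assumes M: "M \<ge> 0"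
    and le: "\<And>H \<pi> K \<rho> v. (H, \<pi>) \<in> P \<Longrightarrow> (K, \<rho>) \<in> Q \<Longrightarrow> norm (tensor_rep s t H \<pi> K \<rho> X v) \<le> M * norm v"
  shows "norm X \<le> M"
proof (rule field_le_epsilon)
  fix e :: real assume e: "e > 0"
  have "X \<in> closure (span {t a b | a b. True})" unfolding t_dense by simp
  then obtain Y where Y: "Y \<in> span {t a b | a b. True}" "dist Y X < e / 2"
    using e unfolding closure_approachable by (meson half_gt_zero)
  then obtain n a b where n: "Y = (\<Sum>i<(n::nat). t (a i) (b i))" using span_sum by blast
  have "norm (\<Sum>i<n. t (a i) (b i)) \<le> M + e / 2"
  proof (rule norm_sum_le)
    fix H \<pi> K \<rho> z assume HP: "(H, \<pi>) \<in> P" and KQ: "(K, \<rho>) \<in> Q"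
    let ?\<sigma> = "tensor_rep s t H \<pi> K \<rho>"
    note bl = star_rep_bounded_linear[OF tensor_rep_star_rep[OF HP KQ], of z]
    have "(\<Sum>i<n. tensor_op s H K (\<pi> (a i)) (\<rho> (b i)) z) = ?\<sigma> Y z"
      by (simp add: n linear_sum[OF bounded_linear.linear[OF bl]] tensor_rep_t[OF HP KQ])
    also have "norm (?\<sigma> Y z) \<le> norm (?\<sigma> X z) + norm (?\<sigma> (Y - X) z)"
      using norm_triangle_ineq[of "?\<sigma> X z" "?\<sigma> (Y - X) z"]
      by (simp add: linear_diff[OF bounded_linear.linear[OF bl]])
    also have "norm (?\<sigma> (Y - X) z) \<le> norm (Y - X) * norm z"
    proof (cases "z \<in> tensor_space s H K")
      case True
      then show ?thesis by (rule star_rep_norm_le[OF tensor_rep_star_rep[OF HP KQ]])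
    next
      case False
      then show ?thesis by (simp add: bops_out[OF star_rep_bops[OF tensor_rep_star_rep[OF HP KQ]]])
    qed
    also have "\<dots> \<le> (e / 2) * norm z"
      using Y(2) by (intro mult_right_mono) (auto simp: dist_norm)
    also have "norm (?\<sigma> X z) \<le> M * norm z" by (rule le[OF HP KQ])
    finally show "norm (\<Sum>i<n. tensor_op s H K (\<pi> (a i)) (\<rho> (b i)) z) \<le> (M + e / 2) * norm z"
      by (simp add: distrib_right)
  qed (use M e in simp)
  then have "norm Y \<le> M + e / 2" by (simp add: n)
  moreover have "norm X \<le> norm Y + norm (X - Y)" by (metis add.commute diff_add_cancel norm_triangle_ineq)
  ultimately show "norm X \<le> M + e" using Y(2) by (simp add: dist_norm norm_minus_commute)
qed

text \<open>The product state is the vector state of the product of the cyclic vectors. Its norm is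
  at most 1 since these are unit vectors; without a unit, the reverse inequality is obtained by
  testing on elementary tensors.\<close>

lemma product_state_exists:
  assumes HP: "(H, \<pi>) \<in> P" and KQ: "(K, \<rho>) \<in> Q"
    and \<omega>: "\<omega>1 \<in> states" "\<omega>2 \<in> states"
    and gns: "gns_triple \<omega>1 H \<pi> \<Omega>1" "gns_triple \<omega>2 K \<rho> \<Omega>2"
  shows "(THE \<phi>. \<phi> \<in> states \<and> (\<forall>a b. \<phi> (t a b) = \<omega>1 a * \<omega>2 b)) =
    (\<lambda>X. cinner (s \<Omega>1 \<Omega>2) (tensor_rep s t H \<pi> K \<rho> X (s \<Omega>1 \<Omega>2)))"
proof -
  define \<sigma> where "\<sigma> = tensor_rep s t H \<pi> K \<rho>"
  define \<phi> where "\<phi> X = cinner (s \<Omega>1 \<Omega>2) (\<sigma> X (s \<Omega>1 \<Omega>2))" for X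
  have rep: "star_rep (tensor_space s H K) \<sigma>" unfolding \<sigma>_def by (rule tensor_rep_star_rep[OF HP KQ])
  have \<Omega>: "\<Omega>1 \<in> H" "\<Omega>2 \<in> K" using gns by (auto simp: gns_triple_def cyclic_vector_def)
  then have \<Omega>12: "s \<Omega>1 \<Omega>2 \<in> tensor_space s H K" by (rule tensor_space_mem)
  have n1: "norm (s \<Omega>1 \<Omega>2) = 1"
    by (simp add: tensor_map_norm[OF s] gns_norm[OF gns(1) \<omega>(1)] gns_norm[OF gns(2) \<omega>(2)])
  have \<phi>t: "\<phi> (t a b) = \<omega>1 a * \<omega>2 b" for a b
    using s gns \<Omega> by (simp add: \<phi>_def \<sigma>_def tensor_rep_apply[OF HP KQ] tensor_map_def gns_triple_def)
  have bl: "bounded_linear \<phi>"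
    unfolding \<phi>_def
    by (rule bounded_linear_compose[OF bounded_linear_cinner_right
          star_rep_bounded_linear[OF rep]])
  have le: "cmod (\<phi> X) \<le> norm X" for X
  proof -
    have "cmod (\<phi> X) \<le> norm (s \<Omega>1 \<Omega>2) * norm (\<sigma> X (s \<Omega>1 \<Omega>2))"
      unfolding \<phi>_def by (rule cinner_Cauchy_Schwarz)
    then show ?thesis using star_rep_norm_le[OF rep \<Omega>12, of X] by (simp add: n1)
  qed
  have "onorm \<phi> = 1"
  proof (rule antisym)
    show "onorm \<phi> \<le> 1" by (rule onorm_bound) (simp_all add: le)
    have o: "onorm \<omega>1 = 1" "onorm \<omega>2 = 1" using \<omega> by (auto simp: states_def)
    \<comment> \<open>Fixing \<open>b\<close> and optimizing over \<open>a\<close> uses up the norm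
      of \<open>\<omega>1\<close>; optimizing over \<open>b\<close> then uses that of
      \<open>\<omega>2\<close>.\<close>
    have ab: "cmod (\<omega>1 a) * cmod (\<omega>2 b) \<le> onorm \<phi> * (norm a * norm b)" for a b
    proof -
      have "cmod (\<omega>1 a) * cmod (\<omega>2 b) = cmod (\<phi> (t a b))" by (simp add: \<phi>t norm_mult)
      also have "\<dots> \<le> onorm \<phi> * norm (t a b)" by (rule onorm[OF bl])
      also have "\<dots> \<le> onorm \<phi> * (norm a * norm b)"
        by (intro mult_left_mono norm_t_le onorm_pos_le[OF bl])
      finally show ?thesis .
    qed
    have "cmod (\<omega>2 b) \<le> onorm \<phi> * norm b" for b
    proof (cases "\<omega>2 b = 0")
      case True
      then show ?thesis by (simp add: onorm_pos_le[OF bl])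
    next
      case False
      have "cmod (\<omega>1 a) \<le> (onorm \<phi> * norm b / cmod (\<omega>2 b)) * norm a" for a
        using ab[of a b] False by (simp add: field_simps)
      then have "onorm \<omega>1 \<le> onorm \<phi> * norm b / cmod (\<omega>2 b)"
        by (intro onorm_bound) (simp_all add: onorm_pos_le[OF bl])
      then show ?thesis using False o by (simp add: pos_le_divide_eq)
    qed
    then have "onorm \<omega>2 \<le> onorm \<phi>"
      by (intro onorm_bound) (simp_all add: onorm_pos_le[OF bl])
    then show "1 \<le> onorm \<phi>" using o by simp
  qed
  moreover have "\<phi> (star X * X) \<in> \<real>\<^sub>\<ge>\<^sub>0" for X
  proof -
    have "\<phi> (star X * X) = cinner (\<sigma> X (s \<Omega>1 \<Omega>2)) (\<sigma> X (s \<Omega>1 \<Omega>2))"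
      by (simp add: \<phi>_def star_rep_mult[OF rep] star_rep_adj[OF rep \<Omega>12 star_rep_mem[OF rep \<Omega>12]])
    then show ?thesis by (simp add: cinner_self)
  qed
  moreover have "clinear_on UNIV \<phi>"
    by (simp add: clinear_on_def \<phi>_def star_rep_add[OF rep] star_rep_scaleC[OF rep] cinner_add_right
        cinner_scaleC_right scaleC_complex_def)
  ultimately have st: "\<phi> \<in> states" using bl by (simp add: states_def)
  have "(THE \<phi>. \<phi> \<in> states \<and> (\<forall>a b. \<phi> (t a b) = \<omega>1 a * \<omega>2 b)) = \<phi>"
  proof (rule the_equality)
    show "\<phi> \<in> states \<and> (\<forall>a b. \<phi> (t a b) = \<omega>1 a * \<omega>2 b)" using st \<phi>t by blast
    fix \<psi> assume \<psi>: "\<psi> \<in> states \<and> (\<forall>a b. \<psi> (t a b) = \<omega>1 a * \<omega>2 b)"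
    then have "bounded_linear \<psi>" by (simp add: states_def)
    then show "\<psi> = \<phi>" using bounded_linear_eq[OF _ bl] \<psi> \<phi>t by auto
  qed
  then show ?thesis by (simp add: \<phi>_def \<sigma>_def fun_eq_iff)
qed

end


section \<open>Flips\<close>

lemma bops_bounded_linear:
  assumes "T \<in> bops UNIV K"
  shows "bounded_linear T"
proof -
  obtain C where "\<And>x. norm (T x) \<le> C * norm x" using bops_bound[OF assms] by blast
  then show ?thesis
    using bops_add[OF assms] bops_scaleC[OF assms]
    by (intro bounded_linear_intro[of _ C]) (auto simp: scaleR_scaleC mult.commute)
qed

lemma csubspace_UNIV: "csubspace UNIV"
  by (simp add: csubspace_def)

locale self_tensor =
  fixes s :: "'h::chilbert_space \<Rightarrow> 'h \<Rightarrow> 'k::chilbert_space"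
  assumes hilbert_tensor: "hilbert_tensor s"
begin

lemma tensor_map: "tensor_map s"
  using hilbert_tensor by (rule hilbert_tensor_map)

lemma flip_op_props:
  assumes H: "csubspace H" "csubspace K"
  shows flip_op_bops: "flip_op s H K \<in> bops (tensor_space s H K) (tensor_space s K H)"
    and flip_op_apply: "\<And>x y. x \<in> H \<Longrightarrow> y \<in> K \<Longrightarrow> flip_op s H K (s x y) = s y x"
proof -
  have "tensor_map (\<lambda>x y. s y x)"
    using tensor_map by (simp add: tensor_map_def cbilinear_def mult.commute)
  then obtain T where T: "T \<in> bops (tensor_space s H K) UNIV" "\<And>x y. x \<in> H \<Longrightarrow> y \<in> K \<Longrightarrow> T (s x y) = s y x"
    using tensor_bops_exists[OF tensor_map _ H, of "\<lambda>x y. s y x" "\<lambda>x. x" 1 "\<lambda>y. y" 1]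
    by (auto simp: clinear_on_def)
  have TB: "T \<in> bops (tensor_space s H K) (tensor_space s K H)"
    by (rule bops_range[OF T(1) tensor_space_def tensor_space_csubspace[OF tensor_map H(1)]
          tensor_space_csubspace[OF tensor_map H(2)] tensor_space_closed])
      (auto simp: T(2) intro: tensor_space_mem)
  have "flip_op s H K = T"
    unfolding flip_op_def
  proof (rule the_equality)
    show "T \<in> bops (tensor_space s H K) (tensor_space s K H) \<and> (\<forall>x\<in>H. \<forall>y\<in>K. T (s x y) = s y x)"
      using TB T(2) by blast
    fix U assume U: "U \<in> bops (tensor_space s H K) (tensor_space s K H) \<and> (\<forall>x\<in>H. \<forall>y\<in>K. U (s x y) = s y x)"
    show "U = T"
      by (rule tensor_bops_eq[OF tensor_map H(1) _ TB]) (use U T(2) in auto)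
  qed
  then show "flip_op s H K \<in> bops (tensor_space s H K) (tensor_space s K H)"
    and "\<And>x y. x \<in> H \<Longrightarrow> y \<in> K \<Longrightarrow> flip_op s H K (s x y) = s y x"
    using TB T(2) by auto
qed

text \<open>The flip of the whole ambient space. Every \<open>flip_op s H K\<close> is its
  restriction, so involutivity and isometry are checked once rather than for each pair of
  subspaces.\<close>

abbreviation F :: "'k \<Rightarrow> 'k" where "F \<equiv> flip_op s UNIV UNIV"

lemma F_bops: "F \<in> bops UNIV UNIV"
  using flip_op_bops[OF csubspace_UNIV csubspace_UNIV] by (simp add: hilbert_tensor_space_UNIV[OF hilbert_tensor])

lemma F_s [simp]: "F (s x y) = s y x"
  using flip_op_apply[OF csubspace_UNIV csubspace_UNIV] by simp

lemma bounded_linear_F: "bounded_linear F"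
  by (rule bops_bounded_linear[OF F_bops])

lemma UNIV_dense: "UNIV = closure (span {s x y | x y. x \<in> UNIV \<and> y \<in> UNIV})"
  using hilbert_tensor by (simp add: hilbert_tensor_def)

lemma flip_op_F:
  assumes "csubspace H" "csubspace K" "z \<in> tensor_space s H K"
  shows "flip_op s H K z = F z"
  by (rule cont_linear_on_eq[OF bops_cont_linear_on[OF flip_op_bops[OF assms(1,2)]
          tensor_space_csubspace[OF tensor_map assms(1)]]
        bounded_linear_cont_linear_on[OF bounded_linear_F] tensor_space_def _ assms(3)])
    (auto simp: flip_op_apply[OF assms(1,2)])

lemma F_F [simp]: "F (F z) = z"
  by (rule cont_linear_on_eq[OF bounded_linear_cont_linear_on[OF bounded_linear_compose[OF bounded_linear_F bounded_linear_F]]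
        bounded_linear_cont_linear_on[OF bounded_linear_ident] UNIV_dense]) auto

lemma F_mem:
  assumes "csubspace H" "csubspace K"
  shows "F z \<in> tensor_space s K H \<longleftrightarrow> z \<in> tensor_space s H K"
  using bops_mem[OF flip_op_bops[OF assms], of z] bops_mem[OF flip_op_bops[OF assms(2,1)], of "F z"]
    flip_op_F[OF assms, of z] flip_op_F[OF assms(2,1), of "F z"] by auto

lemma F_adj: "cinner (F x) y = cinner x (F y)"
  by (rule cinner_adj_extend[OF F_bops F_bops csubspace_UNIV UNIV_dense])
    (use tensor_map in \<open>auto simp: tensor_map_def mult.commute\<close>)

lemma F_cinner: "cinner (F x) (F y) = cinner x y"
  by (simp add: F_adj)

lemma F_norm: "norm (F x) = norm x"
  by (rule norm_eq_cinner) (rule F_cinner)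

lemma tensor_op_flip:
  assumes H: "csubspace H" "csubspace K" and S: "S \<in> bops H H" and T: "T \<in> bops K K"
  shows "tensor_op s H K S T z = F (tensor_op s K H T S (F z))"
proof -
  note op = tensor_op_mem[OF tensor_map H(2,1) T S] tensor_op_apply[OF tensor_map H(2,1) T S]
  have "flip_op s K H \<circ> tensor_op s K H T S \<circ> flip_op s H K \<in> bops (tensor_space s H K) (tensor_space s H K)"
    by (intro bops_compose[OF flip_op_bops[OF H]] bops_compose[OF op(1)] flip_op_bops H)
  then have "tensor_op s H K S T = flip_op s K H \<circ> tensor_op s K H T S \<circ> flip_op s H K"
    by (rule tensor_op_eqI[OF tensor_map H(1)])
      (simp add: flip_op_apply[OF H] op(2) flip_op_apply[OF H(2,1)] bops_mem[OF S] bops_mem[OF T])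
  then have eq: "tensor_op s H K S T z = flip_op s K H (tensor_op s K H T S (flip_op s H K z))" by simp
  show ?thesis
  proof (cases "z \<in> tensor_space s H K")
    case True
    then have "F z \<in> tensor_space s K H" by (simp add: F_mem[OF H])
    then show ?thesis using eq bops_mem[OF op(1)] True by (simp add: flip_op_F H)
  next
    case False
    then have "F z \<notin> tensor_space s K H" by (simp add: F_mem[OF H])
    then show ?thesis using eq False
      by (simp add: bops_out[OF op(1)] bops_out[OF flip_op_bops[OF H]] bops_zero[OF op(1)]
          bops_zero[OF F_bops] bops_zero[OF flip_op_bops[OF H(2,1)]])
  qed
qed

end

locale self_spatial_tensor = spatial_tensor s P P t + self_tensor s
  for s :: "'h::chilbert_space \<Rightarrow> 'h \<Rightarrow> 'k::chilbert_space"
    and P :: "('h set \<times> ('a::cstar_algebra \<Rightarrow> 'h \<Rightarrow> 'h)) set"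
    and t :: "'a \<Rightarrow> 'a \<Rightarrow> 'b::cstar_algebra"
begin

text \<open>Composing a product representation with \<open>f\<close> gives another representation of
  the tensor product on the same space, which is contractive.\<close>

lemma star_hom_norm_le:
  fixes f :: "'b \<Rightarrow> 'b"
  assumes f: "star_hom f"
  shows "norm (f X) \<le> norm X"
proof (rule norm_le_reps)
  fix H \<pi> K \<rho> v assume HP: "(H, \<pi>) \<in> P" "(K, \<rho>) \<in> P"
  let ?\<sigma> = "tensor_rep s t H \<pi> K \<rho>"
  have rep: "star_rep (tensor_space s H K) ?\<sigma>" by (rule tensor_rep_star_rep[OF HP])
  have f': "f (a + b) = f a + f b" "f (c *\<^sub>C a) = c *\<^sub>C f a" "f (a * b) = f a * f b" "f (star a) = star (f a)" for a b c
    using f by (auto simp: star_hom_def clinear_on_def)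
  have "star_rep (tensor_space s H K) (\<lambda>X. ?\<sigma> (f X))"
    using rep unfolding star_rep_def f' by blast
  then show "norm (?\<sigma> (f X) v) \<le> norm X * norm v"
    using star_rep_norm_le bops_out[OF star_rep_bops[OF rep]] by (cases "v \<in> tensor_space s H K") auto
qed simp

lemma star_hom_bounded_linear:
  fixes f :: "'b \<Rightarrow> 'b"
  assumes f: "star_hom f"
  shows "bounded_linear f"
proof -
  have "linear f" using f clinear_on_linear by (auto simp: star_hom_def)
  then show ?thesis
    using star_hom_norm_le[OF f] by (intro bounded_linear_intro[of f 1]) (auto simp: linear_add linear_scale)
qed

text \<open>Exchanging the algebra factors preserves the spatial norm: the isometry \<open>F\<close>
  relates the operators on the space of \<open>(H, K)\<close> to those on the space of
  \<open>(K, H)\<close>, and both slots range over the same family \<open>P\<close>.\<close>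

lemma flip_alg_exists: "\<exists>f. star_hom f \<and> (\<forall>a b. f (t a b) = t b a)"
proof -
  have "norm (\<Sum>k<n. t (b k) (a k)) \<le> norm (\<Sum>k<n. t (a k) (b k))" for n :: nat and a b
  proof (rule norm_sum_le)
    fix H \<pi> K \<rho> z assume HP: "(H, \<pi>) \<in> P" "(K, \<rho>) \<in> P"
    note reps = reps[OF HP] and HK = HK[OF HP]
    have "(\<Sum>k<n. tensor_op s H K (\<pi> (b k)) (\<rho> (a k)) z) = (\<Sum>k<n. F (tensor_op s K H (\<rho> (a k)) (\<pi> (b k)) (F z)))"
      by (intro sum.cong refl tensor_op_flip HK star_rep_bops reps)
    also have "\<dots> = F (\<Sum>k<n. tensor_op s K H (\<rho> (a k)) (\<pi> (b k)) (F z))"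
      by (rule linear_sum[symmetric]) (rule bounded_linear.linear[OF bounded_linear_F])
    finally show "norm (\<Sum>k<n. tensor_op s H K (\<pi> (b k)) (\<rho> (a k)) z) \<le> norm (\<Sum>k<n. t (a k) (b k)) * norm z"
      using op_sum_le[OF HP(2,1), where n = n and a = a and b = b and z = "F z"] by (simp add: F_norm)
  qed simp
  then obtain f where bl: "bounded_linear f" and ft: "\<And>a b. f (t a b) = t b a"
    using extend_from_tensors[of "\<lambda>a b. t b a" 1] cbilinear_scaleC_right[OF bilinear]
    by (auto simp: scaleR_scaleC)
  have add: "f (X + Y) = f X + f Y" for X Y using bl by (simp add: linear_simps)
  have "f (c *\<^sub>C t a b) = c *\<^sub>C f (t a b)" for c a b
    using ft[of "c *\<^sub>C a" b]
    by (simp add: ft cbilinear_scaleC_left[OF bilinear] cbilinear_scaleC_right[OF bilinear])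
  then have scl: "f (c *\<^sub>C X) = c *\<^sub>C f X" for c X
    by (rule bounded_linear_eq[OF bounded_linear_compose[OF bl bounded_linear_scaleC_cstar]
          bounded_linear_compose[OF bounded_linear_scaleC_cstar bl]])
  have st: "f (star X) = star (f X)" for X
    by (rule bounded_linear_eq[OF bounded_linear_compose[OF bl bounded_linear_star]
          bounded_linear_compose[OF bounded_linear_star bl]]) (simp add: ft t_star)
  have m1: "f (X * t a b) = f X * f (t a b)" for X a b
    by (rule bounded_linear_eq[OF bounded_linear_compose[OF bl bounded_linear_mult_left]
          bounded_linear_compose[OF bounded_linear_mult_left bl]]) (simp add: ft t_mult)
  have mu: "f (X * Y) = f X * f Y" for X Y
    by (rule bounded_linear_eq[OF bounded_linear_compose[OF bl bounded_linear_mult_right]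
          bounded_linear_compose[OF bounded_linear_mult_right bl]]) (rule m1)
  have "star_hom f" by (simp add: star_hom_def clinear_on_def add scl mu st)
  then show ?thesis using ft by blast
qed

lemma flip_alg: "star_hom (flip_alg t)" "flip_alg t (t a b) = t b a"
proof -
  have "\<exists>!f. star_hom f \<and> (\<forall>a b. f (t a b) = t b a)"
  proof (rule ex_ex1I[OF flip_alg_exists])
    fix f g assume f: "star_hom f \<and> (\<forall>a b. f (t a b) = t b a)" and g: "star_hom g \<and> (\<forall>a b. g (t a b) = t b a)"
    show "f = g"
      by (rule ext, rule bounded_linear_eq[OF star_hom_bounded_linear star_hom_bounded_linear]) (use f g in auto)
  qed
  from theI'[OF this] show "star_hom (flip_alg t)" "flip_alg t (t a b) = t b a"
    unfolding flip_alg_def by auto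
qed

lemma flip_alg_mult: "flip_alg t (X * Y) = flip_alg t X * flip_alg t Y"
  and flip_alg_add: "flip_alg t (X + Y) = flip_alg t X + flip_alg t Y"
  and flip_alg_scaleC: "flip_alg t (c *\<^sub>C X) = c *\<^sub>C flip_alg t X"
  using flip_alg(1) by (auto simp: star_hom_def clinear_on_def)

lemma flip_alg_flip_alg: "flip_alg t (flip_alg t X) = X"
  by (rule bounded_linear_eq[OF bounded_linear_compose[OF star_hom_bounded_linear star_hom_bounded_linear]
        bounded_linear_ident]) (simp_all add: flip_alg)

lemma tensor_rep_flip_alg:
  assumes HP: "(H, \<pi>) \<in> P" "(K, \<rho>) \<in> P"
  shows "tensor_rep s t H \<pi> K \<rho> (flip_alg t X) v = F (tensor_rep s t K \<rho> H \<pi> X (F v))"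
  by (rule bounded_linear_eq[OF bounded_linear_compose[OF star_rep_bounded_linear[OF tensor_rep_star_rep[OF HP]]
          star_hom_bounded_linear[OF flip_alg(1)]]
        bounded_linear_compose[OF bounded_linear_F star_rep_bounded_linear[OF tensor_rep_star_rep[OF HP(2,1)]]]])
    (simp add: flip_alg tensor_rep_t HP tensor_op_flip[OF HK[OF HP] star_rep_bops[OF P[OF HP(1)]] star_rep_bops[OF P[OF HP(2)]]])

lemma product_state_gns:
  assumes "(H, \<pi>) \<in> P" "(K, \<rho>) \<in> P" "\<omega>1 \<in> states" "\<omega>2 \<in> states"
    and "gns_triple \<omega>1 H \<pi> \<Omega>1" "gns_triple \<omega>2 K \<rho> \<Omega>2"
  shows "product_state t \<omega>1 \<omega>2 X = cinner (s \<Omega>1 \<Omega>2) (tensor_rep s t H \<pi> K \<rho> X (s \<Omega>1 \<Omega>2))"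
  unfolding product_state_def by (simp add: product_state_exists[OF assms])

end


section \<open>Comultiplications with values in the tensor product\<close>

lemma of_multiplier_mult: "of_multiplier (\<lambda>x. y * x) = (y::'b::cstar_algebra)"
  unfolding of_multiplier_def
  by (rule the_equality) (auto simp: fun_eq_iff intro: cstar_mult_cancel)

text \<open>On the dense subalgebra \<open>\<Delta>\<close> acts as multiplication by elements.
  Contractivity transfers Cauchy sequences from the arguments to these elements, and the limit
  represents \<open>\<Delta> x\<close>.\<close>

lemma algebraic_bialgebra_values:
  fixes \<Delta> :: "'a::cstar_algebra \<Rightarrow> 'b::cstar_algebra \<Rightarrow> 'b"
  assumes "algebraic_bialgebra t t21 t12 \<Delta>"
  shows "\<Delta> x = (\<lambda>z. of_multiplier (\<Delta> x) * z)"
proof -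
  obtain A0 where A0: "closure A0 = UNIV"
    "\<forall>a\<in>A0. \<exists>y \<in> span {t b c | b c. b \<in> A0 \<and> c \<in> A0}. \<Delta> a = (\<lambda>x. y * x)"
    using assms unfolding algebraic_bialgebra_def by blast
  have D: "nondeg_hom \<Delta>" using assms by (simp add: algebraic_bialgebra_def cstar_bialgebra_def)
  have "x \<in> closure A0" using A0(1) by simp
  then obtain X where X: "\<forall>n. X n \<in> A0" "X \<longlonglongrightarrow> x" by (rule in_closureE)
  have "\<forall>n. \<exists>y. \<Delta> (X n) = (\<lambda>x. y * x)" using X(1) A0(2) by meson
  then obtain Y where Y: "\<And>n. \<Delta> (X n) = (\<lambda>x. Y n * x)" by metis
  have "dist (Y m) (Y n) \<le> dist (X m) (X n)" for m n
  proof -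
    have eq: "(Y m - Y n) * z = \<Delta> (X m - X n) z" for z
      by (simp add: nondeg_hom_diff[OF D] Y left_diff_distrib)
    \<comment> \<open>Testing at \<open>star (Y m - Y n)\<close> turns an operator estimate into a
      norm estimate by the C*-identity.\<close>
    have "(norm (Y m - Y n))\<^sup>2 = norm (\<Delta> (X m - X n) (star (Y m - Y n)))"
      by (simp only: norm_mult_star_self[symmetric] eq)
    also have "\<dots> \<le> norm (X m - X n) * norm (Y m - Y n)"
      using nondeg_hom_norm_le[OF D, of "X m - X n" "star (Y m - Y n)"] by (simp only: norm_star)
    finally show ?thesis
      by (cases "norm (Y m - Y n) = 0") (simp_all add: power2_eq_square dist_norm)
  qed
  then have "Cauchy Y"
    using LIMSEQ_imp_Cauchy[OF X(2)] unfolding Cauchy_def by (meson le_less_trans)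
  then obtain y where y: "Y \<longlonglongrightarrow> y" using Cauchy_convergent convergentD by blast
  have "\<Delta> x = (\<lambda>z. y * z)"
  proof
    fix z
    have "bounded_linear (\<lambda>a. \<Delta> a z)"
      using nondeg_hom_norm_le[OF D]
      by (intro bounded_linear_intro[of _ "norm z"]) (simp_all add: nondeg_hom_add[OF D] nondeg_hom_scaleR[OF D])
    then have "(\<lambda>n. \<Delta> (X n) z) \<longlonglongrightarrow> \<Delta> x z" using X(2) by (rule bounded_linear.tendsto)
    moreover have "(\<lambda>n. \<Delta> (X n) z) \<longlonglongrightarrow> y * z"
      unfolding Y by (intro tendsto_mult y tendsto_const)
    ultimately show "\<Delta> x z = y * z" by (rule LIMSEQ_unique)
  qed
  then show ?thesis by (simp add: of_multiplier_mult)
qed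

lemma algebraic_bialgebra_star_hom:
  fixes \<Delta> :: "'a::cstar_algebra \<Rightarrow> 'b::cstar_algebra \<Rightarrow> 'b"
  assumes A: "algebraic_bialgebra t t21 t12 \<Delta>"
  shows "star_hom (\<lambda>x. of_multiplier (\<Delta> x))"
proof -
  have D: "nondeg_hom \<Delta>" using assms by (simp add: algebraic_bialgebra_def cstar_bialgebra_def)
  have v: "of_multiplier (\<Delta> x) * z = \<Delta> x z" for x z
    using algebraic_bialgebra_values[OF A, of x] by (metis (full_types))
  show ?thesis
    unfolding star_hom_def clinear_on_def
  proof (intro conjI allI ballI)
    show "of_multiplier (\<Delta> (x + y)) = of_multiplier (\<Delta> x) + of_multiplier (\<Delta> y)" for x y
      by (rule cstar_mult_cancel) (simp add: v distrib_right nondeg_hom_add[OF D])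
    show "of_multiplier (\<Delta> (c *\<^sub>C x)) = c *\<^sub>C of_multiplier (\<Delta> x)" for c x
      by (rule cstar_mult_cancel) (simp add: v scaleC_mult_left nondeg_hom_scaleC[OF D])
    show "of_multiplier (\<Delta> (x * y)) = of_multiplier (\<Delta> x) * of_multiplier (\<Delta> y)" for x y
      by (rule cstar_mult_cancel, subst mult.assoc) (simp add: v nondeg_hom_mult[OF D])
    fix x
    have "star w * star (of_multiplier (\<Delta> x)) * z = star w * of_multiplier (\<Delta> (star x)) * z" for w z
      using nondeg_hom_star[OF D, of x w z] by (simp add: v[symmetric] star_mult mult.assoc)
    then have "star w * star (of_multiplier (\<Delta> x)) = star w * of_multiplier (\<Delta> (star x))" for w
      by (rule cstar_mult_cancel)
    then have "w * of_multiplier (\<Delta> (star x)) = w * star (of_multiplier (\<Delta> x))" for w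
      by (metis star_star)
    then show "of_multiplier (\<Delta> (star x)) = star (of_multiplier (\<Delta> x))"
      by (rule cstar_mult_cancel_left)
  qed
qed

lemma (in self_spatial_tensor) of_multiplier_opposite:
  assumes "algebraic_bialgebra t t21 t12 \<Delta>"
  shows "of_multiplier (opposite t \<Delta> x) = flip_alg t (of_multiplier (\<Delta> x))"
proof -
  have "opposite t \<Delta> x = (\<lambda>z. flip_alg t (of_multiplier (\<Delta> x)) * z)"
    unfolding opposite_def
    by (subst algebraic_bialgebra_values[OF assms]) (simp add: fun_eq_iff flip_alg_mult flip_alg_flip_alg)
  then show ?thesis by (simp add: of_multiplier_mult)
qed


section \<open>The operators R\<close>

locale abelian_states =
  fixes t :: "'a::cstar_algebra \<Rightarrow> 'a \<Rightarrow> 'b::cstar_algebra"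
    and t21 :: "'b \<Rightarrow> 'a \<Rightarrow> 'c::cstar_algebra"
    and t12 :: "'a \<Rightarrow> 'b \<Rightarrow> 'c"
    and s :: "'h::chilbert_space \<Rightarrow> 'h \<Rightarrow> 'k::chilbert_space"
    and s21 :: "'k \<Rightarrow> 'h \<Rightarrow> 'l::chilbert_space"
    and s12 :: "'h \<Rightarrow> 'k \<Rightarrow> 'l"
    and H :: "('a \<Rightarrow> complex) \<Rightarrow> 'h set"
    and \<pi> :: "('a \<Rightarrow> complex) \<Rightarrow> 'a \<Rightarrow> 'h \<Rightarrow> 'h"
    and \<Omega> :: "('a \<Rightarrow> complex) \<Rightarrow> 'h"
    and \<Delta> :: "'a \<Rightarrow> 'b \<Rightarrow> 'b"
    and S0 :: "('a \<Rightarrow> complex) set"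
  assumes gns: "\<And>\<omega>. \<omega> \<in> states \<Longrightarrow> gns_triple \<omega> (H \<omega>) (\<pi> \<omega>) (\<Omega> \<omega>)"
    and hilbert: "hilbert_tensor3 s s21 s12"
    and tensor: "min_tensor3 s s21 s12 (gns_reps H \<pi>) t t21 t12"
    and bialgebra: "algebraic_bialgebra t t21 t12 \<Delta>"
    and S0: "S0 \<subseteq> states"
    and closed: "\<And>\<omega>1 \<omega>2. \<omega>1 \<in> S0 \<Longrightarrow> \<omega>2 \<in> S0 \<Longrightarrow> state_conv t \<Delta> \<omega>1 \<omega>2 \<in> S0"
    and abelian: "\<And>\<omega>1 \<omega>2. \<omega>1 \<in> S0 \<Longrightarrow> \<omega>2 \<in> S0 \<Longrightarrow>
           state_conv t \<Delta> \<omega>1 \<omega>2 = state_conv t \<Delta> \<omega>2 \<omega>1"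
    and cyclic: "\<And>\<omega>1 \<omega>2. \<omega>1 \<in> S0 \<Longrightarrow> \<omega>2 \<in> S0 \<Longrightarrow>
           cyclic_vector (tensor_space s (H \<omega>1) (H \<omega>2))
             (rep_conv s t \<Delta> (H \<omega>1) (\<pi> \<omega>1) (H \<omega>2) (\<pi> \<omega>2)) (s (\<Omega> \<omega>1) (\<Omega> \<omega>2))"
begin

lemma gns_reps_star_rep: "(K, \<rho>) \<in> gns_reps H \<pi> \<Longrightarrow> star_rep K \<rho>"
  using gns by (auto simp: gns_reps_def gns_triple_def)

sublocale T: self_spatial_tensor s "gns_reps H \<pi>" t
  using hilbert tensor gns_reps_star_rep
  by unfold_locales (auto simp: hilbert_tensor3_def min_tensor3_def intro: hilbert_tensor_map)

abbreviation HH where "HH p q \<equiv> tensor_space s (H p) (H q)"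
abbreviation \<pi>\<pi> where "\<pi>\<pi> p q \<equiv> tensor_rep s t (H p) (\<pi> p) (H q) (\<pi> q)"
abbreviation \<Omega>\<Omega> where "\<Omega>\<Omega> p q \<equiv> s (\<Omega> p) (\<Omega> q)"
abbreviation vec where "vec p q X \<equiv> \<pi>\<pi> p q X (\<Omega>\<Omega> p q)"
abbreviation \<Delta>1 where "\<Delta>1 x \<equiv> of_multiplier (\<Delta> x)"
abbreviation \<Delta>op where "\<Delta>op x \<equiv> flip_alg t (of_multiplier (\<Delta> x))"

lemma S0_states: "\<omega> \<in> S0 \<Longrightarrow> \<omega> \<in> states"
  using S0 by blast

lemma gns_props:
  assumes "\<omega> \<in> S0"
  shows rep_mem: "(H \<omega>, \<pi> \<omega>) \<in> gns_reps H \<pi>" and rep: "star_rep (H \<omega>) (\<pi> \<omega>)"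
    and H_csubspace: "csubspace (H \<omega>)"
    and \<Omega>_mem: "\<Omega> \<omega> \<in> H \<omega>" and \<Omega>_cyclic: "closure (range (\<lambda>a. \<pi> \<omega> a (\<Omega> \<omega>))) = H \<omega>"
    and \<Omega>_state: "\<omega> a = cinner (\<Omega> \<omega>) (\<pi> \<omega> a (\<Omega> \<omega>))"
  using gns[OF S0_states[OF assms]] S0_states[OF assms]
  by (auto simp: gns_reps_def gns_triple_def cyclic_vector_def star_rep_def)

lemma \<Delta>_props:
  shows \<Delta>_mult: "\<Delta>1 (x * y) = \<Delta>1 x * \<Delta>1 y" and \<Delta>_star: "\<Delta>1 (star x) = star (\<Delta>1 x)"
    and \<Delta>_clinear: "clinear_on UNIV \<Delta>1"
  using algebraic_bialgebra_star_hom[OF bialgebra] by (auto simp: star_hom_def)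

context
  fixes p q assumes S: "p \<in> S0" "q \<in> S0"
begin

lemma pair_rep: "star_rep (HH p q) (\<pi>\<pi> p q)"
  by (rule T.tensor_rep_star_rep[OF rep_mem[OF S(1)] rep_mem[OF S(2)]])

lemma HH_csubspace: "csubspace (HH p q)"
  using pair_rep by (rule star_rep_csubspace)

lemma \<Omega>\<Omega>_mem: "\<Omega>\<Omega> p q \<in> HH p q"
  by (rule tensor_space_mem[OF \<Omega>_mem[OF S(1)] \<Omega>_mem[OF S(2)]])

lemma pair_dense: "closure (range (\<lambda>x. vec p q (\<Delta>1 x))) = HH p q"
  using cyclic[OF S] by (simp add: cyclic_vector_def rep_conv_def)

lemma pair_clinear: "clinear_on UNIV (\<lambda>x. \<pi>\<pi> p q (\<Delta>1 x) v)"
  using \<Delta>_clinear by (simp add: clinear_on_def star_rep_add[OF pair_rep] star_rep_scaleC[OF pair_rep])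

lemma pair_op_clinear: "clinear_on UNIV (\<lambda>x. \<pi>\<pi> p q (\<Delta>op x) v)"
  using \<Delta>_clinear
  by (simp add: clinear_on_def star_rep_add[OF pair_rep] star_rep_scaleC[OF pair_rep]
      T.flip_alg_add T.flip_alg_scaleC)

text \<open>Trades the opposite comultiplication for an exchange of the two states, because the flip
  carries one product of cyclic vectors to the other. All statements on \<open>\<Delta>op\<close>
  are reduced to \<open>\<Delta>\<close> in this way.\<close>

lemma pair_op: "vec p q (flip_alg t X) = T.F (vec q p X)"
  by (simp add: T.tensor_rep_flip_alg[OF rep_mem[OF S(1)] rep_mem[OF S(2)]])

lemma pair_inner:
  "cinner (vec p q (\<Delta>1 x)) (vec p q (\<Delta>1 y)) = state_conv t \<Delta> p q (star x * y)"
proof -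
  have "state_conv t \<Delta> p q (star x * y) =
      cinner (\<Omega>\<Omega> p q) (vec p q (\<Delta>1 (star x * y)))"
    unfolding state_conv_def
    by (rule T.product_state_gns[OF rep_mem[OF S(1)] rep_mem[OF S(2)]
          S0_states[OF S(1)] S0_states[OF S(2)] gns[OF S0_states[OF S(1)]] gns[OF S0_states[OF S(2)]]])
  then show ?thesis
    by (simp add: \<Delta>_mult \<Delta>_star star_rep_mult[OF pair_rep]
        star_rep_adj[OF pair_rep \<Omega>\<Omega>_mem star_rep_mem[OF pair_rep \<Omega>\<Omega>_mem]])
qed

lemma pair_bops_eq:
  assumes "U \<in> bops (HH p q) K" "V \<in> bops (HH p q) L"
    and "\<And>x. U (vec p q (\<Delta>1 x)) = V (vec p q (\<Delta>1 x))"
  shows "U = V"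
proof (rule bops_eq[OF assms(1,2) _ HH_csubspace])
  have "subspace (range (\<lambda>x. vec p q (\<Delta>1 x)))"
    by (intro csubspace_subspace clinear_range_csubspace pair_clinear)
  then show "HH p q = closure (span (range (\<lambda>x. vec p q (\<Delta>1 x))))"
    using pair_dense by (simp add: span_eq_iff[THEN iffD2])
qed (use assms(3) in auto)

end

lemma F_image: "T.F ` S = {z. T.F z \<in> S}"
proof (intro set_eqI iffI)
  fix z assume "z \<in> {z. T.F z \<in> S}"
  then have "z = T.F (T.F z)" "T.F z \<in> S" by auto
  then show "z \<in> T.F ` S" by blast
qed auto

lemma pair_op_dense:
  assumes S: "p \<in> S0" "q \<in> S0"
  shows "closure (range (\<lambda>x. vec p q (\<Delta>op x))) = HH p q"
proof -
  define V where "V = range (\<lambda>x. vec q p (\<Delta>1 x))"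
  have 1: "range (\<lambda>x. vec p q (\<Delta>op x)) = T.F ` V"
    unfolding V_def pair_op[OF S] by auto
  have img: "T.F ` closure W \<subseteq> closure (T.F ` W)" for W
    by (rule closure_bounded_linear_image_subset[OF T.bounded_linear_F])
  \<comment> \<open>Since \<open>F\<close> is a continuous involution, the inclusion
    \<open>img\<close> applied to the image set gives the reverse inclusion.\<close>
  have "T.F ` closure (T.F ` V) \<subseteq> closure V"
    using img[of "T.F ` V"] by (simp add: image_image)
  then have "T.F ` T.F ` closure (T.F ` V) \<subseteq> T.F ` closure V" by (rule image_mono)
  then have "closure (T.F ` V) = T.F ` closure V"
    using img[of V] by (simp add: image_image)
  also have "closure V = HH q p" unfolding V_def by (rule pair_dense[OF S(2,1)])
  also have "T.F ` HH q p = HH p q"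
    by (simp add: F_image T.F_mem H_csubspace S)
  finally show ?thesis by (simp add: 1)
qed

text \<open>A choice is enough here: existence is \<open>R_props\<close>, and the prescribed values
  on a dense set leave only one bounded operator, which is recorded in the final proof.\<close>

definition R :: "('a \<Rightarrow> complex) \<Rightarrow> ('a \<Rightarrow> complex) \<Rightarrow> 'k \<Rightarrow> 'k" where
  "R p q = (SOME U. unitary_op (HH p q) (HH p q) U \<and>
     (\<forall>x. U (vec p q (\<Delta>1 x)) = vec p q (\<Delta>op x)))"

context
  fixes p q assumes S: "p \<in> S0" "q \<in> S0"
begin

lemma R_props:
  shows R_unitary: "unitary_op (HH p q) (HH p q) (R p q)"
    and R_apply: "R p q (vec p q (\<Delta>1 x)) = vec p q (\<Delta>op x)"
proof -
  have "\<exists>U. unitary_op (HH p q) (HH p q) U \<and>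
     (\<forall>x. U (vec p q (\<Delta>1 x)) = vec p q (\<Delta>op x))"
  proof (rule unitary_from_dense[OF pair_clinear[OF S] pair_dense[OF S] pair_op_clinear[OF S] pair_op_dense[OF S]])
    fix x y
    show "cinner (vec p q (\<Delta>op x)) (vec p q (\<Delta>op y)) =
        cinner (vec p q (\<Delta>1 x)) (vec p q (\<Delta>1 y))"
      by (simp add: pair_op[OF S] T.F_cinner pair_inner[OF S] pair_inner[OF S(2,1)] abelian[OF S])
  qed
  from someI_ex[OF this] show "unitary_op (HH p q) (HH p q) (R p q)"
    and "R p q (vec p q (\<Delta>1 x)) = vec p q (\<Delta>op x)"
    unfolding R_def by auto
qed

lemma R_bops: "R p q \<in> bops (HH p q) (HH p q)"
  using R_unitary by (simp add: unitary_op_def)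

text \<open>On the vector of \<open>\<Delta>1 y\<close> both sides give the vector of
  \<open>\<Delta>op (x * y)\<close>.\<close>

lemma R_intertwines: "R p q \<circ> \<pi>\<pi> p q (\<Delta>1 x) = \<pi>\<pi> p q (\<Delta>op x) \<circ> R p q"
proof (rule pair_bops_eq[OF S bops_compose[OF star_rep_bops[OF pair_rep[OF S]] R_bops]
        bops_compose[OF R_bops star_rep_bops[OF pair_rep[OF S]]]])
  fix y
  show "(R p q \<circ> \<pi>\<pi> p q (\<Delta>1 x)) (vec p q (\<Delta>1 y)) =
      (\<pi>\<pi> p q (\<Delta>op x) \<circ> R p q) (vec p q (\<Delta>1 y))"
    using R_apply[of "x * y"]
    by (simp add: R_apply \<Delta>_mult T.flip_alg_mult star_rep_mult[OF pair_rep[OF S]])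
qed

lemma R_conj:
  "R p q \<circ> \<pi>\<pi> p q (\<Delta>1 x) \<circ> adj_op (HH p q) (HH p q) (R p q) = \<pi>\<pi> p q (\<Delta>op x)"
proof
  fix y
  note adj = adj_op_unitary[OF R_unitary HH_csubspace[OF S] HH_csubspace[OF S]]
  show "(R p q \<circ> \<pi>\<pi> p q (\<Delta>1 x) \<circ> adj_op (HH p q) (HH p q) (R p q)) y = \<pi>\<pi> p q (\<Delta>op x) y"
  proof (cases "y \<in> HH p q")
    case True
    then show ?thesis using adj(2)[OF True] by (simp only: R_intertwines) simp
  next
    case False
    then show ?thesis
      using bops_out[OF adj(1)] bops_out[OF star_rep_bops[OF pair_rep[OF S]]]
        bops_zero[OF star_rep_bops[OF pair_rep[OF S]]] bops_zero[OF R_bops] by simp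
  qed
qed

end

lemma R_flip_R:
  assumes S: "p \<in> S0" "q \<in> S0"
  shows "R p q \<circ> flip_op s (H q) (H p) \<circ> R q p \<circ> flip_op s (H p) (H q) =
    tensor_op s (H p) (H q) (id_op (H p)) (id_op (H q))"
proof -
  note cs = H_csubspace[OF S(1)] H_csubspace[OF S(2)]
  have id: "tensor_op s (H p) (H q) (id_op (H p)) (id_op (H q)) = id_op (HH p q)"
    by (rule tensor_op_eqI[OF T.tensor_map cs(1) id_op_bops[OF HH_csubspace[OF S]]])
      (simp add: id_op_def tensor_space_mem)
  let ?U = "R p q \<circ> flip_op s (H q) (H p) \<circ> R q p \<circ> flip_op s (H p) (H q)"
  have U: "?U \<in> bops (HH p q) (HH p q)"
    by (rule bops_compose[OF T.flip_op_bops[OF cs] bops_compose[OF R_bops[OF S(2,1)]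
          bops_compose[OF T.flip_op_bops[OF cs(2,1)] R_bops[OF S]]]])
  have "?U = id_op (HH p q)"
  proof (rule bops_eq[OF U id_op_bops[OF HH_csubspace[OF S]] _ HH_csubspace[OF S]])
    \<comment> \<open>The test vectors come from \<open>\<Delta>op\<close>, not
      \<open>\<Delta>\<close>: the first flip turns them into vectors of \<open>\<Delta>1 x\<close>
      for the exchanged states, where \<open>R q p\<close> is known.\<close>
    let ?v = "\<lambda>x. vec p q (\<Delta>op x)"
    have "subspace (range ?v)"
      by (intro csubspace_subspace clinear_range_csubspace pair_op_clinear S)
    then show "HH p q = closure (span (range ?v))"
      using pair_op_dense[OF S] by (simp add: span_eq_iff[THEN iffD2])
    fix z assume "z \<in> range ?v"
    then obtain x where x: "z = ?v x" by blast
    have mem: "vec p q X \<in> HH p q" "vec q p X \<in> HH q p" for X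
      by (intro star_rep_mem[OF pair_rep] \<Omega>\<Omega>_mem S)+
    have "flip_op s (H p) (H q) z = vec q p (\<Delta>1 x)"
      by (simp add: T.flip_op_F[OF cs] x mem) (simp add: pair_op[OF S])
    then have "?U z = R p q (flip_op s (H q) (H p) (vec q p (\<Delta>op x)))"
      by (simp add: R_apply[OF S(2,1)])
    also have "flip_op s (H q) (H p) (vec q p (\<Delta>op x)) = vec p q (\<Delta>1 x)"
      by (simp add: T.flip_op_F[OF cs(2,1)] mem) (simp add: pair_op[OF S(2,1)])
    also have "R p q \<dots> = z" by (simp add: R_apply[OF S] x)
    finally show "?U z = id_op (HH p q) z" using mem by (simp add: id_op_def x)
  qed
  then show ?thesis by (simp add: id)
qed

text \<open>The two cyclic vectors induce the same functional of \<open>A\<close> by commutativity,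
  so the representations are equivalent as GNS representations of one state. By
  \<open>pair_op\<close> the operator obtained is the flip composed with
  \<open>R p q\<close>.\<close>

lemma rep_conv_equivalent:
  assumes S: "p \<in> S0" "q \<in> S0"
  shows "unitarily_equivalent
    (HH p q) (rep_conv s t \<Delta> (H p) (\<pi> p) (H q) (\<pi> q))
    (HH q p) (rep_conv s t \<Delta> (H q) (\<pi> q) (H p) (\<pi> p))"
proof -
  note S' = S(2,1)
  have "\<exists>U. unitary_op (HH p q) (HH q p) U \<and>
     (\<forall>x. U (vec p q (\<Delta>1 x)) = vec q p (\<Delta>1 x))"
    by (rule unitary_from_dense[OF pair_clinear[OF S] pair_dense[OF S] pair_clinear[OF S'] pair_dense[OF S']])
      (simp add: pair_inner S abelian[OF S])
  then obtain U where U: "unitary_op (HH p q) (HH q p) U"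
     "\<And>x. U (vec p q (\<Delta>1 x)) = vec q p (\<Delta>1 x)" by blast
  have UB: "U \<in> bops (HH p q) (HH q p)" using U(1) by (simp add: unitary_op_def)
  have "U \<circ> \<pi>\<pi> p q (\<Delta>1 x) = \<pi>\<pi> q p (\<Delta>1 x) \<circ> U" for x
  proof (rule pair_bops_eq[OF S bops_compose[OF star_rep_bops[OF pair_rep[OF S]] UB]
          bops_compose[OF UB star_rep_bops[OF pair_rep[OF S']]]])
    fix y
    show "(U \<circ> \<pi>\<pi> p q (\<Delta>1 x)) (vec p q (\<Delta>1 y)) =
        (\<pi>\<pi> q p (\<Delta>1 x) \<circ> U) (vec p q (\<Delta>1 y))"
      using U(2)[of "x * y"] U(2)[of y]
      by (simp add: \<Delta>_mult star_rep_mult[OF pair_rep[OF S]] star_rep_mult[OF pair_rep[OF S']])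
  qed
  then show ?thesis using U(1) by (auto simp: unitarily_equivalent_def rep_conv_def)
qed

end


section \<open>Threefold tensor products\<close>

lemma linear_eq_span:
  assumes "linear f" "linear g" "\<And>x. x \<in> G \<Longrightarrow> f x = g x" "x \<in> span G"
  shows "f x = g x"
  using linear_eq_on_span[OF assms(1,2)] assms(3,4) by blast

lemma bops_linear_compose:
  assumes T: "T \<in> bops D K" and L: "linear L" "\<And>X. L X \<in> D"
  shows "linear (\<lambda>X. T (L X))"
  by (rule linearI)
    (simp_all add: linear_add[OF L(1)] linear_scale[OF L(1)] bops_add[OF T L(2) L(2)]
      clinear_on_scaleR[OF bops_clinear[OF T] L(2)])

lemma nondeg_hom_sum: "nondeg_hom D \<Longrightarrow> D (\<Sum>i<(n::nat). f i) w = (\<Sum>i<n. D (f i) w)"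
  by (induction n)
    (simp_all add: nondeg_hom_add nondeg_hom_scaleR[of D 0 0 w, simplified])

text \<open>\<open>U\<close> agrees with left multiplication by \<open>e\<close> on the vectors
  \<open>f a x\<close>, whose span is dense. This converts coassociativity from a statement about
  extensions into one about elements.\<close>

lemma extension_maps_mult:
  assumes f: "nondeg_hom f" and U: "extension_maps f (\<lambda>z. y * z) U" and y: "f y = (\<lambda>w. e * w)"
  shows "U = (\<lambda>w. e * w)"
proof (rule multiplier_eq_mult[where G = "{f a x | a x. True}"])
  show "U \<in> multipliers" using U by (simp add: extension_maps_def)
  show "closure (span {f a x | a x. True}) = UNIV" using f by (simp add: nondeg_hom_def)
  fix w assume "w \<in> {f a x | a x. True}"
  then obtain a x where w: "w = f a x" by blast
  have "U (f a x) = f (y * a) x" using U by (simp add: extension_maps_def)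
  also have "\<dots> = e * f a x" by (simp add: nondeg_hom_mult[OF f] y)
  finally show "U w = e * w" by (simp add: w)
qed

context abelian_states
begin

lemma tensor_reps_star_rep:
  "(K, \<sigma>) \<in> tensor_reps s t (gns_reps H \<pi>) (gns_reps H \<pi>) \<Longrightarrow> star_rep K \<sigma>"
  by (auto simp: tensor_reps_def intro: T.tensor_rep_star_rep)

sublocale T21: spatial_tensor s21 "tensor_reps s t (gns_reps H \<pi>) (gns_reps H \<pi>)" "gns_reps H \<pi>" t21
  using hilbert tensor gns_reps_star_rep tensor_reps_star_rep
  by unfold_locales (auto simp: hilbert_tensor3_def min_tensor3_def intro: hilbert_tensor_map)

sublocale T12: spatial_tensor s12 "gns_reps H \<pi>" "tensor_reps s t (gns_reps H \<pi>) (gns_reps H \<pi>)" t12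
  using hilbert tensor gns_reps_star_rep tensor_reps_star_rep
  by unfold_locales (auto simp: hilbert_tensor3_def min_tensor3_def intro: hilbert_tensor_map)

lemma s_assoc: "s21 (s x y) z = s12 x (s y z)"
  using hilbert by (simp add: hilbert_tensor3_def)

lemma t_assoc: "t21 (t a b) c = t12 a (t b c)"
  using tensor by (simp add: min_tensor3_def)

lemma hilbert_tensor_21: "hilbert_tensor s21" and hilbert_tensor_12: "hilbert_tensor s12"
  using hilbert by (simp_all add: hilbert_tensor3_def)

text \<open>The elements \<open>(\<Delta> \<otimes> id) (\<Delta> x) = (id \<otimes> \<Delta>) (\<Delta> x)\<close> belong to this set for all \<open>x\<close> in the dense subalgebra.\<close>

definition coassociated :: "'c set" where
  "coassociated = span {t21 (\<Delta>1 a) b | a b. True} \<inter> span {t12 a (\<Delta>1 b) | a b. True}"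

text \<open>For \<open>x\<close> in the subalgebra, \<open>\<Delta>1 x\<close> is a finite sum of
  elementary tensors, so \<open>\<Delta>\<close> can be applied termwise in either leg without any
  extension. The common multiplier \<open>U\<close> acts as left multiplication by both results, and
  cancellation makes them equal.\<close>

lemma coassociative_elements:
  "\<exists>A0. closure A0 = UNIV \<and> (\<forall>x\<in>A0. \<exists>(n::nat) b c. \<Delta>1 x = (\<Sum>i<n. t (b i) (c i)) \<and>
     (\<Sum>i<n. t21 (\<Delta>1 (b i)) (c i)) \<in> coassociated)"
proof -
  have D: "\<Delta> x = (\<lambda>z. \<Delta>1 x * z)" for x by (rule algebraic_bialgebra_values[OF bialgebra])
  obtain A0 where A0: "closure A0 = UNIV"
    "\<And>a. a \<in> A0 \<Longrightarrow> \<exists>y \<in> span {t b c | b c. b \<in> A0 \<and> c \<in> A0}. \<Delta> a = (\<lambda>x. y * x)"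
    using bialgebra unfolding algebraic_bialgebra_def by blast
  have "coassociative t t21 t12 \<Delta>"
    using bialgebra by (simp add: algebraic_bialgebra_def cstar_bialgebra_def)
  then obtain F G where F: "nondeg_hom F" "\<And>a b y c. F (t a b) (t21 y c) = t21 (\<Delta> a y) (b * c)"
    and G: "nondeg_hom G" "\<And>a b c y. G (t a b) (t12 c y) = t12 (a * c) (\<Delta> b y)"
    and U: "\<And>a. \<exists>U. extension_maps F (\<Delta> a) U \<and> extension_maps G (\<Delta> a) U"
    unfolding coassociative_def by blast
  have Ft: "F (t a b) = (\<lambda>w. t21 (\<Delta>1 a) b * w)" for a b
  proof (rule multiplier_eq_mult[OF nondeg_hom_multiplier[OF F(1)] T21.t_dense])
    fix w assume "w \<in> {t21 y c | y c. True}"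
    then obtain y c where "w = t21 y c" by blast
    moreover have "\<Delta> a y = \<Delta>1 a * y" using D[of a] by (rule fun_cong)
    ultimately show "F (t a b) w = t21 (\<Delta>1 a) b * w" by (simp add: F(2) T21.t_mult)
  qed
  have Gt: "G (t a b) = (\<lambda>w. t12 a (\<Delta>1 b) * w)" for a b
  proof (rule multiplier_eq_mult[OF nondeg_hom_multiplier[OF G(1)] T12.t_dense])
    fix w assume "w \<in> {t12 c y | c y. True}"
    then obtain y c where "w = t12 c y" by blast
    moreover have "\<Delta> b y = \<Delta>1 b * y" using D[of b] by (rule fun_cong)
    ultimately show "G (t a b) w = t12 a (\<Delta>1 b) * w" by (simp add: G(2) T12.t_mult)
  qed
  have "\<exists>(n::nat) b c. \<Delta>1 x = (\<Sum>i<n. t (b i) (c i)) \<and> (\<Sum>i<n. t21 (\<Delta>1 (b i)) (c i)) \<in> coassociated"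
    if x: "x \<in> A0" for x
  proof -
    obtain y where y: "y \<in> span {t b c | b c. b \<in> A0 \<and> c \<in> A0}" "\<Delta> x = (\<lambda>z. y * z)"
      using A0(2)[OF x] by blast
    have "\<Delta>1 x = y" by (simp add: y(2) of_multiplier_mult)
    moreover have "span {t b c | b c. b \<in> A0 \<and> c \<in> A0} \<subseteq> span {t b c | b c. True}"
      by (rule span_mono) blast
    ultimately have "\<Delta>1 x \<in> span {t b c | b c. True}" using y(1) by blast
    then obtain n b c where n: "\<Delta>1 x = (\<Sum>i<(n::nat). t (b i) (c i))" by (rule T.span_sum)
    \<comment> \<open>The two iterated coproducts of \<open>x\<close>, one in each
      bracketing.\<close>
    define e1 e2 where "e1 = (\<Sum>i<n. t21 (\<Delta>1 (b i)) (c i))" and "e2 = (\<Sum>i<n. t12 (b i) (\<Delta>1 (c i)))"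
    have Fe: "F (\<Delta>1 x) = (\<lambda>w. e1 * w)"
      by (simp add: n nondeg_hom_sum[OF F(1)] Ft e1_def sum_distrib_right fun_eq_iff)
    have Ge: "G (\<Delta>1 x) = (\<lambda>w. e2 * w)"
      by (simp add: n nondeg_hom_sum[OF G(1)] Gt e2_def sum_distrib_right fun_eq_iff)
    obtain U where U: "extension_maps F (\<Delta> x) U" "extension_maps G (\<Delta> x) U" using U by blast
    have "U = (\<lambda>w. e1 * w)"
      by (rule extension_maps_mult[OF F(1) _ Fe]) (use U(1) D[of x] in metis)
    moreover have "U = (\<lambda>w. e2 * w)"
      by (rule extension_maps_mult[OF G(1) _ Ge]) (use U(2) D[of x] in metis)
    ultimately have "e1 * w = e2 * w" for w by metis
    then have e: "e1 = e2" by (rule cstar_mult_cancel)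
    have "e1 \<in> span {t21 (\<Delta>1 a) b | a b. True}"
      unfolding e1_def by (intro span_sum span_base) blast
    moreover have "e2 \<in> span {t12 a (\<Delta>1 b) | a b. True}"
      unfolding e2_def by (intro span_sum span_base) blast
    ultimately have "e1 \<in> coassociated" by (simp add: coassociated_def e)
    then show ?thesis using n e1_def by blast
  qed
  then show ?thesis using A0(1) by blast
qed

section \<open>Vectors and operators on three legs\<close>

abbreviation KK where "KK p q r \<equiv> tensor_space s12 (H p) (HH q r)"

text \<open>The threefold GNS map, set up in the left bracketing; \<open>\<Lambda>_t12\<close> shows
  that it has the analogous form in the right one.\<close>

definition \<Lambda> where
  "\<Lambda> p q r X =
     tensor_rep s21 t21 (HH p q) (\<pi>\<pi> p q) (H r) (\<pi> r) X (s21 (\<Omega>\<Omega> p q) (\<Omega> r))"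

text \<open>\<open>RL\<close> is \<open>R\<close> on the left pair of legs and \<open>RR\<close> on
  the right pair; \<open>FR\<close> flips the right pair, and conjugating \<open>RL\<close> with it
  yields \<open>R13\<close>.\<close>

definition RL where
  "RL p q r = tensor_op s21 (HH p q) (H r) (R p q) (id_op (H r))"

definition RR where
  "RR p q r = tensor_op s12 (H p) (HH q r) (id_op (H p)) (R q r)"

definition FR where
  "FR p q r = tensor_op s12 (H p) (HH q r) (id_op (H p)) (flip_op s (H q) (H r))"

text \<open>\<open>F12\<close> and \<open>F23\<close> live on the ambient space and depend on no
  states. Words in them can be simplified by the relations of the symmetric group while the state
  spaces of the legs change.\<close>

definition F12 :: "'l \<Rightarrow> 'l" where
  "F12 = tensor_op s21 UNIV UNIV T.F (id_op UNIV)"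

definition F23 :: "'l \<Rightarrow> 'l" where
  "F23 = tensor_op s12 UNIV UNIV (id_op UNIV) T.F"

lemma F12_bops: "F12 \<in> bops UNIV UNIV" and F12_apply: "F12 (s21 u z) = s21 (T.F u) z"
proof -
  note op = tensor_op_bops[OF T21.s csubspace_UNIV csubspace_UNIV T.F_bops id_op_bops[OF csubspace_UNIV]]
  show "F12 \<in> bops UNIV UNIV"
    unfolding F12_def using op(1) by (simp add: hilbert_tensor_space_UNIV[OF hilbert_tensor_21])
  show "F12 (s21 u z) = s21 (T.F u) z"
    unfolding F12_def using op(2) by (simp add: id_op_def)
qed

lemma F23_bops: "F23 \<in> bops UNIV UNIV" and F23_apply: "F23 (s12 x v) = s12 x (T.F v)"
proof -
  note op = tensor_op_bops[OF T12.s csubspace_UNIV csubspace_UNIV id_op_bops[OF csubspace_UNIV] T.F_bops]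
  show "F23 \<in> bops UNIV UNIV"
    unfolding F23_def using op(1) by (simp add: hilbert_tensor_space_UNIV[OF hilbert_tensor_12])
  show "F23 (s12 x v) = s12 x (T.F v)"
    unfolding F23_def using op(2) by (simp add: id_op_def)
qed

lemma F12_linear: "bounded_linear F12" and F23_linear: "bounded_linear F23"
  using bops_bounded_linear F12_bops F23_bops by blast+

lemma linear_F12: "linear f \<Longrightarrow> linear (\<lambda>X. F12 (f X))"
  and linear_F23: "linear f \<Longrightarrow> linear (\<lambda>X. F23 (f X))"
  using linear_compose[of f F12] linear_compose[of f F23] F12_linear F23_linear
  by (simp_all add: comp_def bounded_linear.linear)

lemma bounded_linear_eq_s:
  assumes "bounded_linear f" "bounded_linear g" "\<And>x y. f (s x y) = g (s x y)"
  shows "f v = g v"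
  by (rule cont_linear_on_eq[OF bounded_linear_cont_linear_on[OF assms(1)]
        bounded_linear_cont_linear_on[OF assms(2)] T.UNIV_dense]) (auto simp: assms(3))

lemma bounded_linear_eq_s3:
  assumes f: "bounded_linear f" and g: "bounded_linear g"
    and eq: "\<And>x y z. f (s21 (s x y) z) = g (s21 (s x y) z)"
  shows "f v = g v"
proof -
  have "f (s21 u z) = g (s21 u z)" for u z
    by (rule bounded_linear_eq_s[where f = "\<lambda>u. f (s21 u z)" and g = "\<lambda>u. g (s21 u z)"])
      (auto intro: bounded_linear_compose[OF f] bounded_linear_compose[OF g]
        tensor_map_bounded_linear(1)[OF T21.s] eq)
  moreover have "UNIV = closure (span {s21 u z | u z. True})"
    using hilbert_tensor_21 by (simp add: hilbert_tensor_def)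
  ultimately show ?thesis
    using cont_linear_on_eq[OF bounded_linear_cont_linear_on[OF f] bounded_linear_cont_linear_on[OF g],
        of UNIV "{s21 u z | u z. True}" v] by auto
qed

section \<open>Permutation relations for the flips of three legs\<close>

lemma F_elementary:
  "F12 (s21 (s x y) z) = s21 (s y x) z" "F23 (s21 (s x y) z) = s21 (s x z) y"
  by (simp_all add: F12_apply) (simp add: s_assoc F23_apply)

lemma F12_F12 [simp]: "F12 (F12 v) = v"
  by (rule bounded_linear_eq_s3[OF bounded_linear_compose[OF F12_linear F12_linear] bounded_linear_ident])
    (simp add: F_elementary)

lemma F23_F23 [simp]: "F23 (F23 v) = v"
  by (rule bounded_linear_eq_s3[OF bounded_linear_compose[OF F23_linear F23_linear] bounded_linear_ident])
    (simp add: F_elementary)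

lemma F_braid: "F23 (F12 (F23 v)) = F12 (F23 (F12 v))"
  by (rule bounded_linear_eq_s3[OF
        bounded_linear_compose[OF F23_linear bounded_linear_compose[OF F12_linear F23_linear]]
        bounded_linear_compose[OF F12_linear bounded_linear_compose[OF F23_linear F12_linear]]])
    (simp add: F_elementary)

text \<open>The cyclic permutation carrying the first leg to the last place; it also changes the
  bracketing, so a pair occupying legs 2 and 3 becomes a pair on legs 1 and 2.\<close>

lemma F_rotate: "F23 (F12 (s12 x v)) = s21 v x"
  by (rule bounded_linear_eq_s[OF
        bounded_linear_compose[OF F23_linear bounded_linear_compose[OF F12_linear tensor_map_bounded_linear(2)[OF T12.s]]]
        tensor_map_bounded_linear(1)[OF T21.s]])
    (simp add: s_assoc[symmetric] F_elementary)

lemma F_rotate': "F12 (F23 (s21 v x)) = s12 x v"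
  by (simp add: F_rotate[symmetric])

context
  fixes p q r assumes S: "p \<in> S0" "q \<in> S0" "r \<in> S0"
begin

text \<open>A limit of elementary tensors in one pair of legs stays in the other closed span when
  tensored with a fixed vector; associativity settles the elementary case.\<close>

lemma KK_eq: "tensor_space s21 (HH p q) (H r) = KK p q r"
proof
  have sub: "subspace (tensor_space s21 (HH p q) (H r))" "subspace (KK p q r)"
    unfolding tensor_space_def[of s21] tensor_space_def[of s12] by (intro subspace_closure subspace_span)+
  have id: "cont_linear_on D (\<lambda>x. x)" for D :: "'z::real_normed_vector set"
    by (rule bounded_linear_cont_linear_on[OF bounded_linear_ident])
  show "tensor_space s21 (HH p q) (H r) \<subseteq> KK p q r"
  proof
    fix v assume v: "v \<in> tensor_space s21 (HH p q) (H r)"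
    have "s21 u z \<in> KK p q r" if u: "u \<in> HH p q" and z: "z \<in> H r" for u z
      by (rule cont_linear_on_range[OF bounded_linear_cont_linear_on[OF tensor_map_bounded_linear(1)[OF T21.s]]
            tensor_space_def sub(2) tensor_space_closed _ u])
        (use z in \<open>auto simp: s_assoc intro!: tensor_space_mem\<close>)
    then show "v \<in> KK p q r"
      by (intro cont_linear_on_range[OF id tensor_space_def sub(2) tensor_space_closed _ v]) auto
  qed
  show "KK p q r \<subseteq> tensor_space s21 (HH p q) (H r)"
  proof
    fix v assume v: "v \<in> KK p q r"
    have "s12 x u \<in> tensor_space s21 (HH p q) (H r)" if u: "u \<in> HH q r" and x: "x \<in> H p" for u x
      by (rule cont_linear_on_range[OF bounded_linear_cont_linear_on[OF tensor_map_bounded_linear(2)[OF T12.s]]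
            tensor_space_def sub(1) tensor_space_closed _ u])
        (use x in \<open>auto simp: s_assoc[symmetric] intro!: tensor_space_mem\<close>)
    then show "v \<in> tensor_space s21 (HH p q) (H r)"
      by (intro cont_linear_on_range[OF id tensor_space_def sub(1) tensor_space_closed _ v]) auto
  qed
qed

lemma KK_csubspace: "csubspace (KK p q r)"
  by (rule tensor_space_csubspace[OF T12.s H_csubspace[OF S(1)]])

lemma F12_mem:
  assumes v: "v \<in> KK p q r"
  shows "F12 v \<in> tensor_space s21 (HH q p) (H r)"
proof (rule cont_linear_on_range[OF bounded_linear_cont_linear_on[OF F12_linear] _ _ tensor_space_closed])
  show "KK p q r = closure (span {s21 u z | u z. u \<in> HH p q \<and> z \<in> H r})"
    unfolding KK_eq[symmetric] tensor_space_def[of s21] ..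
  show "subspace (tensor_space s21 (HH q p) (H r))"
    unfolding tensor_space_def[of s21] by (intro subspace_closure subspace_span)
  fix w assume "w \<in> {s21 u z | u z. u \<in> HH p q \<and> z \<in> H r}"
  then show "F12 w \<in> tensor_space s21 (HH q p) (H r)"
    by (auto simp: F12_apply T.F_mem H_csubspace S intro!: tensor_space_mem)
qed (rule v)

lemma F23_mem:
  assumes v: "v \<in> KK p q r"
  shows "F23 v \<in> KK p r q"
proof (rule cont_linear_on_range[OF bounded_linear_cont_linear_on[OF F23_linear] tensor_space_def _ tensor_space_closed])
  show "subspace (KK p r q)"
    unfolding tensor_space_def[of s12] by (intro subspace_closure subspace_span)
  fix w assume "w \<in> {s12 x u | x u. x \<in> H p \<and> u \<in> HH q r}"
  then show "F23 w \<in> KK p r q"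
    by (auto simp: F23_apply T.F_mem H_csubspace S intro!: tensor_space_mem)
qed (rule v)

lemma pair_mem: "(HH p q, \<pi>\<pi> p q) \<in> tensor_reps s t (gns_reps H \<pi>) (gns_reps H \<pi>)"
  unfolding tensor_reps_def using rep_mem[OF S(1)] rep_mem[OF S(2)] by blast

lemma triple_rep:
  "star_rep (KK p q r) (tensor_rep s21 t21 (HH p q) (\<pi>\<pi> p q) (H r) (\<pi> r))"
  using T21.tensor_rep_star_rep[OF pair_mem rep_mem[OF S(3)]] by (simp add: KK_eq)

lemma \<Lambda>_linear: "bounded_linear (\<Lambda> p q r)"
  unfolding \<Lambda>_def by (rule star_rep_bounded_linear[OF triple_rep])

lemma linear_\<Lambda>: "linear (\<Lambda> p q r)"
  by (rule bounded_linear.linear[OF \<Lambda>_linear])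

lemma \<Lambda>_mem: "\<Lambda> p q r X \<in> KK p q r"
  unfolding \<Lambda>_def
  by (rule star_rep_mem[OF triple_rep])
    (simp add: KK_eq[symmetric] tensor_space_mem \<Omega>_mem S \<Omega>\<Omega>_mem)

lemma \<Lambda>_t21: "\<Lambda> p q r (t21 X c) = s21 (vec p q X) (\<pi> r c (\<Omega> r))"
  unfolding \<Lambda>_def
  by (rule T21.tensor_rep_apply[OF pair_mem rep_mem[OF S(3)] \<Omega>\<Omega>_mem[OF S(1,2)] \<Omega>_mem[OF S(3)]])

lemma RL_bops: "RL p q r \<in> bops (KK p q r) (KK p q r)"
  and RL_apply: "\<And>u z. u \<in> HH p q \<Longrightarrow> z \<in> H r \<Longrightarrow> RL p q r (s21 u z) = s21 (R p q u) z"
proof -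
  note op = tensor_op_bops[OF T21.s HH_csubspace[OF S(1,2)] H_csubspace[OF S(3)] R_bops[OF S(1,2)]
      id_op_bops[OF H_csubspace[OF S(3)]]]
  show "RL p q r \<in> bops (KK p q r) (KK p q r)"
    using op(1) by (simp add: RL_def KK_eq)
  show "\<And>u z. u \<in> HH p q \<Longrightarrow> z \<in> H r \<Longrightarrow> RL p q r (s21 u z) = s21 (R p q u) z"
    using op(2) by (simp add: RL_def id_op_def)
qed

lemma RR_bops: "RR p q r \<in> bops (KK p q r) (KK p q r)"
  and RR_apply: "\<And>x u. x \<in> H p \<Longrightarrow> u \<in> HH q r \<Longrightarrow> RR p q r (s12 x u) = s12 x (R q r u)"
proof -
  note op = tensor_op_bops[OF T12.s H_csubspace[OF S(1)] HH_csubspace[OF S(2,3)]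
      id_op_bops[OF H_csubspace[OF S(1)]] R_bops[OF S(2,3)]]
  show "RR p q r \<in> bops (KK p q r) (KK p q r)"
    using op(1) by (simp add: RR_def)
  show "\<And>x u. x \<in> H p \<Longrightarrow> u \<in> HH q r \<Longrightarrow> RR p q r (s12 x u) = s12 x (R q r u)"
    using op(2) by (simp add: RR_def id_op_def)
qed

lemma FR_bops: "FR p q r \<in> bops (KK p q r) (KK p r q)"
  and FR_eq: "\<And>v. v \<in> KK p q r \<Longrightarrow> FR p q r v = F23 v"
proof -
  note fl = T.flip_op_bops[OF H_csubspace[OF S(2)] H_csubspace[OF S(3)]]
  note op = tensor_op_bops[OF T12.s H_csubspace[OF S(1)] HH_csubspace[OF S(2,3)]
      id_op_bops[OF H_csubspace[OF S(1)]] fl]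
  show B: "FR p q r \<in> bops (KK p q r) (KK p r q)"
    using op(1) by (simp add: FR_def)
  fix v assume v: "v \<in> KK p q r"
  show "FR p q r v = F23 v"
  proof (rule cont_linear_on_eq[OF bops_cont_linear_on[OF B KK_csubspace]
        bounded_linear_cont_linear_on[OF F23_linear] tensor_space_def _ v])
    fix w assume "w \<in> {s12 x u | x u. x \<in> H p \<and> u \<in> HH q r}"
    then show "FR p q r w = F23 w"
      using op(2) T.flip_op_F[OF H_csubspace[OF S(2)] H_csubspace[OF S(3)]]
      by (auto simp: FR_def F23_apply id_op_def)
  qed
qed

end

text \<open>With \<open>a\<close> fixed, density in \<open>Y\<close> reduces to threefold elementary
  tensors, where \<open>t_assoc\<close> and \<open>s_assoc\<close> bring in the left-bracketed
  formula.\<close>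

lemma \<Lambda>_t12:
  assumes S: "p \<in> S0" "q \<in> S0" "r \<in> S0"
  shows "\<Lambda> p q r (t12 a Y) = s12 (\<pi> p a (\<Omega> p)) (vec q r Y)"
  by (rule T.bounded_linear_eq[OF bounded_linear_compose[OF \<Lambda>_linear[OF S] T12.bounded_linear_t(2)]
        bounded_linear_compose[OF tensor_map_bounded_linear(2)[OF T12.s] star_rep_bounded_linear[OF pair_rep[OF S(2,3)]]]])
    (simp add: t_assoc[symmetric] \<Lambda>_t21[OF S]
      T.tensor_rep_apply[OF rep_mem[OF S(1)] rep_mem[OF S(2)] \<Omega>_mem[OF S(1)] \<Omega>_mem[OF S(2)]]
      T.tensor_rep_apply[OF rep_mem[OF S(2)] rep_mem[OF S(3)] \<Omega>_mem[OF S(2)] \<Omega>_mem[OF S(3)]] s_assoc)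

lemma KK_mem_F12:
  assumes "p \<in> S0" "q \<in> S0" "r \<in> S0" "v \<in> KK p q r"
  shows "F12 v \<in> KK q p r"
  using F12_mem[OF assms] KK_eq[OF assms(2,1,3)] by simp

lemma R_pair:
  assumes "p \<in> S0" "q \<in> S0"
  shows "R p q (vec p q (\<Delta>1 x)) = T.F (vec q p (\<Delta>1 x))"
  by (simp add: R_apply[OF assms] pair_op[OF assms])

section \<open>Moving R past the threefold GNS vectors\<close>

context
  fixes p q r assumes S: "p \<in> S0" "q \<in> S0" "r \<in> S0"
begin

lemma vec_mem:
  "\<pi> p a (\<Omega> p) \<in> H p" "\<pi> q a (\<Omega> q) \<in> H q" "\<pi> r a (\<Omega> r) \<in> H r"
  "vec p q X \<in> HH p q" "vec q r X \<in> HH q r"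
  by (intro star_rep_mem[OF rep] star_rep_mem[OF pair_rep] \<Omega>_mem \<Omega>\<Omega>_mem S)+

text \<open>When \<open>X\<close> is a sum of tensors with a coproduct in legs 2 and 3,
  \<open>R q r\<close> meets exactly the vectors on which it is defined by formula. It exchanges the
  states \<open>q\<close> and \<open>r\<close> and leaves a flip behind.\<close>

lemma RR_\<Lambda>:
  assumes X: "X \<in> span {t12 a (\<Delta>1 b) | a b. True}"
  shows "RR p q r (\<Lambda> p q r X) = F23 (\<Lambda> p r q X)"
proof (rule linear_eq_span[OF _ _ _ X])
  show "linear (\<lambda>X. RR p q r (\<Lambda> p q r X))"
    by (rule bops_linear_compose[OF RR_bops[OF S] linear_\<Lambda>[OF S] \<Lambda>_mem[OF S]])
  show "linear (\<lambda>X. F23 (\<Lambda> p r q X))"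
    by (intro linear_F12 linear_F23 linear_\<Lambda> S)
  show "RR p q r (\<Lambda> p q r Y) = F23 (\<Lambda> p r q Y)" if "Y \<in> {t12 a (\<Delta>1 b) | a b. True}" for Y
    using that by (auto simp: \<Lambda>_t12 S RR_apply vec_mem R_pair F23_apply)
qed

lemma RL_\<Lambda>:
  assumes X: "X \<in> span {t21 (\<Delta>1 a) b | a b. True}"
  shows "RL p q r (\<Lambda> p q r X) = F12 (\<Lambda> q p r X)"
proof (rule linear_eq_span[OF _ _ _ X])
  show "linear (\<lambda>X. RL p q r (\<Lambda> p q r X))"
    by (rule bops_linear_compose[OF RL_bops[OF S] linear_\<Lambda>[OF S] \<Lambda>_mem[OF S]])
  show "linear (\<lambda>X. F12 (\<Lambda> q p r X))"
    by (intro linear_F12 linear_F23 linear_\<Lambda> S)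
  show "RL p q r (\<Lambda> p q r Y) = F12 (\<Lambda> q p r Y)" if "Y \<in> {t21 (\<Delta>1 a) b | a b. True}" for Y
    using that by (auto simp: \<Lambda>_t21 S RL_apply vec_mem R_pair F12_apply)
qed

text \<open>In \<open>\<Lambda> r p q X\<close> the pair \<open>p\<close>, \<open>q\<close> carries
  the coproduct in legs 2 and 3; the rotation brings it to legs 1 and 2, where \<open>RL\<close>
  acts.\<close>

lemma RL_rotate_\<Lambda>:
  assumes X: "X \<in> span {t12 a (\<Delta>1 b) | a b. True}"
  shows "RL p q r (F23 (F12 (\<Lambda> r p q X))) = F12 (F23 (F12 (\<Lambda> r q p X)))"
proof (rule linear_eq_span[OF _ _ _ X])
  show "linear (\<lambda>X. RL p q r (F23 (F12 (\<Lambda> r p q X))))"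
  proof (rule bops_linear_compose[OF RL_bops[OF S]])
    show "linear (\<lambda>X. F23 (F12 (\<Lambda> r p q X)))"
      by (intro linear_F12 linear_F23 linear_\<Lambda> S)
    show "F23 (F12 (\<Lambda> r p q X)) \<in> KK p q r" for X
      by (intro F23_mem KK_mem_F12 \<Lambda>_mem S)
  qed
  show "linear (\<lambda>X. F12 (F23 (F12 (\<Lambda> r q p X))))"
    by (intro linear_F12 linear_F23 linear_\<Lambda> S)
  show "RL p q r (F23 (F12 (\<Lambda> r p q Y))) = F12 (F23 (F12 (\<Lambda> r q p Y)))"
    if "Y \<in> {t12 a (\<Delta>1 b) | a b. True}" for Y
    using that by (auto simp: \<Lambda>_t12 S F_rotate RL_apply vec_mem R_pair F12_apply)
qed

text \<open>The mirror case: the coproduct sits in legs 1 and 2 with states \<open>q\<close>,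
  \<open>r\<close>, and the inverse rotation brings it to legs 2 and 3.\<close>

lemma RR_rotate_\<Lambda>:
  assumes X: "X \<in> span {t21 (\<Delta>1 a) b | a b. True}"
  shows "RR p q r (F12 (F23 (\<Lambda> q r p X))) = F23 (F12 (F23 (\<Lambda> r q p X)))"
proof (rule linear_eq_span[OF _ _ _ X])
  show "linear (\<lambda>X. RR p q r (F12 (F23 (\<Lambda> q r p X))))"
  proof (rule bops_linear_compose[OF RR_bops[OF S]])
    show "linear (\<lambda>X. F12 (F23 (\<Lambda> q r p X)))"
      by (intro linear_F12 linear_F23 linear_\<Lambda> S)
    show "F12 (F23 (\<Lambda> q r p X)) \<in> KK p q r" for X
      by (intro KK_mem_F12 F23_mem \<Lambda>_mem S)
  qed
  show "linear (\<lambda>X. F23 (F12 (F23 (\<Lambda> r q p X))))"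
    by (intro linear_F12 linear_F23 linear_\<Lambda> S)
  show "RR p q r (F12 (F23 (\<Lambda> q r p Y))) = F23 (F12 (F23 (\<Lambda> r q p Y)))"
    if "Y \<in> {t21 (\<Delta>1 a) b | a b. True}" for Y
    using that by (auto simp: \<Lambda>_t21 S F_rotate' RR_apply vec_mem R_pair F23_apply)
qed

text \<open>
  Cyclicity on three legs: the GNS space of \<open>p \<star> q\<close>, which is again in \<open>S0\<close>, is identified by
  \<open>V\<close> with the tensor product of the GNS spaces of \<open>p\<close> and \<open>q\<close>, and the cyclicity hypothesis is
  applied to the pair \<open>(p \<star> q, r)\<close>.
\<close>

lemma coassociated_dense: "KK p q r = closure (span (\<Lambda> p q r ` coassociated))"
proof
  define Z where "Z = closure (span (\<Lambda> p q r ` coassociated))"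
  have Z: "subspace Z" "closed Z" by (simp_all add: Z_def subspace_closure)
  have id: "cont_linear_on D (\<lambda>x. x)" for D :: "'z::real_normed_vector set"
    by (rule bounded_linear_cont_linear_on[OF bounded_linear_ident])
  show "closure (span (\<Lambda> p q r ` coassociated)) \<subseteq> KK p q r"
    by (intro closure_minimal span_minimal tensor_space_closed csubspace_subspace KK_csubspace S)
      (auto intro: \<Lambda>_mem S)
  define \<psi> where "\<psi> = state_conv t \<Delta> p q"
  have \<psi>: "\<psi> \<in> S0" unfolding \<psi>_def by (rule closed[OF S(1,2)])
  have "\<exists>V. unitary_op (H \<psi>) (HH p q) V \<and> (\<forall>a. V (\<pi> \<psi> a (\<Omega> \<psi>)) = vec p q (\<Delta>1 a))"
  proof (rule unitary_from_dense[OF star_rep_clinear[OF rep[OF \<psi>]] \<Omega>_cyclic[OF \<psi>]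
        pair_clinear[OF S(1,2)] pair_dense[OF S(1,2)]])
    fix x y
    have "cinner (\<pi> \<psi> x (\<Omega> \<psi>)) (\<pi> \<psi> y (\<Omega> \<psi>)) = \<psi> (star x * y)"
      by (simp add: \<Omega>_state[OF \<psi>] star_rep_mult[OF rep[OF \<psi>]]
          star_rep_adj[OF rep[OF \<psi>] \<Omega>_mem[OF \<psi>] star_rep_mem[OF rep[OF \<psi>] \<Omega>_mem[OF \<psi>]]])
    then show "cinner (vec p q (\<Delta>1 x)) (vec p q (\<Delta>1 y)) =
        cinner (\<pi> \<psi> x (\<Omega> \<psi>)) (\<pi> \<psi> y (\<Omega> \<psi>))"
      by (simp only: pair_inner[OF S(1,2)] \<psi>_def)
  qed
  then obtain V where V: "unitary_op (H \<psi>) (HH p q) V"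
    "\<And>a. V (\<pi> \<psi> a (\<Omega> \<psi>)) = vec p q (\<Delta>1 a)" by blast
  have VB: "V \<in> bops (H \<psi>) (HH p q)" and Vsurj: "V ` H \<psi> = HH p q"
    using V(1) by (auto simp: unitary_op_def)
  obtain C where C: "C \<ge> 0" "\<And>x. norm (V x) \<le> C * norm x" using bops_bound[OF VB] by blast
  \<comment> \<open>\<open>W\<close> is \<open>V\<close> tensored with the identity, from the
    two-leg space of the convolution and \<open>r\<close> into the three-leg space.\<close>
  obtain W where W: "W \<in> bops (HH \<psi> r) UNIV"
    "\<And>x z. x \<in> H \<psi> \<Longrightarrow> z \<in> H r \<Longrightarrow> W (s x z) = s21 (V x) z"
    using tensor_bops_exists[OF T.s T21.s H_csubspace[OF \<psi>] H_csubspace[OF S(3)] bops_clinear[OF VB] C(2) C(1),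
        of "\<lambda>x. x" 1]
    by (auto simp: clinear_on_def)
  have Wcont: "cont_linear_on (HH \<psi> r) W" by (rule bops_cont_linear_on[OF W(1) HH_csubspace[OF \<psi> S(3)]])
  define v where "v x = vec \<psi> r (\<Delta>1 x)" for x
  have v_mem: "v x \<in> HH \<psi> r" for x
    unfolding v_def by (intro star_rep_mem[OF pair_rep] \<Omega>\<Omega>_mem \<psi> S)
  obtain A0 where A0: "closure A0 = UNIV"
    "\<And>x. x \<in> A0 \<Longrightarrow> \<exists>(n::nat) b c. \<Delta>1 x = (\<Sum>i<n. t (b i) (c i)) \<and>
       (\<Sum>i<n. t21 (\<Delta>1 (b i)) (c i)) \<in> coassociated"
    using coassociative_elements by blast
  \<comment> \<open>\<open>W\<close> replaces the first leg by a coproduct: it sends the vector of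
    \<open>\<Delta>1 x\<close> to the threefold vector of the iterated coproduct of
    \<open>x\<close>.\<close>
  have WA: "W (v x) \<in> Z" if x: "x \<in> A0" for x
  proof -
    obtain n b c where n: "\<Delta>1 x = (\<Sum>i<(n::nat). t (b i) (c i))"
      and e: "(\<Sum>i<n. t21 (\<Delta>1 (b i)) (c i)) \<in> coassociated" using A0(2)[OF x] by blast
    have lin: "linear (\<lambda>X. W (vec \<psi> r X))"
      by (rule bops_linear_compose[OF W(1) bounded_linear.linear[OF star_rep_bounded_linear[OF pair_rep[OF \<psi> S(3)]]]
            star_rep_mem[OF pair_rep[OF \<psi> S(3)] \<Omega>\<Omega>_mem[OF \<psi> S(3)]]])
    have "W (v x) = (\<Sum>i<n. W (vec \<psi> r (t (b i) (c i))))"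
      unfolding v_def n by (rule linear_sum[OF lin])
    also have "\<dots> = (\<Sum>i<n. \<Lambda> p q r (t21 (\<Delta>1 (b i)) (c i)))"
    proof (rule sum.cong[OF refl])
      fix i
      have "vec \<psi> r (t (b i) (c i)) = s (\<pi> \<psi> (b i) (\<Omega> \<psi>)) (\<pi> r (c i) (\<Omega> r))"
        by (rule T.tensor_rep_apply[OF rep_mem[OF \<psi>] rep_mem[OF S(3)] \<Omega>_mem[OF \<psi>] \<Omega>_mem[OF S(3)]])
      then show "W (vec \<psi> r (t (b i) (c i))) = \<Lambda> p q r (t21 (\<Delta>1 (b i)) (c i))"
        by (simp add: W(2) star_rep_mem[OF rep[OF \<psi>] \<Omega>_mem[OF \<psi>]] vec_mem V(2) \<Lambda>_t21[OF S])
    qed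
    also have "\<dots> = \<Lambda> p q r (\<Sum>i<n. t21 (\<Delta>1 (b i)) (c i))"
      by (rule linear_sum[symmetric]) (rule bounded_linear.linear[OF \<Lambda>_linear[OF S]])
    finally show ?thesis
      unfolding Z_def using e by (auto intro!: subsetD[OF closure_subset] span_base)
  qed
  have v_linear: "bounded_linear v"
  proof -
    \<comment> \<open>Composition with \<open>\<Delta>1\<close> is again a representation, so
      continuity of \<open>v\<close> follows from automatic contractivity.\<close>
    have "star_rep (HH \<psi> r) (\<lambda>x. \<pi>\<pi> \<psi> r (\<Delta>1 x))"
      using pair_rep[OF \<psi> S(3)] \<Delta>_clinear
      unfolding star_rep_def \<Delta>_mult \<Delta>_star clinear_on_def by auto
    then show ?thesis unfolding v_def by (rule star_rep_bounded_linear)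
  qed
  have Wv: "W (v x) \<in> Z" for x
  proof -
    have "x \<in> closure A0" using A0(1) by simp
    then obtain X where X: "\<forall>n. X n \<in> A0" "X \<longlonglongrightarrow> x" by (rule in_closureE)
    have "(\<lambda>n. v (X n)) \<longlonglongrightarrow> v x" by (rule bounded_linear.tendsto[OF v_linear X(2)])
    then have "(\<lambda>n. W (v (X n))) \<longlonglongrightarrow> W (v x)"
      using Wcont v_mem unfolding cont_linear_on_def
      by (intro continuous_on_tendsto_compose[of "HH \<psi> r" W]) auto
    moreover have "\<forall>n. W (v (X n)) \<in> Z" using X(1) WA by blast
    ultimately show ?thesis using Z(2) by (metis closure_closed in_closureI)
  qed
  have WZ: "W u \<in> Z" if u: "u \<in> HH \<psi> r" for u
  proof (rule cont_linear_on_range[OF Wcont _ Z _ u])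
    have "subspace (range v)"
      unfolding v_def by (intro csubspace_subspace clinear_range_csubspace pair_clinear \<psi> S)
    then show "HH \<psi> r = closure (span (range v))"
      using pair_dense[OF \<psi> S(3)] unfolding v_def[symmetric] by (simp add: span_eq_iff[THEN iffD2])
  qed (use Wv in auto)
  show "KK p q r \<subseteq> closure (span (\<Lambda> p q r ` coassociated))"
  proof
    fix k assume "k \<in> KK p q r"
    then have k: "k \<in> tensor_space s21 (HH p q) (H r)" by (simp add: KK_eq[OF S])
    have "k \<in> Z"
    proof (rule cont_linear_on_range[OF id tensor_space_def Z _ k])
      fix w assume "w \<in> {s21 x y |x y. x \<in> HH p q \<and> y \<in> H r}"
      then obtain x y where w: "w = s21 x y" "x \<in> HH p q" "y \<in> H r" by blast
      \<comment> \<open>Surjectivity of \<open>V\<close> puts every elementary tensor of the target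
        into the range of \<open>W\<close>.\<close>
      then obtain u where u: "u \<in> H \<psi>" "x = V u" using Vsurj by blast
      then have "w = W (s u y)" using w by (simp add: W(2))
      then show "w \<in> Z" using WZ[OF tensor_space_mem[OF u(1) w(3)]] by simp
    qed
    then show "k \<in> closure (span (\<Lambda> p q r ` coassociated))" by (simp add: Z_def)
  qed
qed

end

text \<open>
  Both sides map \<open>\<Lambda> p q r X\<close> to the vector obtained from \<open>\<Lambda> r q p X\<close> by reversing the legs;
  every factor is moved past \<open>X\<close> by writing \<open>X\<close> in whichever of its two forms suits.
\<close>

theorem yang_baxter:
  assumes S: "p \<in> S0" "q \<in> S0" "r \<in> S0"
  defines "R13 \<equiv> FR p r q \<circ> RL p r q \<circ> FR p q r"
  shows "RL p q r \<circ> R13 \<circ> RR p q r = RR p q r \<circ> R13 \<circ> RL p q r"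
proof -
  note S' = S(1,3,2)
  note bops = RL_bops[OF S] RR_bops[OF S] FR_bops[OF S] RL_bops[OF S'] FR_bops[OF S']
  have R13: "R13 \<in> bops (KK p q r) (KK p q r)"
    unfolding R13_def by (rule bops_compose[OF bops(3) bops_compose[OF bops(4,5)]])
  show ?thesis
  proof (rule bops_eq[OF bops_compose[OF bops(2) bops_compose[OF R13 bops(1)]]
        bops_compose[OF bops(1) bops_compose[OF R13 bops(2)]] coassociated_dense[OF S] KK_csubspace[OF S]])
    fix z assume "z \<in> \<Lambda> p q r ` coassociated"
    then obtain X where z: "z = \<Lambda> p q r X"
      and X: "X \<in> span {t21 (\<Delta>1 a) b | a b. True}" "X \<in> span {t12 a (\<Delta>1 b) | a b. True}"
      by (auto simp: coassociated_def)
    note mem = \<Lambda>_mem[OF S, of X]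
    have a1: "RR p q r z = F23 (\<Lambda> p r q X)" unfolding z by (rule RR_\<Lambda>[OF S X(2)])
    \<comment> \<open>\<open>FR\<close> cancels the flip left behind by \<open>RR\<close>, so the
      next factor meets a plain \<open>\<Lambda>\<close> vector.\<close>
    have "FR p q r (RR p q r z) = \<Lambda> p r q X"
      using bops_mem[OF bops(2) mem] by (simp add: FR_eq[OF S] z) (simp add: z[symmetric] a1)
    then have a2: "RL p r q (FR p q r (RR p q r z)) = F12 (\<Lambda> r p q X)"
      by (simp add: RL_\<Lambda>[OF S' X(1)])
    have "F12 (\<Lambda> r p q X) \<in> KK p r q"
      by (intro KK_mem_F12 \<Lambda>_mem S)
    then have "R13 (RR p q r z) = F23 (F12 (\<Lambda> r p q X))"
      by (simp add: R13_def a2 FR_eq[OF S'])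
    then have A: "RL p q r (R13 (RR p q r z)) = F12 (F23 (F12 (\<Lambda> r q p X)))"
      by (simp add: RL_rotate_\<Lambda>[OF S X(2)])
    have b1: "RL p q r z = F12 (\<Lambda> q p r X)" unfolding z by (rule RL_\<Lambda>[OF S X(1)])
    have "F12 (\<Lambda> q p r X) \<in> KK p q r"
      by (intro KK_mem_F12 \<Lambda>_mem S)
    then have "RL p r q (FR p q r (RL p q r z)) = F12 (F23 (F12 (\<Lambda> q r p X)))"
      by (simp add: b1 FR_eq[OF S] RL_rotate_\<Lambda>[OF S' X(2)])
    moreover have "F12 (F23 (F12 (\<Lambda> q r p X))) \<in> KK p r q"
      by (intro KK_mem_F12 F23_mem \<Lambda>_mem S)
    ultimately have "R13 (RL p q r z) = F23 (F12 (F23 (F12 (\<Lambda> q r p X))))"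
      by (simp add: R13_def FR_eq[OF S'])
    \<comment> \<open>By the braid relation \<open>F23 F12\<close> has order dividing three, so its
      square is the inverse rotation \<open>F12 F23\<close>.\<close>
    also have "\<dots> = F12 (F23 (\<Lambda> q r p X))" by (simp add: F_braid)
    finally have B: "RR p q r (R13 (RL p q r z)) = F12 (F23 (F12 (\<Lambda> r q p X)))"
      by (simp add: RR_rotate_\<Lambda>[OF S X(1)] F_braid)
    show "(RL p q r \<circ> R13 \<circ> RR p q r) z = (RR p q r \<circ> R13 \<circ> RL p q r) z"
      by (simp add: A B)
  qed
qed

end


theorem theorem1p4:
  fixes t :: "'a::cstar_algebra \<Rightarrow> 'a \<Rightarrow> 'b::cstar_algebra"
    and t21 :: "'b \<Rightarrow> 'a \<Rightarrow> 'c::cstar_algebra"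
    and t12 :: "'a \<Rightarrow> 'b \<Rightarrow> 'c"
    and s :: "'h::chilbert_space \<Rightarrow> 'h \<Rightarrow> 'k::chilbert_space"
    and s21 :: "'k \<Rightarrow> 'h \<Rightarrow> 'l::chilbert_space"
    and s12 :: "'h \<Rightarrow> 'k \<Rightarrow> 'l"
    and H :: "('a \<Rightarrow> complex) \<Rightarrow> 'h set"
    and \<pi> :: "('a \<Rightarrow> complex) \<Rightarrow> 'a \<Rightarrow> 'h \<Rightarrow> 'h"
    and \<Omega> :: "('a \<Rightarrow> complex) \<Rightarrow> 'h"
    and \<Delta> :: "'a \<Rightarrow> 'b \<Rightarrow> 'b"
    and S0 :: "('a \<Rightarrow> complex) set"
  assumes gns: "\<And>\<omega>. \<omega> \<in> states \<Longrightarrow> gns_triple \<omega> (H \<omega>) (\<pi> \<omega>) (\<Omega> \<omega>)"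
    and hilbert: "hilbert_tensor3 s s21 s12"
    and tensor: "min_tensor3 s s21 s12 (gns_reps H \<pi>) t t21 t12"
    and bialgebra: "algebraic_bialgebra t t21 t12 \<Delta>"
    and S0: "S0 \<subseteq> states" "S0 \<noteq> {}"
    and closed: "\<And>\<omega>1 \<omega>2. \<omega>1 \<in> S0 \<Longrightarrow> \<omega>2 \<in> S0 \<Longrightarrow> state_conv t \<Delta> \<omega>1 \<omega>2 \<in> S0"
    and abelian: "\<And>\<omega>1 \<omega>2. \<omega>1 \<in> S0 \<Longrightarrow> \<omega>2 \<in> S0 \<Longrightarrow>
           state_conv t \<Delta> \<omega>1 \<omega>2 = state_conv t \<Delta> \<omega>2 \<omega>1"
    and cyclic: "\<And>\<omega>1 \<omega>2. \<omega>1 \<in> S0 \<Longrightarrow> \<omega>2 \<in> S0 \<Longrightarrow>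
           cyclic_vector (tensor_space s (H \<omega>1) (H \<omega>2))
             (rep_conv s t \<Delta> (H \<omega>1) (\<pi> \<omega>1) (H \<omega>2) (\<pi> \<omega>2)) (s (\<Omega> \<omega>1) (\<Omega> \<omega>2))"
  shows
    "let
       HH = (\<lambda>\<omega>1 \<omega>2. tensor_space s (H \<omega>1) (H \<omega>2));
       \<pi>\<pi> = (\<lambda>\<omega>1 \<omega>2. tensor_rep s t (H \<omega>1) (\<pi> \<omega>1) (H \<omega>2) (\<pi> \<omega>2));
       \<Lambda> = (\<lambda>\<omega>1 \<omega>2 X. \<pi>\<pi> \<omega>1 \<omega>2 X (s (\<Omega> \<omega>1) (\<Omega> \<omega>2)));
       \<Delta>1 = (\<lambda>x. of_multiplier (\<Delta> x));
       \<Delta>op = (\<lambda>x. of_multiplier (opposite t \<Delta> x));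
       I = (\<lambda>\<omega>. id_op (H \<omega>));
       \<tau> = (\<lambda>\<omega>1 \<omega>2. flip_op s (H \<omega>1) (H \<omega>2))
     in
     \<exists>R.
       (\<forall>\<omega>1\<in>S0. \<forall>\<omega>2\<in>S0.
          unitary_op (HH \<omega>1 \<omega>2) (HH \<omega>1 \<omega>2) (R \<omega>1 \<omega>2) \<and>
          (\<forall>x. R \<omega>1 \<omega>2 (\<Lambda> \<omega>1 \<omega>2 (\<Delta>1 x)) = \<Lambda> \<omega>1 \<omega>2 (\<Delta>op x)) \<and>
          (\<forall>T \<in> bops (HH \<omega>1 \<omega>2) (HH \<omega>1 \<omega>2).
             (\<forall>x. T (\<Lambda> \<omega>1 \<omega>2 (\<Delta>1 x)) = \<Lambda> \<omega>1 \<omega>2 (\<Delta>op x)) \<longrightarrow> T = R \<omega>1 \<omega>2)) \<and>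
       (\<forall>\<omega>1\<in>S0. \<forall>\<omega>2\<in>S0. \<forall>x.
          R \<omega>1 \<omega>2 \<circ> \<pi>\<pi> \<omega>1 \<omega>2 (\<Delta>1 x) \<circ> adj_op (HH \<omega>1 \<omega>2) (HH \<omega>1 \<omega>2) (R \<omega>1 \<omega>2)
            = \<pi>\<pi> \<omega>1 \<omega>2 (\<Delta>op x)) \<and>
       (\<forall>\<omega>1\<in>S0. \<forall>\<omega>2\<in>S0.
          R \<omega>1 \<omega>2 \<circ> \<tau> \<omega>2 \<omega>1 \<circ> R \<omega>2 \<omega>1 \<circ> \<tau> \<omega>1 \<omega>2
            = tensor_op s (H \<omega>1) (H \<omega>2) (I \<omega>1) (I \<omega>2)) \<and>
       (\<forall>\<omega>1\<in>S0. \<forall>\<omega>2\<in>S0.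
          unitarily_equivalent
            (HH \<omega>1 \<omega>2) (rep_conv s t \<Delta> (H \<omega>1) (\<pi> \<omega>1) (H \<omega>2) (\<pi> \<omega>2))
            (HH \<omega>2 \<omega>1) (rep_conv s t \<Delta> (H \<omega>2) (\<pi> \<omega>2) (H \<omega>1) (\<pi> \<omega>1))) \<and>
       (\<forall>\<omega>1\<in>S0. \<forall>\<omega>2\<in>S0. \<forall>\<omega>3\<in>S0.
          let R12 = tensor_op s21 (HH \<omega>1 \<omega>2) (H \<omega>3) (R \<omega>1 \<omega>2) (I \<omega>3);
              R23 = tensor_op s12 (H \<omega>1) (HH \<omega>2 \<omega>3) (I \<omega>1) (R \<omega>2 \<omega>3);
              R13 = tensor_op s12 (H \<omega>1) (HH \<omega>3 \<omega>2) (I \<omega>1) (\<tau> \<omega>3 \<omega>2)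
                      \<circ> tensor_op s21 (HH \<omega>1 \<omega>3) (H \<omega>2) (R \<omega>1 \<omega>3) (I \<omega>2)
                      \<circ> tensor_op s12 (H \<omega>1) (HH \<omega>2 \<omega>3) (I \<omega>1) (\<tau> \<omega>2 \<omega>3)
          in R12 \<circ> R13 \<circ> R23 = R23 \<circ> R13 \<circ> R12)"
proof -
  interpret abelian_states t t21 t12 s s21 s12 H \<pi> \<Omega> \<Delta> S0
    by unfold_locales (rule gns hilbert tensor bialgebra S0(1) closed abelian cyclic; assumption)+
  \<comment> \<open>The vectors of \<open>\<Delta>1 x\<close> are dense, so the formula admits no
    second bounded operator; this is the sense in which it defines \<open>R\<close>.\<close>
  have unique: "U = R p q"
    if S: "p \<in> S0" "q \<in> S0" and U: "U \<in> bops (HH p q) (HH p q)"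
      "\<forall>x. U (vec p q (\<Delta>1 x)) = vec p q (\<Delta>op x)" for p q U
    by (rule pair_bops_eq[OF S U(1) R_bops[OF S]]) (simp add: U(2) R_apply[OF S])
  show ?thesis
    unfolding Let_def T.of_multiplier_opposite[OF bialgebra]
    by (intro exI[of _ R] conjI ballI allI impI)
      (simp_all add: R_unitary R_apply unique R_conj R_flip_R rep_conv_equivalent
        yang_baxter[unfolded RL_def RR_def FR_def])
qed

end
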